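(* Let $X$ be a wedge of two circles. There exist finite $2$-step nilpotent groups $G$ and $G$-covers $Y\to X$ given by surjections $\phi:\pi_1(X)=F_2\to G$ such that $\operatorname{Irr^{pr}}(\phi,G)\subsetneq\operatorname{Irr}(G)$ and $H_1^{\mathrm{prim}}(Y;\mathbb{C})\subsetneq H_1(Y;\mathbb{C})$.
   Context: $F_2$ is the free group of rank $2$; an element of $F_2$ is primitive if it is part of a free basis. The $G$-cover $Y\to X$ given by a surjection $\phi:\pi_1(X)\to G$ is the connected regular cover with $\pi_1(Y)=\ker\phi$ and deck group $G$. A group is $2$-step nilpotent if its commutator subgroup is contained in its center. Fix a basepoint $x_0\in X$ and a lift $\hat x_0\in Y$. For a loop $\gamma$ in $X$ at $x_0$, the preferred elevation is the lift at $\hat x_0$ of the smallest power $\gamma^k$ ($k\ge1$) that lifts to a closed loop in $Y$; its images under deck transformations are the elevations of $\gamma$. The primitive homology $H_1^{\mathrm{prim}}(Y;\mathbb{C})\subseteq H_1(Y;\mathbb{C})$ is the $\mathbb{C}$-span of the homology classes of all elevations of loops representing primitive elements of $\pi_1(X)$. $\operatorname{Irr}(G)$ is the set of isomorphism classes of complex irreducible $G$-representations. $\operatorname{Irr^{pr}}(\phi,G)\subseteq\operatorname{Irr}(G)$ is the set of irreducible representations $V$ such that $\phi(\gamma)(v)=v$ for some primitive $\gamma\in F_2$ and some nonzero $v\in V$. *)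

theory Defs
  imports
    "HOL-Analysis.Analysis"
    "HOL-Homology.Homology"
    "HOL-Algebra.Bij"
    "HOL-Algebra.Generated_Groups"
    "Jordan_Normal_Form.Matrix"
begin

subsection \<open>Free bases, primitive elements, 2-step nilpotency\<close>

text \<open>A word is a list of letters \<open>(b, e)\<close>, where \<open>(b, True)\<close> stands for \<open>b\<close> and
  \<open>(b, False)\<close> for its inverse.\<close>

definition word_value :: "('a, 'm) monoid_scheme \<Rightarrow> ('a \<times> bool) list \<Rightarrow> 'a" where
  "word_value G w =
     foldr (\<lambda>(b, e) x. (if e then b else inv\<^bsub>G\<^esub> b) \<otimes>\<^bsub>G\<^esub> x) w \<one>\<^bsub>G\<^esub>"

definition reduced_word :: "('a \<times> bool) list \<Rightarrow> bool" where
  "reduced_word w \<longleftrightarrow>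
     (\<forall>i. Suc i < length w \<longrightarrow>
        \<not> (fst (w ! i) = fst (w ! Suc i) \<and> snd (w ! i) \<noteq> snd (w ! Suc i)))"

definition free_basis :: "('a, 'm) monoid_scheme \<Rightarrow> 'a set \<Rightarrow> bool" where
  "free_basis G B \<longleftrightarrow>
     B \<subseteq> carrier G \<and> generate G B = carrier G \<and>
     (\<forall>w. fst ` set w \<subseteq> B \<and> reduced_word w \<and> w \<noteq> [] \<longrightarrow> word_value G w \<noteq> \<one>\<^bsub>G\<^esub>)"

definition primitive_element :: "('a, 'm) monoid_scheme \<Rightarrow> 'a \<Rightarrow> bool" where
  "primitive_element G x \<longleftrightarrow> (\<exists>B. free_basis G B \<and> x \<in> B)"

definition group_center :: "('a, 'm) monoid_scheme \<Rightarrow> 'a set" where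
  "group_center G = {z \<in> carrier G. \<forall>x \<in> carrier G. z \<otimes>\<^bsub>G\<^esub> x = x \<otimes>\<^bsub>G\<^esub> z}"

definition two_step_nilpotent :: "('a, 'm) monoid_scheme \<Rightarrow> bool" where
  "two_step_nilpotent G \<longleftrightarrow> group G \<and> derived G (carrier G) \<subseteq> group_center G"


subsection \<open>The fundamental group\<close>

definition loops :: "'a::topological_space set \<Rightarrow> 'a \<Rightarrow> (real \<Rightarrow> 'a) set" where
  "loops S x = {g. path g \<and> path_image g \<subseteq> S \<and> pathstart g = x \<and> pathfinish g = x}"

definition loop_class :: "'a::topological_space set \<Rightarrow> (real \<Rightarrow> 'a) \<Rightarrow> (real \<Rightarrow> 'a) set" where
  "loop_class S g = {h. homotopic_paths S g h}"

definition fundamental_group ::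
    "'a::topological_space set \<Rightarrow> 'a \<Rightarrow> (real \<Rightarrow> 'a) set monoid" where
  "fundamental_group S x =
     \<lparr>carrier = loop_class S ` loops S x,
      mult = (\<lambda>A B. {h. \<exists>a \<in> A. \<exists>b \<in> B. homotopic_paths S (a +++ b) h}),
      one = loop_class S (\<lambda>_. x)\<rparr>"

text \<open>The wedge of two circles; the wedge point is \<open>0\<close>.\<close>

definition figure_eight :: "complex set" where
  "figure_eight = sphere (-1) 1 \<union> sphere 1 1"


subsection \<open>Regular covers and elevations\<close>

text \<open>As in \<^const>\<open>BijGroup\<close>, maps are made extensional so that a deck transformation is
  determined by its values on \<open>Y\<close>.\<close>

definition deck_transformations ::
    "'b::topological_space set \<Rightarrow> ('b \<Rightarrow> 'a) \<Rightarrow> ('b \<Rightarrow> 'b) set" where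
  "deck_transformations Y p =
     {h \<in> Bij Y. homeomorphism Y Y h (inv_into Y h) \<and> (\<forall>y \<in> Y. p (h y) = p y)}"

definition deck_group ::
    "'b::topological_space set \<Rightarrow> ('b \<Rightarrow> 'a) \<Rightarrow> ('b \<Rightarrow> 'b) monoid" where
  "deck_group Y p = (BijGroup Y)\<lparr>carrier := deck_transformations Y p\<rparr>"

text \<open>\<open>p : Y \<rightarrow> X\<close> is the \<open>G\<close>-cover given by the surjection \<open>\<phi>\<close>, with the lift \<open>y0\<close> of the
  basepoint \<open>x0\<close>; the subgroup \<open>\<pi>\<^sub>1(Y)\<close> of \<open>\<pi>\<^sub>1(X)\<close> is the image of the injection induced
  by \<open>p\<close>.\<close>

definition is_G_cover ::
    "'a::topological_space set \<Rightarrow> 'a \<Rightarrow> ('g, 'm) monoid_scheme \<Rightarrow> ((real \<Rightarrow> 'a) set \<Rightarrow> 'g) \<Rightarrow>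
     'b::topological_space set \<Rightarrow> ('b \<Rightarrow> 'a) \<Rightarrow> 'b \<Rightarrow> bool" where
  "is_G_cover X x0 G \<phi> Y p y0 \<longleftrightarrow>
     \<phi> \<in> epi (fundamental_group X x0) G \<and>
     covering_space Y p X \<and> connected Y \<and> y0 \<in> Y \<and> p y0 = x0 \<and>
     (\<forall>y \<in> Y. \<forall>y' \<in> Y. p y = p y' \<longrightarrow> (\<exists>h \<in> deck_transformations Y p. h y = y')) \<and>
     (\<lambda>d. loop_class X (p \<circ> d)) ` loops Y y0 = kernel (fundamental_group X x0) G \<phi> \<and>
     deck_group Y p \<cong> G"

definition is_lift ::
    "'b::topological_space set \<Rightarrow> ('b \<Rightarrow> 'a) \<Rightarrow> 'b \<Rightarrow> (real \<Rightarrow> 'a) \<Rightarrow> (real \<Rightarrow> 'b) \<Rightarrow> bool" where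
  "is_lift Y p y0 g h \<longleftrightarrow>
     path h \<and> path_image h \<subseteq> Y \<and> pathstart h = y0 \<and> (\<forall>t \<in> {0..1}. p (h t) = g t)"

text \<open>The loop \<open>g\<close> traversed \<open>k\<close> times at constant speed.\<close>

definition loop_power :: "(real \<Rightarrow> 'a) \<Rightarrow> nat \<Rightarrow> real \<Rightarrow> 'a" where
  "loop_power g k = (\<lambda>t. g (frac (real k * t)))"

definition preferred_elevation ::
    "'b::topological_space set \<Rightarrow> ('b \<Rightarrow> 'a) \<Rightarrow> 'b \<Rightarrow> (real \<Rightarrow> 'a) \<Rightarrow> (real \<Rightarrow> 'b) \<Rightarrow> bool" where
  "preferred_elevation Y p y0 g h \<longleftrightarrow>
     (\<exists>k \<ge> 1. is_lift Y p y0 (loop_power g k) h \<and> pathfinish h = pathstart h \<and>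
        (\<forall>j h'. 1 \<le> j \<and> j < k \<and> is_lift Y p y0 (loop_power g j) h' \<longrightarrow>
           pathfinish h' \<noteq> pathstart h'))"

definition elevations ::
    "'b::topological_space set \<Rightarrow> ('b \<Rightarrow> 'a) \<Rightarrow> 'b \<Rightarrow> (real \<Rightarrow> 'a) \<Rightarrow> (real \<Rightarrow> 'b) set" where
  "elevations Y p y0 g =
     {\<tau> \<circ> h | \<tau> h. \<tau> \<in> deck_transformations Y p \<and> preferred_elevation Y p y0 g h}"


subsection \<open>Singular homology with complex coefficients\<close>

text \<open>HOL-Homology has singular chains with integer coefficients only. We keep its singular
  simplices and faces and take coefficients in \<^typ>\<open>complex\<close>.\<close>

type_synonym 'a cchain = "((nat \<Rightarrow> real) \<Rightarrow> 'a) \<Rightarrow>\<^sub>0 complex"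

definition cscale :: "complex \<Rightarrow> 'a cchain \<Rightarrow> 'a cchain" where
  "cscale a c = Poly_Mapping.map (\<lambda>z. a * z) c"

definition cchains :: "nat \<Rightarrow> 'a topology \<Rightarrow> 'a cchain set" where
  "cchains n T = {c. \<forall>f \<in> Poly_Mapping.keys c. singular_simplex n T f}"

definition cboundary :: "nat \<Rightarrow> 'a cchain \<Rightarrow> 'a cchain" where
  "cboundary n c =
     (if n = 0 then 0
      else \<Sum>f \<in> Poly_Mapping.keys c. \<Sum>k\<le>n.
             Poly_Mapping.single (singular_face n k f) ((-1) ^ k * Poly_Mapping.lookup c f))"

definition ccycles :: "nat \<Rightarrow> 'a topology \<Rightarrow> 'a cchain set" where
  "ccycles n T = {c \<in> cchains n T. cboundary n c = 0}"

definition cboundaries :: "nat \<Rightarrow> 'a topology \<Rightarrow> 'a cchain set" where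
  "cboundaries n T = cboundary (Suc n) ` cchains (Suc n) T"

text \<open>Homology classes are cosets of \<^const>\<open>cboundaries\<close>.\<close>

definition hclass :: "nat \<Rightarrow> 'a topology \<Rightarrow> 'a cchain \<Rightarrow> 'a cchain set" where
  "hclass n T z = {z + b | b. b \<in> cboundaries n T}"

definition homology_C :: "nat \<Rightarrow> 'a topology \<Rightarrow> 'a cchain set set" where
  "homology_C n T = hclass n T ` ccycles n T"

definition hadd :: "'a cchain set \<Rightarrow> 'a cchain set \<Rightarrow> 'a cchain set" where
  "hadd A B = {a + b | a b. a \<in> A \<and> b \<in> B}"

text \<open>Adding the boundaries matters only for the scalar \<open>0\<close>.\<close>

definition hscale :: "nat \<Rightarrow> 'a topology \<Rightarrow> complex \<Rightarrow> 'a cchain set \<Rightarrow> 'a cchain set" where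
  "hscale n T c A = {cscale c a + b | a b. a \<in> A \<and> b \<in> cboundaries n T}"

definition homology_subspace :: "nat \<Rightarrow> 'a topology \<Rightarrow> 'a cchain set set \<Rightarrow> bool" where
  "homology_subspace n T U \<longleftrightarrow>
     U \<subseteq> homology_C n T \<and> hclass n T 0 \<in> U \<and>
     (\<forall>A \<in> U. \<forall>B \<in> U. hadd A B \<in> U) \<and> (\<forall>c. \<forall>A \<in> U. hscale n T c A \<in> U)"

definition homology_span ::
    "nat \<Rightarrow> 'a topology \<Rightarrow> 'a cchain set set \<Rightarrow> 'a cchain set set" where
  "homology_span n T S = \<Inter> {U. homology_subspace n T U \<and> S \<subseteq> U}"

text \<open>A path as a singular 1-simplex, running from vertex \<open>0\<close> to vertex \<open>1\<close>.\<close>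

definition path_simplex :: "(real \<Rightarrow> 'a) \<Rightarrow> (nat \<Rightarrow> real) \<Rightarrow> 'a" where
  "path_simplex h = restrict (\<lambda>x. h (x 1)) (standard_simplex 1)"

definition loop_homology_class ::
    "'a::topological_space set \<Rightarrow> (real \<Rightarrow> 'a) \<Rightarrow> 'a cchain set" where
  "loop_homology_class Y h =
     hclass 1 (top_of_set Y) (Poly_Mapping.single (path_simplex h) 1)"

definition H1_C :: "'b::topological_space set \<Rightarrow> 'b cchain set set" where
  "H1_C Y = homology_C 1 (top_of_set Y)"

definition H1_prim ::
    "'a::topological_space set \<Rightarrow> 'a \<Rightarrow> 'b::topological_space set \<Rightarrow> ('b \<Rightarrow> 'a) \<Rightarrow> 'b \<Rightarrow>
     'b cchain set set" where
  "H1_prim X x0 Y p y0 =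
     homology_span 1 (top_of_set Y)
       {loop_homology_class Y e | e g.
          g \<in> loops X x0 \<and> primitive_element (fundamental_group X x0) (loop_class X g) \<and>
          e \<in> elevations Y p y0 g}"


subsection \<open>Complex irreducible representations\<close>

text \<open>Every irreducible representation of a finite group is finite dimensional, hence isomorphic
  to a representation on some \<open>\<complex>\<^sup>n\<close>. A pair \<open>(n, \<rho>)\<close> is a matrix representation
  of degree \<open>n\<close>; the values of \<open>\<rho>\<close> off the carrier play no role in \<open>rep_isomorphic\<close>.\<close>

type_synonym 'g matrix_rep = "nat \<times> ('g \<Rightarrow> complex mat)"

definition is_rep :: "('g, 'm) monoid_scheme \<Rightarrow> 'g matrix_rep \<Rightarrow> bool" where
  "is_rep G = (\<lambda>(n, \<rho>).
     (\<forall>g \<in> carrier G. \<rho> g \<in> carrier_mat n n) \<and> \<rho> \<one>\<^bsub>G\<^esub> = 1\<^sub>m n \<and>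
     (\<forall>g \<in> carrier G. \<forall>h \<in> carrier G. \<rho> (g \<otimes>\<^bsub>G\<^esub> h) = \<rho> g * \<rho> h))"

definition vec_subspace :: "nat \<Rightarrow> complex vec set \<Rightarrow> bool" where
  "vec_subspace n W \<longleftrightarrow>
     W \<subseteq> carrier_vec n \<and> 0\<^sub>v n \<in> W \<and> (\<forall>v \<in> W. \<forall>w \<in> W. v + w \<in> W) \<and>
     (\<forall>c. \<forall>v \<in> W. c \<cdot>\<^sub>v v \<in> W)"

definition irreducible_reps :: "('g, 'm) monoid_scheme \<Rightarrow> 'g matrix_rep set" where
  "irreducible_reps G = {(n, \<rho>). is_rep G (n, \<rho>) \<and> 0 < n \<and>
     (\<forall>W. vec_subspace n W \<and> (\<forall>g \<in> carrier G. \<forall>w \<in> W. \<rho> g *\<^sub>v w \<in> W) \<longrightarrow>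
        W = {0\<^sub>v n} \<or> W = carrier_vec n)}"

definition rep_isomorphic :: "('g, 'm) monoid_scheme \<Rightarrow> 'g matrix_rep \<Rightarrow> 'g matrix_rep \<Rightarrow> bool" where
  "rep_isomorphic G = (\<lambda>(n, \<rho>) (m, \<sigma>).
     \<exists>P \<in> carrier_mat m n. \<exists>Q \<in> carrier_mat n m. P * Q = 1\<^sub>m m \<and> Q * P = 1\<^sub>m n \<and>
       (\<forall>g \<in> carrier G. P * \<rho> g = \<sigma> g * P))"

definition irrep_iso_rel :: "('g, 'm) monoid_scheme \<Rightarrow> ('g matrix_rep \<times> 'g matrix_rep) set" where
  "irrep_iso_rel G =
     {(V, W). V \<in> irreducible_reps G \<and> W \<in> irreducible_reps G \<and> rep_isomorphic G V W}"

definition Irr :: "('g, 'm) monoid_scheme \<Rightarrow> 'g matrix_rep set set" where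
  "Irr G = irreducible_reps G // irrep_iso_rel G"

definition Irr_pr ::
    "('f, 'k) monoid_scheme \<Rightarrow> ('f \<Rightarrow> 'g) \<Rightarrow> ('g, 'm) monoid_scheme \<Rightarrow> 'g matrix_rep set set" where
  "Irr_pr F \<phi> G =
     {(n, \<rho>) \<in> irreducible_reps G.
        \<exists>\<gamma> v. primitive_element F \<gamma> \<and> v \<in> carrier_vec n \<and> v \<noteq> 0\<^sub>v n \<and> \<rho> (\<phi> \<gamma>) *\<^sub>v v = v}
     // irrep_iso_rel G"

end

theory Submission
  imports Defs
begin

text \<open>
  The example is the quaternion group \<open>{1, -1, i, -i, j, -j, k, -k}\<close>, with \<open>\<phi>\<close> sending the loops
  around the two circles to \<open>i\<close> and \<open>j\<close>. Everything rests on one fact: a primitive element is sent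
  to some \<open>q\<close> with \<open>q\<^sup>2 = -1\<close> (\<open>primitive_value_square\<close>). Indeed, counting modulo 2 the occurrences
  of a basis element \<open>x\<close> in words over a free basis is a homomorphism to \<open>\<int>/2\<close> that does not vanish
  at \<open>x\<close> (\<open>free_basis_parity_hom\<close>). The two standard loops generate the fundamental group
  (\<open>fundamental_group_figure_eight_generated\<close>), so every homomorphism to \<open>\<int>/2\<close> factors through
  the quotient \<open>(\<int>/2)\<^sup>2\<close> of the quaternion group by its centre \<open>{1, -1}\<close>. Hence \<open>\<phi>(x)\<close> is
  not central, and the six noncentral quaternions all square to \<open>-1\<close>.

  Representations: in the irreducible representation of degree 2 the element \<open>-1\<close> acts as the
  scalar \<open>-1\<close>, so an element with square \<open>-1\<close> fixes no nonzero vector, and this representation is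
  missing from \<open>Irr_pr\<close> (\<open>Irr_pr_Q8_proper\<close>).

  Homology: an elevation of a primitive loop closes up after exactly four turns, and the deck
  transformation \<open>-1\<close> rotates it by half a period, so its homology class is fixed by \<open>-1\<close>.
  Classes that are not fixed by \<open>-1\<close> are detected by a nowhere vanishing function \<open>F\<close> on the cover
  with \<open>F(-y)\<close> conjugate to \<open>F(y)\<close>: the change of the argument of \<open>F\<close> along a path is a
  cocycle on singular chains, it changes sign under \<open>-1\<close> and therefore vanishes on these elevations, while it
  is \<open>-2\<pi>\<close> on the cycle through the vertices \<open>1, i, k, -j\<close> (\<open>H1_prim_proper\<close>).

  The cover lives in \<open>\<complex>\<^sup>2\<close>, identified with the quaternions: it is the Cayley graph of the
  group, with the great circle arcs \<open>g e\<^sup>i\<^sup>t\<close> and \<open>g e\<^sup>j\<^sup>t\<close> for edges, so that deck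
  transformations are left multiplications and the projection is a polynomial expression in the coordinates and
  their conjugates.
\<close>

section \<open>The fundamental group\<close>

lemma loop_class_eq_iff:
  assumes "g \<in> loops S x" "h \<in> loops S x"
  shows "loop_class S g = loop_class S h \<longleftrightarrow> homotopic_paths S g h"
proof
  assume "loop_class S g = loop_class S h"
  moreover have "h \<in> loop_class S h"
    using assms by (auto simp: loop_class_def loops_def)
  ultimately show "homotopic_paths S g h" by (auto simp: loop_class_def)
next
  assume "homotopic_paths S g h"
  then show "loop_class S g = loop_class S h"
    unfolding loop_class_def using homotopic_paths_sym homotopic_paths_trans by blast
qed

lemma loops_join: "g \<in> loops S x \<Longrightarrow> h \<in> loops S x \<Longrightarrow> g +++ h \<in> loops S x"
  by (auto simp: loops_def path_image_join)

lemma loops_reversepath: "g \<in> loops S x \<Longrightarrow> reversepath g \<in> loops S x"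
  by (auto simp: loops_def)

lemma loops_const: "x \<in> S \<Longrightarrow> (\<lambda>_. x) \<in> loops S x"
  by (auto simp: loops_def path_def path_image_def pathstart_def pathfinish_def)

lemma loop_class_self: "g \<in> loops S x \<Longrightarrow> g \<in> loop_class S g"
  by (auto simp: loop_class_def loops_def)

lemma mult_loop_class:
  assumes "g \<in> loops S x" "h \<in> loops S x"
  shows "loop_class S g \<otimes>\<^bsub>fundamental_group S x\<^esub> loop_class S h = loop_class S (g +++ h)"
proof (intro equalityI subsetI)
  fix k assume "k \<in> loop_class S g \<otimes>\<^bsub>fundamental_group S x\<^esub> loop_class S h"
  then obtain a b where ab: "homotopic_paths S g a" "homotopic_paths S h b"
    "homotopic_paths S (a +++ b) k"
    by (auto simp: fundamental_group_def loop_class_def)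
  have "homotopic_paths S (g +++ h) (a +++ b)"
    using ab assms by (intro homotopic_paths_join) (auto simp: loops_def)
  then show "k \<in> loop_class S (g +++ h)"
    using ab(3) homotopic_paths_trans by (auto simp: loop_class_def)
next
  fix k assume "k \<in> loop_class S (g +++ h)"
  then show "k \<in> loop_class S g \<otimes>\<^bsub>fundamental_group S x\<^esub> loop_class S h"
    using loop_class_self[OF assms(1)] loop_class_self[OF assms(2)]
    unfolding fundamental_group_def monoid.simps loop_class_def by blast
qed

lemma carrier_fundamental_group: "carrier (fundamental_group S x) = loop_class S ` loops S x"
  by (simp add: fundamental_group_def)

lemma one_fundamental_group: "\<one>\<^bsub>fundamental_group S x\<^esub> = loop_class S (\<lambda>_. x)"
  by (simp add: fundamental_group_def)

lemma loop_class_eqI: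
  assumes "g \<in> loops S x" "h \<in> loops S x" "homotopic_paths S g h"
  shows "loop_class S g = loop_class S h"
  using assms loop_class_eq_iff by blast

lemma group_fundamental_group:
  fixes S :: "'a::real_normed_vector set"
  assumes "x \<in> S"
  shows "group (fundamental_group S x)"
proof (rule groupI)
  fix A assume "A \<in> carrier (fundamental_group S x)"
  then obtain g where g: "g \<in> loops S x" "A = loop_class S g"
    by (auto simp: carrier_fundamental_group)
  have c: "(\<lambda>_. x) = linepath x x" by (simp add: linepath_def fun_eq_iff flip: scaleR_left_distrib)
  have "homotopic_paths S ((\<lambda>_. x) +++ g) g"
    using homotopic_paths_lid'[of g S x] g by (auto simp: loops_def c)
  then show "\<one>\<^bsub>fundamental_group S x\<^esub> \<otimes>\<^bsub>fundamental_group S x\<^esub> A = A"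
    using g assms loop_class_eqI[of "(\<lambda>_. x) +++ g" S x g]
    by (simp add: one_fundamental_group mult_loop_class loops_const loops_join)
  have "homotopic_paths S (reversepath g +++ g) (\<lambda>_. x)"
    using homotopic_paths_linv[of g S] g by (auto simp: loops_def c)
  then show "\<exists>B\<in>carrier (fundamental_group S x). B \<otimes>\<^bsub>fundamental_group S x\<^esub> A = \<one>\<^bsub>fundamental_group S x\<^esub>"
    using g assms loop_class_eqI[of "reversepath g +++ g" S x "\<lambda>_. x"]
    by (intro bexI[of _ "loop_class S (reversepath g)"])
     (auto simp: one_fundamental_group mult_loop_class loops_reversepath carrier_fundamental_group
        loops_join loops_const)
next
  fix A B C assume "A \<in> carrier (fundamental_group S x)" "B \<in> carrier (fundamental_group S x)"
    "C \<in> carrier (fundamental_group S x)"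
  then obtain f g h where g: "f \<in> loops S x" "A = loop_class S f" "g \<in> loops S x" "B = loop_class S g"
     "h \<in> loops S x" "C = loop_class S h"
    by (auto simp: carrier_fundamental_group)
  have "homotopic_paths S ((f +++ g) +++ h) (f +++ (g +++ h))"
    using homotopic_paths_assoc[of f S g h] g by (auto simp: loops_def homotopic_paths_sym)
  then show "A \<otimes>\<^bsub>fundamental_group S x\<^esub> B \<otimes>\<^bsub>fundamental_group S x\<^esub> C =
     A \<otimes>\<^bsub>fundamental_group S x\<^esub> (B \<otimes>\<^bsub>fundamental_group S x\<^esub> C)"
    using g loop_class_eqI[of "(f +++ g) +++ h" S x "f +++ (g +++ h)"]
    by (simp add: mult_loop_class loops_join)
qed (auto simp: carrier_fundamental_group one_fundamental_group mult_loop_class loops_join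
    loops_const assms)

section \<open>Galois coverings and their monodromy\<close>

locale free_group_action = group G for G (structure) +
  fixes Y :: "'y::real_normed_vector set"
    and p :: "'y \<Rightarrow> 'x::real_normed_vector" and act :: "'a \<Rightarrow> 'y \<Rightarrow> 'y"
  assumes act_in: "g \<in> carrier G \<Longrightarrow> y \<in> Y \<Longrightarrow> act g y \<in> Y"
    and act_cont: "g \<in> carrier G \<Longrightarrow> continuous_on Y (act g)"
    and p_act: "g \<in> carrier G \<Longrightarrow> y \<in> Y \<Longrightarrow> p (act g y) = p y"
    and act_one: "y \<in> Y \<Longrightarrow> act \<one> y = y"
    and act_mult: "g \<in> carrier G \<Longrightarrow> h \<in> carrier G \<Longrightarrow> y \<in> Y \<Longrightarrow> act (g \<otimes> h) y = act g (act h y)"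
    and act_free: "g \<in> carrier G \<Longrightarrow> y \<in> Y \<Longrightarrow> act g y = y \<Longrightarrow> g = \<one>"
    and act_trans: "y \<in> Y \<Longrightarrow> y' \<in> Y \<Longrightarrow> p y = p y' \<Longrightarrow> \<exists>g\<in>carrier G. act g y = y'"
begin

lemma act_inv_left: "g \<in> carrier G \<Longrightarrow> y \<in> Y \<Longrightarrow> act (inv g) (act g y) = y"
  using act_mult[of "inv g" g y] act_one[of y] by simp

lemma act_inj:
  assumes "g \<in> carrier G" "h \<in> carrier G" "y \<in> Y" "act g y = act h y"
  shows "g = h"
proof -
  have "act (inv h \<otimes> g) y = y"
    using act_mult[of "inv h" g y] act_inv_left[of h y] assms by simp
  then have "inv h \<otimes> g = \<one>"
    using assms act_free[of "inv h \<otimes> g" y] by simp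
  then show ?thesis
    using assms inv_equality[of "inv h" g] inv_inv[of g] inv_inv[of h] inv_closed[of h] by metis
qed

text \<open>Over the domain \<open>T\<close> of a local section \<open>s\<close> the sheets are the translates \<open>g s(T)\<close>. Each is the
fixed point set of \<open>y \<mapsto> g s(p(y))\<close>, hence closed in the preimage of \<open>T\<close>, and as finitely many of them
partition the preimage they are also open.\<close>

lemma covering_space_quotient:
  fixes X :: "'x set"
  assumes fin: "finite (carrier G)" and cont: "continuous_on Y p"
    and local_section: "\<And>x. x \<in> X \<Longrightarrow> \<exists>T s. x \<in> T \<and> openin (top_of_set X) T \<and>
        continuous_on T s \<and> s ` T \<subseteq> Y \<and> (\<forall>z\<in>T. p (s z) = z)"
    and pX: "p ` Y \<subseteq> X"
  shows "covering_space Y p X"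
proof
  show "p ` Y = X"
  proof
    show "X \<subseteq> p ` Y"
    proof
      fix x assume "x \<in> X"
      then obtain T s where "x \<in> T" "s ` T \<subseteq> Y" "\<forall>z\<in>T. p (s z) = z"
        using local_section by blast
      then show "x \<in> p ` Y" by (intro image_eqI[of _ _ "s x"]) auto
    qed
  qed (rule pX)
  show "continuous_on Y p" by fact
  fix x assume "x \<in> X"
  then obtain T s where x: "x \<in> T" and T: "openin (top_of_set X) T"
    and s: "continuous_on T s" "s ` T \<subseteq> Y" "\<forall>z\<in>T. p (s z) = z"
    using local_section[of x] by blast
  define U where "U = Y \<inter> p -` T"
  define sheet where "sheet g = (\<lambda>z. act g (s z)) ` T" for g
  have U_open: "openin (top_of_set Y) U"
    unfolding U_def by (rule continuous_openin_preimage[OF cont _ T]) (use pX in auto)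
  have sheet_eq: "sheet g = {y \<in> U. act g (s (p y)) = y}" if "g \<in> carrier G" for g
    
  proof (intro equalityI subsetI)
    fix y assume "y \<in> sheet g"
    then obtain z where z: "z \<in> T" "y = act g (s z)" by (auto simp: sheet_def)
    then have "s z \<in> Y" "p y = z" using s p_act[OF that] by auto
    then show "y \<in> {y \<in> U. act g (s (p y)) = y}" using z act_in[OF that] by (simp add: U_def)
  next
    fix y assume "y \<in> {y \<in> U. act g (s (p y)) = y}"
    then show "y \<in> sheet g" unfolding sheet_def U_def by (metis (mono_tags, lifting) IntD2 image_eqI mem_Collect_eq vimageD)
  qed
  have cont_act_s: "continuous_on T (\<lambda>z. act g (s z))" if "g \<in> carrier G" for g
    using continuous_on_compose2[OF act_cont[OF that] s(1)] s(2) by auto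
  have sheet_closed: "closedin (top_of_set U) (sheet g)" if "g \<in> carrier G" for g
  proof -
    have "continuous_on U (\<lambda>y. act g (s (p y)))"
      by (rule continuous_on_compose2[OF cont_act_s[OF that]])
        (auto simp: U_def intro: continuous_on_subset[OF cont])
    then have "continuous_on U (\<lambda>y. act g (s (p y)) - y)"
      by (intro continuous_intros)
    from continuous_closedin_preimage_constant[OF this, of 0]
    show ?thesis by (simp add: sheet_eq[OF that] vimage_def Int_def)
  qed
  have sheets: "\<Union> (sheet ` carrier G) = U"
  proof
    show "\<Union> (sheet ` carrier G) \<subseteq> U" using sheet_eq by auto
    show "U \<subseteq> \<Union> (sheet ` carrier G)"
    proof
      fix y assume y: "y \<in> U"
      then have "s (p y) \<in> Y" "p (s (p y)) = p y" "y \<in> Y" using s by (auto simp: U_def)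
      then obtain g where "g \<in> carrier G" "act g (s (p y)) = y" using act_trans by blast
      then show "y \<in> \<Union> (sheet ` carrier G)" using y sheet_eq by blast
    qed
  qed
  have disj: "sheet g \<inter> sheet h = {}" if gh: "g \<in> carrier G" "h \<in> carrier G" "g \<noteq> h" for g h
  proof (rule ccontr)
    assume "sheet g \<inter> sheet h \<noteq> {}"
    then obtain y where "y \<in> U" "act g (s (p y)) = y" "act h (s (p y)) = y"
      using sheet_eq[OF gh(1)] sheet_eq[OF gh(2)] by blast
    moreover have "s (p y) \<in> Y" using s \<open>y \<in> U\<close> by (auto simp: U_def)
    ultimately show False using act_inj[OF gh(1,2)] gh(3) by metis
  qed
  have sheet_open: "openin (top_of_set Y) (sheet g)" if "g \<in> carrier G" for g
  proof -
    have eq: "sheet g = U - \<Union> (sheet ` (carrier G - {g}))"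
      using sheets disj that by blast
    have "closedin (top_of_set U) (\<Union> (sheet ` (carrier G - {g})))"
      using fin sheet_closed by (intro closedin_Union) auto
    then have "openin (top_of_set U) (sheet g)"
      unfolding eq by (metis openin_diff openin_topspace topspace_euclidean_subtopology)
    then show ?thesis using U_open openin_trans by blast
  qed
  have homeo: "homeomorphism (sheet g) T p (\<lambda>z. act g (s z))" if "g \<in> carrier G" for g
  proof
    show "continuous_on (sheet g) p"
      by (rule continuous_on_subset[OF cont]) (use sheet_eq[OF that] in \<open>auto simp: U_def\<close>)
    show "p ` sheet g \<subseteq> T" using sheet_eq[OF that] by (auto simp: U_def)
    show "(\<lambda>z. act g (s z)) ` T \<subseteq> sheet g" by (simp add: sheet_def)
    show "\<And>y. y \<in> sheet g \<Longrightarrow> act g (s (p y)) = y" using sheet_eq[OF that] by auto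
    show "\<And>z. z \<in> T \<Longrightarrow> p (act g (s z)) = z" using s p_act that by (simp add: image_subset_iff)
  qed (rule cont_act_s[OF that])
  have "pairwise disjnt (sheet ` carrier G)"
  proof (rule pairwiseI)
    fix a b assume "a \<in> sheet ` carrier G" "b \<in> sheet ` carrier G" "a \<noteq> b"
    then obtain g h where "a = sheet g" "b = sheet h" "g \<in> carrier G" "h \<in> carrier G" "g \<noteq> h" by blast
    then show "disjnt a b" using disj unfolding disjnt_def by blast
  qed
  moreover have "\<forall>u\<in>sheet ` carrier G. \<exists>q. homeomorphism u T p q"
    using homeo by blast
  ultimately show "\<exists>T. x \<in> T \<and> openin (top_of_set X) T \<and> (\<exists>v. \<Union> v = Y \<inter> p -` T \<and>
          (\<forall>u\<in>v. openin (top_of_set Y) u) \<and> pairwise disjnt v \<and> (\<forall>u\<in>v. \<exists>q. homeomorphism u T p q))"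
    using x T sheets sheet_open unfolding U_def
    by (intro exI[of _ T] conjI exI[of _ "sheet ` carrier G"]) simp_all
qed

end

locale galois_covering = free_group_action G Y p act
  for G (structure) and Y :: "'y::real_normed_vector set"
    and p :: "'y \<Rightarrow> 'x::real_normed_vector" and act :: "'a \<Rightarrow> 'y \<Rightarrow> 'y" +
  fixes X :: "'x set" and x0 :: 'x and y0 :: 'y
  assumes cov: "covering_space Y p X" and pc: "path_connected Y" and y0: "y0 \<in> Y" and py0: "p y0 = x0"
begin

text \<open>The surjection that belongs to a Galois cover: the lift at \<open>y0\<close> of a loop ends at \<open>g y0\<close> for a
unique \<open>g\<close>, which by homotopy lifting depends on the class of the loop only.\<close>

definition monodromy :: "(real \<Rightarrow> 'x) set \<Rightarrow> 'a" where
  "monodromy A = (THE g. g \<in> carrier G \<and>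
     (\<exists>\<gamma>\<in>A. \<exists>h. is_lift Y p y0 \<gamma> h \<and> pathfinish h = act g y0))"

lemma proj_in: "y \<in> Y \<Longrightarrow> p y \<in> X"
  using covering_space_imp_surjective[OF cov] by blast

lemma lift_exists:
  assumes "\<gamma> \<in> loops X x0"
  obtains h where "is_lift Y p y0 \<gamma> h"
proof -
  have *: "path \<gamma>" "path_image \<gamma> \<subseteq> X" "pathstart \<gamma> = p y0"
    using assms py0 by (auto simp: loops_def)
  obtain h where "path h" "path_image h \<subseteq> Y" "pathstart h = y0" "\<And>t. t \<in> {0..1} \<Longrightarrow> p (h t) = \<gamma> t"
    using covering_space_lift_path_strong[OF cov y0 *] by metis
  then show ?thesis using that[of h] by (simp add: is_lift_def)
qed

lemma lift_end_unique:
  assumes "\<gamma> \<in> loops X x0" "\<gamma>' \<in> loop_class X \<gamma>" "is_lift Y p y0 \<gamma> h" "is_lift Y p y0 \<gamma>' h'"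
  shows "pathfinish h = pathfinish h'"
proof (rule covering_space_monodromy[OF cov])
  show hom: "homotopic_paths X \<gamma> \<gamma>'" using assms by (simp add: loop_class_def)
  show "path \<gamma>" "path_image \<gamma> \<subseteq> X" "path \<gamma>'" "path_image \<gamma>' \<subseteq> X"
    using homotopic_paths_imp_path[OF hom] homotopic_paths_imp_subset[OF hom] by auto
qed (use assms in \<open>auto simp: is_lift_def\<close>)

lemma monodromy_eq:
  assumes "\<gamma> \<in> loops X x0" "is_lift Y p y0 \<gamma> h" "g \<in> carrier G" "pathfinish h = act g y0"
  shows "monodromy (loop_class X \<gamma>) = g"
  unfolding monodromy_def
proof (rule the_equality)
  show "g \<in> carrier G \<and> (\<exists>\<gamma>\<in>loop_class X \<gamma>. \<exists>h. is_lift Y p y0 \<gamma> h \<and> pathfinish h = act g y0)"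
    using assms loop_class_self by blast
  fix g' assume "g' \<in> carrier G \<and> (\<exists>\<gamma>\<in>loop_class X \<gamma>. \<exists>h. is_lift Y p y0 \<gamma> h \<and> pathfinish h = act g' y0)"
  then obtain \<gamma>' h' where "g' \<in> carrier G" "\<gamma>' \<in> loop_class X \<gamma>" "is_lift Y p y0 \<gamma>' h'" "pathfinish h' = act g' y0"
    by blast
  then show "g' = g" using lift_end_unique[OF assms(1) _ assms(2)] assms act_inj y0 by metis
qed

lemma monodromy_lift:
  assumes "\<gamma> \<in> loops X x0" "is_lift Y p y0 \<gamma> h"
  shows "monodromy (loop_class X \<gamma>) \<in> carrier G" "pathfinish h = act (monodromy (loop_class X \<gamma>)) y0"
proof -
  have 1: "pathfinish h \<in> Y" using assms by (auto simp: is_lift_def pathfinish_def path_image_def)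
  have "p (pathfinish h) = p y0"
    using assms py0 by (auto simp: is_lift_def loops_def pathfinish_def)
  then obtain g where g: "g \<in> carrier G" "pathfinish h = act g y0" using act_trans[OF y0 1] by metis
  then show "monodromy (loop_class X \<gamma>) \<in> carrier G" "pathfinish h = act (monodromy (loop_class X \<gamma>)) y0"
    using monodromy_eq[OF assms] by auto
qed

text \<open>If \<open>h\<close> and \<open>k\<close> are the lifts of two loops at \<open>y0\<close> and \<open>h\<close> ends at \<open>g y0\<close>, then \<open>h\<close> followed by the translate
\<open>g k\<close> lifts the product. Since \<open>k\<close> is translated by the element of the first loop, left actions
make monodromy a homomorphism rather than an antihomomorphism.\<close>

lemma monodromy_hom: "monodromy \<in> hom (fundamental_group X x0) G"
proof (rule homI)
  fix A assume "A \<in> carrier (fundamental_group X x0)"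
  then show "monodromy A \<in> carrier G"
    using monodromy_lift(1) lift_exists by (auto simp: carrier_fundamental_group) metis
next
  fix A B assume "A \<in> carrier (fundamental_group X x0)" "B \<in> carrier (fundamental_group X x0)"
  then obtain \<gamma> \<delta> where gd: "\<gamma> \<in> loops X x0" "A = loop_class X \<gamma>" "\<delta> \<in> loops X x0" "B = loop_class X \<delta>"
    by (auto simp: carrier_fundamental_group)
  obtain h k where hk: "is_lift Y p y0 \<gamma> h" "is_lift Y p y0 \<delta> k"
    using lift_exists gd by metis
  define g where "g = monodromy A"
  have g: "g \<in> carrier G" "pathfinish h = act g y0"
    using monodromy_lift[OF gd(1) hk(1)] gd by (auto simp: g_def)
  have k: "monodromy B \<in> carrier G" "pathfinish k = act (monodromy B) y0"
    using monodromy_lift[OF gd(3) hk(2)] gd by auto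
  have kY: "k t \<in> Y" if "0 \<le> t" "t \<le> 1" for t using hk(2) that by (auto simp: is_lift_def path_image_def)
  have pk: "path (act g \<circ> k)"
    using hk(2) continuous_on_subset[OF act_cont[OF g(1)]] by (intro path_continuous_image) (auto simp: is_lift_def)
  have "is_lift Y p y0 (\<gamma> +++ \<delta>) (h +++ (act g \<circ> k))"
    unfolding is_lift_def
  proof (intro conjI ballI)
    show "path (h +++ (act g \<circ> k))"
      using hk pk g by (intro path_join_imp) (auto simp: is_lift_def pathstart_compose)
    show "path_image (h +++ (act g \<circ> k)) \<subseteq> Y"
      using hk act_in g by (intro subset_path_image_join) (auto simp: is_lift_def path_image_compose)
    show "pathstart (h +++ (act g \<circ> k)) = y0" using hk by (auto simp: is_lift_def)
    fix t :: real assume "t \<in> {0..1}"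
    then show "p ((h +++ (act g \<circ> k)) t) = (\<gamma> +++ \<delta>) t"
      using hk p_act[OF g(1) kY] by (auto simp: joinpaths_def is_lift_def)
  qed
  moreover have "pathfinish (h +++ (act g \<circ> k)) = act (g \<otimes> monodromy B) y0"
    using g k y0 by (simp add: pathfinish_compose act_mult)
  ultimately show "monodromy (A \<otimes>\<^bsub>fundamental_group X x0\<^esub> B) = monodromy A \<otimes> monodromy B"
    using gd g k monodromy_eq[OF loops_join[OF gd(1,3)]]
    by (simp add: mult_loop_class g_def)
qed

lemma projected_path:
  assumes "path d" "path_image d \<subseteq> Y" "pathstart d = y0" "p (pathfinish d) = x0"
  shows "p \<circ> d \<in> loops X x0" "is_lift Y p y0 (p \<circ> d) d"
proof -
  have "path (p \<circ> d)"
    using assms covering_space_imp_continuous[OF cov] continuous_on_subset by (intro path_continuous_image) auto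
  then show "p \<circ> d \<in> loops X x0"
    using assms py0 proj_in by (auto simp: loops_def pathstart_compose pathfinish_compose path_image_compose)
  show "is_lift Y p y0 (p \<circ> d) d" using assms by (auto simp: is_lift_def)
qed

lemma monodromy_epi: "monodromy \<in> epi (fundamental_group X x0) G"
proof -
  have "g \<in> monodromy ` carrier (fundamental_group X x0)" if g: "g \<in> carrier G" for g
  proof -
    obtain d where d: "path d" "path_image d \<subseteq> Y" "pathstart d = y0" "pathfinish d = act g y0"
      using pc y0 act_in[OF g y0] unfolding path_connected_def by metis
    have "p (pathfinish d) = x0" using d py0 p_act g y0 by simp
    note * = projected_path[OF d(1-3) this]
    show ?thesis
      using monodromy_eq[OF * g d(4)] *(1) by (auto simp: carrier_fundamental_group image_iff)
  qed
  then show ?thesis using monodromy_hom by (auto simp: epi_def hom_def)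
qed

lemma monodromy_kernel:
  "(\<lambda>d. loop_class X (p \<circ> d)) ` loops Y y0 = kernel (fundamental_group X x0) G monodromy"
proof (intro equalityI subsetI)
  fix A assume "A \<in> (\<lambda>d. loop_class X (p \<circ> d)) ` loops Y y0"
  then obtain d where d: "d \<in> loops Y y0" "A = loop_class X (p \<circ> d)" by blast
  have 1: "p \<circ> d \<in> loops X x0" "is_lift Y p y0 (p \<circ> d) d"
    using projected_path[of d] d py0 by (auto simp: loops_def)
  have "monodromy A = \<one>"
    using monodromy_eq[OF 1, of \<one>] d act_one[OF y0] by (simp add: loops_def)
  then show "A \<in> kernel (fundamental_group X x0) G monodromy"
    using d 1 by (auto simp: kernel_def carrier_fundamental_group)
next
  fix A assume "A \<in> kernel (fundamental_group X x0) G monodromy"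
  then obtain \<gamma> where g: "\<gamma> \<in> loops X x0" "A = loop_class X \<gamma>" "monodromy A = \<one>"
    by (auto simp: kernel_def carrier_fundamental_group)
  obtain d where d: "is_lift Y p y0 \<gamma> d" using lift_exists g by metis
  have "pathfinish d = y0" using monodromy_lift[OF g(1) d] g act_one y0 by simp
  then have dl: "d \<in> loops Y y0" using d by (auto simp: loops_def is_lift_def)
  have pd: "p \<circ> d \<in> loops X x0" using projected_path[of d] dl py0 by (auto simp: loops_def)
  have "homotopic_paths X \<gamma> (p \<circ> d)"
    using d g by (intro homotopic_paths_eq) (auto simp: is_lift_def loops_def)
  then have "A = loop_class X (p \<circ> d)" using loop_class_eqI[OF g(1) pd] g by simp
  then show "A \<in> (\<lambda>d. loop_class X (p \<circ> d)) ` loops Y y0" using dl by blast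
qed

lemma act_bij: "g \<in> carrier G \<Longrightarrow> bij_betw (act g) Y Y"
  using act_inv_left act_inv_left[of "inv g"] act_in
  by (intro bij_betw_byWitness[where f'="act (inv g)"]) (auto simp: image_subset_iff)

text \<open>A deck transformation is a lift of \<open>p\<close> through itself, so on the connected space \<open>Y\<close> it is determined
by its value at \<open>y0\<close>, where some group element takes the same value.\<close>

lemma deck_transformations_eq:
  "deck_transformations Y p = (\<lambda>g. restrict (act g) Y) ` carrier G"
proof (intro equalityI subsetI)
  fix h assume "h \<in> (\<lambda>g. restrict (act g) Y) ` carrier G"
  then obtain g where g: "g \<in> carrier G" "h = restrict (act g) Y" by blast
  have bij: "h \<in> Bij Y" using act_bij[OF g(1)] g(2) by (simp add: Bij_def bij_betw_def inj_on_def)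
  have inj: "inj_on h Y" "h ` Y = Y" using bij by (auto simp: Bij_def bij_betw_def)
  have inv: "inv_into Y h y = act (inv g) y" if "y \<in> Y" for y
  proof (rule inv_into_f_eq[OF inj(1)])
    show "act (inv g) y \<in> Y" using g that act_in by simp
    then show "h (act (inv g) y) = y" using g that act_inv_left[of "inv g" y] by simp
  qed
  have "homeomorphism Y Y h (inv_into Y h)"
    unfolding homeomorphism_def
  proof (intro conjI ballI)
    show "continuous_on Y h" using continuous_on_cong[of Y Y h "act g"] act_cont g by simp
    show "continuous_on Y (inv_into Y h)"
      using continuous_on_cong[of Y Y "inv_into Y h" "act (inv g)"] act_cont g inv by simp
    show "inv_into Y h ` Y = Y" using inj by (metis bij_betw_def bij_betw_inv_into)
  qed (use inj in \<open>auto simp: f_inv_into_f inv_into_f_f\<close>)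
  then show "h \<in> deck_transformations Y p"
    using bij g p_act by (simp add: deck_transformations_def)
next
  fix h assume "h \<in> deck_transformations Y p"
  then have h: "h \<in> Bij Y" "continuous_on Y h" "\<forall>y\<in>Y. p (h y) = p y" "h ` Y = Y"
    by (auto simp: deck_transformations_def homeomorphism_def)
  have "h y0 \<in> Y" "p y0 = p (h y0)" using h y0 by auto
  then obtain g where g: "g \<in> carrier G" "act g y0 = h y0" using act_trans[OF y0] by blast
  have "act g y = h y" if "y \<in> Y" for y
  proof (rule covering_space_lift_unique[where ?g1.0="act g" and ?g2.0=h and a=y0 and T=Y and f=p, OF cov g(2)])
    show "continuous_on Y p" using cov by (rule covering_space_imp_continuous)
    show "connected Y" using pc by (rule path_connected_imp_connected)
  qed (use g h act_in act_cont p_act y0 proj_in that in auto)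
  then have "h = restrict (act g) Y" using h(1) by (auto simp: Bij_def extensional_def fun_eq_iff)
  then show "h \<in> (\<lambda>g. restrict (act g) Y) ` carrier G" using g by blast
qed

lemma deck_group_iso: "deck_group Y p \<cong> G"
proof -
  have "(\<lambda>g. restrict (act g) Y) \<in> iso G (deck_group Y p)"
  proof (rule isoI)
    show "(\<lambda>g. restrict (act g) Y) \<in> hom G (deck_group Y p)"
    proof (rule homI)
      fix g assume "g \<in> carrier G"
      then show "restrict (act g) Y \<in> carrier (deck_group Y p)"
        by (simp add: deck_group_def deck_transformations_eq)
    next
      fix g h assume gh: "g \<in> carrier G" "h \<in> carrier G"
      then have "restrict (act g) Y \<in> Bij Y" "restrict (act h) Y \<in> Bij Y"
        using deck_transformations_eq unfolding deck_transformations_def by blast+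
      then show "restrict (act (g \<otimes> h)) Y = restrict (act g) Y \<otimes>\<^bsub>deck_group Y p\<^esub> restrict (act h) Y"
        using gh by (auto simp: deck_group_def BijGroup_def compose_def act_mult act_in fun_eq_iff)
    qed
    have "inj_on (\<lambda>g. restrict (act g) Y) (carrier G)"
    proof (rule inj_onI)
      fix g h assume "g \<in> carrier G" "h \<in> carrier G" "restrict (act g) Y = restrict (act h) Y"
      then show "g = h" using act_inj[OF _ _ y0] y0 by (metis restrict_apply')
    qed
    then show "bij_betw (\<lambda>g. restrict (act g) Y) (carrier G) (carrier (deck_group Y p))"
      by (simp add: bij_betw_def deck_group_def deck_transformations_eq)
  qed
  then show ?thesis using iso_set_sym is_isoI is_group by blast
qed

lemma is_G_cover: "is_G_cover X x0 G monodromy Y p y0"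
  unfolding is_G_cover_def
proof (intro conjI ballI impI)
  fix y y' assume y: "y \<in> Y" "y' \<in> Y" "p y = p y'"
  then obtain g where "g \<in> carrier G" "act g y = y'" using act_trans by blast
  then show "\<exists>h\<in>deck_transformations Y p. h y = y'"
    using y unfolding deck_transformations_eq by force
qed (fact monodromy_epi cov y0 py0 monodromy_kernel deck_group_iso path_connected_imp_connected[OF pc])+

text \<open>Advancing the lift of a power of \<open>g\<close> by one turn is translation by the monodromy of \<open>g\<close>: both sides
lift the same path, and at \<open>s = 0\<close> they agree because the first turn is the lift of \<open>g\<close> itself.\<close>

lemma lift_power_shift:
  assumes g: "g \<in> loops X x0" and h: "is_lift Y p y0 (loop_power g k) h"
    and k: "1 \<le> k" and s: "0 \<le> s" "s \<le> 1 - 1 / real k"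
  shows "h (s + 1 / real k) = act (monodromy (loop_class X g)) (h s)"
proof -
  define q where "q = monodromy (loop_class X g)"
  have hp: "path h" "path_image h \<subseteq> Y" "h 0 = y0" "\<And>t. t \<in> {0..1} \<Longrightarrow> p (h t) = g (frac (real k * t))"
    using h by (auto simp: is_lift_def loop_power_def pathstart_def)
  have hY: "h t \<in> Y" if "t \<in> {0..1}" for t using hp(2) that by (auto simp: path_image_def)
  have k0: "real k > 0" "1 / real k \<le> 1" "0 \<le> 1 / real k" using k by auto
  have cont: "continuous_on {0..1} h" using hp(1) by (simp add: path_def)
  have g01: "g 1 = g 0" using g by (simp add: loops_def pathstart_def pathfinish_def)
  have in01: "t / real k \<in> {0..1}" if "t \<in> {0..1}" for t
    using that k by (auto simp: divide_le_eq_1)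
  have "is_lift Y p y0 g (\<lambda>t. h (t / real k))"
    unfolding is_lift_def
  proof (intro conjI ballI)
    show "path (\<lambda>t. h (t / real k))"
      unfolding path_def by (rule continuous_on_compose2[OF cont]) (use in01 k0 in \<open>auto intro!: continuous_intros\<close>)
    show "path_image (\<lambda>t. h (t / real k)) \<subseteq> Y"
      using hY in01 by (auto simp: path_image_def)
    show "pathstart (\<lambda>t. h (t / real k)) = y0" using hp(3) by (simp add: pathstart_def)
    fix t :: real assume t: "t \<in> {0..1}"
    then have "p (h (t / real k)) = g (frac t)" using hp(4)[OF in01[OF t]] k0 by simp
    moreover have "g (frac t) = g t"
    proof (cases "t = 1")
      case True
      then show ?thesis using g01 by simp
    next
      case False
      then have "frac t = t" using t by (simp add: frac_eq)
      then show ?thesis by simp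
    qed
    ultimately show "p (h (t / real k)) = g t" by simp
  qed
  from monodromy_lift[OF g this] have q: "q \<in> carrier G" "h (1 / real k) = act q y0"
    by (simp_all add: q_def pathfinish_def)
  define T where "T = {0..1 - 1 / real k}"
  have T01: "t \<in> {0..1}" "t + 1 / real k \<in> {0..1}" if "t \<in> T" for t
    using that k0(2,3) unfolding T_def atLeastAtMost_iff by linarith+
  have "h (s + 1 / real k) = act q (h s)"
  proof (rule covering_space_lift_unique[where ?g1.0="\<lambda>t. h (t + 1 / real k)" and ?g2.0="\<lambda>t. act q (h t)"
        and a=0 and T=T and f="\<lambda>t. p (h t)", OF cov])
    show "h (0 + 1 / real k) = act q (h 0)" using q(2) hp(3) by simp
    show "continuous_on T (\<lambda>t. p (h t))"
      by (rule continuous_on_compose2[OF covering_space_imp_continuous[OF cov] continuous_on_subset[OF cont]])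
        (use T01 hY in auto)
    show "continuous_on T (\<lambda>t. h (t + 1 / real k))"
      by (rule continuous_on_compose2[OF cont]) (use T01 in \<open>auto intro!: continuous_intros\<close>)
    show "continuous_on T (\<lambda>t. act q (h t))"
      by (rule continuous_on_compose2[OF act_cont[OF q(1)] continuous_on_subset[OF cont]]) (use T01 hY in auto)
    show "p (h t) = p (h (t + 1 / real k))" if "t \<in> T" for t
    proof -
      have "real k * (t + 1 / real k) = real k * t + 1" using k0 by (simp add: algebra_simps)
      then show ?thesis using hp(4)[OF T01(1)[OF that]] hp(4)[OF T01(2)[OF that]] by (simp add: frac_1_eq)
    qed
    show "p (h t) = p (act q (h t))" if "t \<in> T" for t
      using p_act[OF q(1) hY[OF T01(1)[OF that]]] by simp
    have TY: "h t \<in> Y" "h (t + 1 / real k) \<in> Y" if "t \<in> T" for t using hY T01[OF that] by auto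
    show "(\<lambda>t. p (h t)) \<in> T \<rightarrow> X" "(\<lambda>t. h (t + 1 / real k)) \<in> T \<rightarrow> Y" "(\<lambda>t. act q (h t)) \<in> T \<rightarrow> Y"
      using TY proj_in act_in[OF q(1)] by auto
  qed (use s k0 in \<open>auto simp: T_def\<close>)
  then show ?thesis by (simp add: q_def)
qed

lemma lift_power_vertices:
  assumes g: "g \<in> loops X x0" and h: "is_lift Y p y0 (loop_power g k) h" and k: "1 \<le> k" and j: "j \<le> k"
  shows "h (real j / real k) = (act (monodromy (loop_class X g)) ^^ j) y0"
  using j
proof (induction j)
  case 0
  then show ?case using h by (simp add: is_lift_def pathstart_def)
next
  case (Suc j)
  have "real j / real k + 1 / real k \<le> 1" using Suc.prems k by (simp add: divide_le_eq_1 flip: add_divide_distrib)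
  then have "h (real j / real k + 1 / real k) = act (monodromy (loop_class X g)) (h (real j / real k))"
    by (intro lift_power_shift[OF g h k]) auto
  then show ?case using Suc by (simp add: add_divide_distrib add.commute)
qed

lemma is_lift_power_restrict:
  assumes h: "is_lift Y p y0 (loop_power g k) h" and j: "1 \<le> j" "j \<le> k"
  shows "is_lift Y p y0 (loop_power g j) (\<lambda>t. h (real j / real k * t))"
proof -
  have in01: "real j / real k * t \<in> {0..1}" if "t \<in> {0..1}" for t
  proof -
    have "real j / real k \<le> 1" using j by simp
    then have "real j / real k * t \<le> 1 * 1" using that by (intro mult_mono) auto
    moreover have "0 \<le> real j / real k * t" using that by simp
    ultimately show ?thesis by simp
  qed
  have cont: "continuous_on {0..1} h" using h by (simp add: path_def is_lift_def)
  show ?thesis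
    unfolding is_lift_def
  proof (intro conjI ballI)
    show "path (\<lambda>t. h (real j / real k * t))"
      unfolding path_def by (rule continuous_on_compose2[OF cont]) (use in01 j in \<open>auto intro!: continuous_intros\<close>)
    show "path_image (\<lambda>t. h (real j / real k * t)) \<subseteq> Y"
      using in01 h by (auto simp: path_image_def is_lift_def)
    show "pathstart (\<lambda>t. h (real j / real k * t)) = y0" using h by (simp add: pathstart_def is_lift_def)
    fix t :: real assume t: "t \<in> {0..1}"
    have "real k * (real j / real k * t) = real j * t" using j by simp
    then show "p (h (real j / real k * t)) = loop_power g j t"
      using h in01[OF t] by (simp add: is_lift_def loop_power_def)
  qed
qed

end

section \<open>The figure eight as a quotient of the coordinate axes\<close>

lemma figure_eight_cases:
  assumes "x \<in> figure_eight"
  shows "Re x \<ge> 0 \<Longrightarrow> cmod (1 - x) = 1" "Re x \<le> 0 \<Longrightarrow> cmod (1 + x) = 1"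
    "Re x = 0 \<Longrightarrow> x = 0"
proof -
  have *: "cmod (1 - x) = 1 \<or> cmod (1 + x) = 1"
    using assms by (auto simp: figure_eight_def dist_norm norm_minus_commute add.commute)
  have sq: "cmod (1 - x) ^ 2 = 1 - 2 * Re x + (Re x ^ 2 + Im x ^ 2)" "cmod (1 + x) ^ 2 = 1 + 2 * Re x + (Re x ^ 2 + Im x ^ 2)"
    unfolding cmod_power2 by (simp_all add: power2_eq_square algebra_simps)
  have z: "x = 0" if "Re x ^ 2 + Im x ^ 2 \<le> 0"
    using that by (simp add: complex_eq_iff sum_power2_le_zero_iff)
  show "x = 0" if "Re x = 0" using * sq z that by auto
  show "cmod (1 - x) = 1" if "Re x \<ge> 0" using * sq z that by (cases "cmod (1 - x) = 1") auto
  show "cmod (1 + x) = 1" if "Re x \<le> 0" using * sq z that by (cases "cmod (1 + x) = 1") auto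
qed

lemma right_circle_in: "1 - cis t \<in> figure_eight" and left_circle_in: "-1 + cis t \<in> figure_eight"
  by (auto simp: figure_eight_def dist_norm)

lemma cis_Arg_unit: "cmod z = 1 \<Longrightarrow> cis (Arg z) = z"
  by (metis cis_Arg norm_zero sgn_eq div_by_1 of_real_1 zero_neq_one)

lemma unit_nonpos_Reals: "cmod z = 1 \<Longrightarrow> z \<in> \<real>\<^sub>\<le>\<^sub>0 \<Longrightarrow> z = -1"
  by (auto elim!: nonpos_Reals_cases)

text \<open>The figure eight is the image of two crossing real lines, each wound around one of the circles.
The cross is contractible and \<open>axes_map\<close> has local sections, which makes the cross a substitute for
the universal cover, although \<open>axes_map\<close> is not a covering at the points where only one of the lines passes over the wedge point.\<close>

definition axes :: "(real \<times> real) set" where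
  "axes = {(s, t). s = 0 \<or> t = 0}"

definition axes_map :: "real \<times> real \<Rightarrow> complex" where
  "axes_map = (\<lambda>(s, t). cis t - cis s)"

lemma continuous_on_axes_map: "continuous_on S axes_map"
  unfolding axes_map_def case_prod_unfold by (intro continuous_intros)

lemma axes_map_in: "q \<in> axes \<Longrightarrow> axes_map q \<in> figure_eight"
  using right_circle_in left_circle_in by (auto simp: axes_def axes_map_def)

text \<open>Three open sets suffice: each of the two open circles without the wedge point, where the angle is
taken in \<open>(0, 2\<pi>)\<close>, and the complement of the two points opposite to the wedge point, where it is
taken in \<open>(-\<pi>, \<pi>)\<close> and the two branches agree at \<open>0\<close>.\<close>

lemma axes_map_local_section:
  assumes x: "x \<in> figure_eight"
  shows "\<exists>T L. x \<in> T \<and> openin (top_of_set figure_eight) T \<and> continuous_on T L \<and>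
    L ` T \<subseteq> axes \<and> (\<forall>z\<in>T. axes_map (L z) = z)"
proof -
  consider "Re x > 0" | "Re x < 0" | "Re x = 0" by linarith
  then show ?thesis
  proof cases
    case 1
    define T where "T = figure_eight \<inter> {z. Re z > 0}"
    define L where "L = (\<lambda>z. (Arg (z - 1) + pi, 0::real))"
    have "openin (top_of_set figure_eight) T"
      unfolding T_def by (intro openin_open_Int open_halfspace_Re_gt)
    moreover have n: "cmod (z - 1) = 1" if "z \<in> T" for z
      using figure_eight_cases(1)[of z] that by (simp add: T_def norm_minus_commute)
    have "z - 1 \<notin> \<real>\<^sub>\<le>\<^sub>0" if "z \<in> T" for z
      using unit_nonpos_Reals[OF n[OF that]] that by (auto simp: T_def)
    then have "continuous_on T L"
      unfolding L_def by (intro continuous_intros) auto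
    moreover have "axes_map (L z) = z" if "z \<in> T" for z
      using cis_Arg_unit[OF n[OF that]] by (simp add: axes_map_def L_def flip: cis_mult)
    ultimately show ?thesis using x 1 by (intro exI[of _ T] exI[of _ L]) (auto simp: T_def L_def axes_def)
  next
    case 2
    define T where "T = figure_eight \<inter> {z. Re z < 0}"
    define L where "L = (\<lambda>z. (0::real, Arg (-1 - z) + pi))"
    have "openin (top_of_set figure_eight) T"
      unfolding T_def by (intro openin_open_Int open_halfspace_Re_lt)
    moreover have n: "cmod (-1 - z) = 1" if "z \<in> T" for z
      using figure_eight_cases(2)[of z] that norm_minus_cancel[of "1 + z"] by (simp add: T_def)
    have "-1 - z \<notin> \<real>\<^sub>\<le>\<^sub>0" if "z \<in> T" for z
      using unit_nonpos_Reals[OF n[OF that]] that by (auto simp: T_def)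
    then have "continuous_on T L"
      unfolding L_def by (intro continuous_intros) auto
    moreover have "axes_map (L z) = z" if "z \<in> T" for z
      using cis_Arg_unit[OF n[OF that]] by (simp add: axes_map_def L_def flip: cis_mult)
    ultimately show ?thesis using x 2 by (intro exI[of _ T] exI[of _ L]) (auto simp: T_def L_def axes_def)
  next
    case 3
    define T where "T = figure_eight - {2, -2}"
    define L where "L = (\<lambda>z. if 0 \<le> Re z then (Arg (1 - z), 0) else (0, Arg (1 + z)))"
    have "T = figure_eight \<inter> - {2, -2}" by (auto simp: T_def)
    then have "openin (top_of_set figure_eight) T"
      by (metis openin_open_Int open_Compl finite_imp_closed finite.simps)
    moreover have "continuous_on T L"
    proof -
      have Teq: "T = (T \<inter> {z. 0 \<le> Re z}) \<union> (T \<inter> {z. Re z \<le> 0})" by auto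
      have r: "1 - z \<notin> \<real>\<^sub>\<le>\<^sub>0" if "z \<in> T" "0 \<le> Re z" for z
        using unit_nonpos_Reals[OF figure_eight_cases(1)[of z]] that by (auto simp: T_def algebra_simps)
      have l: "1 + z \<notin> \<real>\<^sub>\<le>\<^sub>0" if "z \<in> T" "Re z \<le> 0" for z
        using unit_nonpos_Reals[OF figure_eight_cases(2)[of z]] that by (auto simp: T_def eq_diff_eq' add_eq_0_iff)
      have "continuous_on ((T \<inter> {z. 0 \<le> Re z}) \<union> (T \<inter> {z. Re z \<le> 0})) L"
        unfolding L_def
      proof (rule continuous_on_cases_local)
        show "closedin (top_of_set (T \<inter> {z. 0 \<le> Re z} \<union> T \<inter> {z. Re z \<le> 0})) (T \<inter> {z. 0 \<le> Re z})"
          unfolding Teq[symmetric] by (intro closedin_closed_Int closed_halfspace_Re_ge)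
        show "closedin (top_of_set (T \<inter> {z. 0 \<le> Re z} \<union> T \<inter> {z. Re z \<le> 0})) (T \<inter> {z. Re z \<le> 0})"
          unfolding Teq[symmetric] by (intro closedin_closed_Int closed_halfspace_Re_le)
        show "continuous_on (T \<inter> {z. 0 \<le> Re z}) (\<lambda>z. (Arg (1 - z), 0))"
          using r by (intro continuous_intros) auto
        show "continuous_on (T \<inter> {z. Re z \<le> 0}) (\<lambda>z. (0, Arg (1 + z)))"
          using l by (intro continuous_intros) auto
      next
        fix z assume "z \<in> T \<inter> {z. 0 \<le> Re z} \<and> \<not> 0 \<le> Re z \<or> z \<in> T \<inter> {z. Re z \<le> 0} \<and> 0 \<le> Re z"
        then have "z = 0" using figure_eight_cases(3)[of z] by (auto simp: T_def)
        then show "(Arg (1 - z), 0) = (0, Arg (1 + z))" by simp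
      qed
      then show ?thesis using Teq by simp
    qed
    moreover have "axes_map (L z) = z" if "z \<in> T" for z
      using cis_Arg_unit[OF figure_eight_cases(1)[of z]] cis_Arg_unit[OF figure_eight_cases(2)[of z]] that
      unfolding L_def by (auto simp: axes_map_def T_def)
    ultimately show ?thesis
      using x 3 figure_eight_cases(3)[OF x] by (intro exI[of _ T] exI[of _ L]) (auto simp: T_def L_def axes_def)
  qed
qed

section \<open>The quaternion group\<close>

text \<open>The pair \<open>(a, b)\<close> stands for the quaternion \<open>a + j b\<close>, where \<open>a j = j cnj a\<close>.\<close>

type_synonym quat = "complex \<times> complex"

definition qmul :: "quat \<Rightarrow> quat \<Rightarrow> quat" where
  "qmul x y = (fst x * fst y - cnj (snd x) * snd y, snd x * fst y + cnj (fst x) * snd y)"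

definition qconj :: "quat \<Rightarrow> quat" where
  "qconj x = (cnj (fst x), - snd x)"

lemma qmul_assoc: "qmul (qmul x y) z = qmul x (qmul y z)"
  by (simp add: qmul_def algebra_simps)

lemma qmul_one [simp]: "qmul (1, 0) x = x" "qmul x (1, 0) = x"
  by (simp_all add: qmul_def)

lemma continuous_on_qmul: "continuous_on S f \<Longrightarrow> continuous_on S (\<lambda>x. qmul g (f x))"
  unfolding qmul_def by (intro continuous_intros)

definition Q8_list :: "quat list" where
  "Q8_list = [(1, 0), (-1, 0), (\<i>, 0), (-\<i>, 0), (0, 1), (0, -1), (0, \<i>), (0, -\<i>)]"

definition Q8 :: "quat set" where "Q8 = set Q8_list"

lemma Q8_eq: "Q8 = {(1, 0), (-1, 0), (\<i>, 0), (-\<i>, 0), (0, 1), (0, -1), (0, \<i>), (0, -\<i>)}"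
  unfolding Q8_def Q8_list_def list.set ..

lemma Q8_cases:
  assumes "g \<in> Q8"
  obtains "g = (1, 0)" | "g = (-1, 0)" | "g = (\<i>, 0)" | "g = (-\<i>, 0)"
    | "g = (0, 1)" | "g = (0, -1)" | "g = (0, \<i>)" | "g = (0, -\<i>)"
  using assms unfolding Q8_eq by blast

lemma qmul_Q8: "g \<in> Q8 \<Longrightarrow> h \<in> Q8 \<Longrightarrow> qmul g h \<in> Q8"
  by (erule Q8_cases; hypsubst; erule Q8_cases; hypsubst; simp add: qmul_def; simp add: Q8_eq)

lemma qconj_Q8: "g \<in> Q8 \<Longrightarrow> qconj g \<in> Q8"
  by (erule Q8_cases; hypsubst; simp add: qconj_def; simp add: Q8_eq)

lemma qmul_qconj_Q8: "g \<in> Q8 \<Longrightarrow> qmul (qconj g) g = (1, 0)" "g \<in> Q8 \<Longrightarrow> qmul g (qconj g) = (1, 0)"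
  by (erule Q8_cases; simp add: qconj_def qmul_def)+

text \<open>The group is carried by natural numbers, namely positions in \<open>Q8_list\<close>; the neutral element comes first.\<close>

definition Q8_dec :: "nat \<Rightarrow> quat" where "Q8_dec n = Q8_list ! n"

definition Q8_enc :: "quat \<Rightarrow> nat" where "Q8_enc = inv_into {..<8} Q8_dec"

definition Q8_group :: "nat monoid" where
  "Q8_group = \<lparr>carrier = {..<8}, mult = (\<lambda>m n. Q8_enc (qmul (Q8_dec m) (Q8_dec n))), one = 0\<rparr>"

lemma Q8_dec_bij: "bij_betw Q8_dec (carrier Q8_group) Q8"
proof -
  have "distinct Q8_list" by (simp add: Q8_list_def complex_eq_iff)
  moreover have "length Q8_list = 8" by (simp add: Q8_list_def)
  ultimately show ?thesis
    using bij_betw_nth[of Q8_list "{..<8}" Q8] unfolding Q8_def Q8_group_def Q8_dec_def[abs_def] by simp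
qed

lemma Q8_dec_in: "g \<in> carrier Q8_group \<Longrightarrow> Q8_dec g \<in> Q8"
  using Q8_dec_bij by (auto simp: bij_betw_def)

lemma Q8_dec_eq_iff: "g \<in> carrier Q8_group \<Longrightarrow> h \<in> carrier Q8_group \<Longrightarrow> Q8_dec g = Q8_dec h \<longleftrightarrow> g = h"
  using Q8_dec_bij by (auto simp: bij_betw_def inj_on_def)

lemma Q8_enc_in: "q \<in> Q8 \<Longrightarrow> Q8_enc q \<in> carrier Q8_group"
  using Q8_dec_bij inv_into_into[of q Q8_dec "{..<8}"] by (simp add: bij_betw_def Q8_enc_def Q8_group_def)

lemma Q8_dec_enc: "q \<in> Q8 \<Longrightarrow> Q8_dec (Q8_enc q) = q"
  using Q8_dec_bij f_inv_into_f[of q Q8_dec "{..<8}"] by (simp add: bij_betw_def Q8_enc_def Q8_group_def)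

lemma Q8_dec_surj: "q \<in> Q8 \<Longrightarrow> \<exists>g\<in>carrier Q8_group. Q8_dec g = q"
  using Q8_enc_in Q8_dec_enc by blast

lemma Q8_mult: 
  assumes "g \<in> carrier Q8_group" "h \<in> carrier Q8_group"
  shows "g \<otimes>\<^bsub>Q8_group\<^esub> h \<in> carrier Q8_group"
    "Q8_dec (g \<otimes>\<^bsub>Q8_group\<^esub> h) = qmul (Q8_dec g) (Q8_dec h)"
  using qmul_Q8[OF Q8_dec_in[OF assms(1)] Q8_dec_in[OF assms(2)]] Q8_enc_in Q8_dec_enc
  by (simp_all add: Q8_group_def)

lemma Q8_one: "\<one>\<^bsub>Q8_group\<^esub> \<in> carrier Q8_group" "Q8_dec \<one>\<^bsub>Q8_group\<^esub> = (1, 0)"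
  by (simp_all add: Q8_group_def Q8_dec_def Q8_list_def)

lemma group_Q8: "group Q8_group"
proof (rule groupI)
  fix x y z assume x: "x \<in> carrier Q8_group" and y: "y \<in> carrier Q8_group" and z: "z \<in> carrier Q8_group"
  show "x \<otimes>\<^bsub>Q8_group\<^esub> y \<otimes>\<^bsub>Q8_group\<^esub> z = x \<otimes>\<^bsub>Q8_group\<^esub> (y \<otimes>\<^bsub>Q8_group\<^esub> z)"
    using x y z by (subst Q8_dec_eq_iff[symmetric]) (auto simp: Q8_mult qmul_assoc)
next
  fix x assume x: "x \<in> carrier Q8_group"
  show "\<one>\<^bsub>Q8_group\<^esub> \<otimes>\<^bsub>Q8_group\<^esub> x = x"
    using x Q8_one by (subst Q8_dec_eq_iff[symmetric]) (auto simp: Q8_mult)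
  obtain y where y: "y \<in> carrier Q8_group" "Q8_dec y = qconj (Q8_dec x)"
    using Q8_dec_surj qconj_Q8[OF Q8_dec_in[OF x]] by blast
  then have "y \<otimes>\<^bsub>Q8_group\<^esub> x = \<one>\<^bsub>Q8_group\<^esub>"
    using x Q8_one qmul_qconj_Q8[OF Q8_dec_in[OF x]]
    by (subst Q8_dec_eq_iff[symmetric]) (auto simp: Q8_mult)
  then show "\<exists>y\<in>carrier Q8_group. y \<otimes>\<^bsub>Q8_group\<^esub> x = \<one>\<^bsub>Q8_group\<^esub>" using y by blast
qed (auto simp: Q8_mult Q8_one)

lemma Q8_commute_or_anticommute:
  "g \<in> Q8 \<Longrightarrow> h \<in> Q8 \<Longrightarrow> qmul g h = qmul h g \<or> qmul g h = qmul (-1, 0) (qmul h g)"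
  by (erule Q8_cases; hypsubst; erule Q8_cases; hypsubst; simp add: qmul_def)

text \<open>Any two elements commute up to sign, so commutators lie in the central subgroup \<open>{1, -1}\<close>.\<close>

lemma two_step_nilpotent_Q8: "two_step_nilpotent Q8_group"
proof -
  interpret group Q8_group by (rule group_Q8)
  define Z where "Z = {g \<in> carrier Q8_group. Q8_dec g \<in> {(1, 0), (-1, 0)}}"
  have Z_center: "Z \<subseteq> group_center Q8_group"
  proof
    fix z assume z: "z \<in> Z"
    have "z \<otimes>\<^bsub>Q8_group\<^esub> x = x \<otimes>\<^bsub>Q8_group\<^esub> z" if "x \<in> carrier Q8_group" for x
      using z that by (subst Q8_dec_eq_iff[symmetric]) (auto simp: Q8_mult Z_def qmul_def)
    then show "z \<in> group_center Q8_group" using z by (auto simp: group_center_def Z_def)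
  qed
  have "subgroup Z Q8_group"
  proof
    fix x assume x: "x \<in> Z"
    have "Q8_dec (inv\<^bsub>Q8_group\<^esub> x) = Q8_dec x"
    proof -
      have "x \<otimes>\<^bsub>Q8_group\<^esub> x = \<one>\<^bsub>Q8_group\<^esub>"
        using x by (subst Q8_dec_eq_iff[symmetric]) (auto simp: Q8_mult Q8_one Z_def qmul_def)
      then show ?thesis using x inv_equality[of x x] by (simp add: Z_def)
    qed
    then show "inv\<^bsub>Q8_group\<^esub> x \<in> Z" using x by (simp add: Z_def)
  qed (auto simp: Z_def Q8_mult Q8_one qmul_def)
  moreover have "derived_set Q8_group (carrier Q8_group) \<subseteq> Z"
  proof clarsimp
    fix g h assume g: "g \<in> carrier Q8_group" and h: "h \<in> carrier Q8_group"
    define k where "k = g \<otimes>\<^bsub>Q8_group\<^esub> h \<otimes>\<^bsub>Q8_group\<^esub> inv\<^bsub>Q8_group\<^esub> g \<otimes>\<^bsub>Q8_group\<^esub> inv\<^bsub>Q8_group\<^esub> h"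
    have k: "k \<in> carrier Q8_group" using g h by (simp add: k_def)
    have "inv\<^bsub>Q8_group\<^esub> h \<otimes>\<^bsub>Q8_group\<^esub> (h \<otimes>\<^bsub>Q8_group\<^esub> g) = g"
      using g h by (simp flip: m_assoc)
    then have "k \<otimes>\<^bsub>Q8_group\<^esub> (h \<otimes>\<^bsub>Q8_group\<^esub> g) = g \<otimes>\<^bsub>Q8_group\<^esub> h"
      using g h unfolding k_def by (simp add: m_assoc)
    then have eq: "qmul (Q8_dec k) (qmul (Q8_dec h) (Q8_dec g)) = qmul (Q8_dec g) (Q8_dec h)"
      using g h k Q8_mult m_closed by metis
    define r where "r = qmul (Q8_dec h) (Q8_dec g)"
    have r: "r \<in> Q8" using g h by (simp add: r_def qmul_Q8 Q8_dec_in)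
    have "qmul (Q8_dec k) r = r \<or> qmul (Q8_dec k) r = qmul (-1, 0) r"
      using Q8_commute_or_anticommute[OF Q8_dec_in[OF g] Q8_dec_in[OF h]] eq r_def by metis
    then have "qmul (Q8_dec k) (qmul r (qconj r)) = qmul r (qconj r) \<or>
        qmul (Q8_dec k) (qmul r (qconj r)) = qmul (-1, 0) (qmul r (qconj r))"
      by (metis qmul_assoc)
    then have "Q8_dec k \<in> {(1, 0), (-1, 0)}"
      using qmul_qconj_Q8(2)[OF r] by auto
    then show "k \<in> Z" using k by (simp add: Z_def)
  qed
  ultimately have "derived Q8_group (carrier Q8_group) \<subseteq> Z"
    unfolding derived_def by (rule generate_subgroup_incl[rotated])
  then show ?thesis using Z_center group_Q8 by (auto simp: two_step_nilpotent_def)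
qed

section \<open>A covering of the figure eight with quaternion deck group\<close>

text \<open>The Cayley graph of the quaternion group for the generators \<open>i\<close> and \<open>j\<close>: over the right circle lie the
arcs \<open>g e\<^sup>i\<^sup>t\<close>, over the left one the arcs \<open>g e\<^sup>j\<^sup>t\<close>. As \<open>t\<close> is unrestricted, each arc runs around a full
great circle through four vertices; the union consists of four such circles.\<close>

definition Q8_cover :: "quat set" where
  "Q8_cover = {qmul g (cis t, 0) | g t. g \<in> Q8} \<union>
     {qmul g (of_real (cos t), of_real (sin t)) | g t. g \<in> Q8}"

text \<open>One formula for both kinds of arcs, which makes continuity evident. On \<open>(u, 0)\<close> and \<open>(0, v)\<close> the
mixed terms vanish and \<open>1 - u\<^sup>4\<close> or \<open>1 - v\<^sup>4\<close> remains. On the real points \<open>(c, s)\<close> of the unit sphere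
it is \<open>-1 + (c + i s)\<^sup>4\<close>, since \<open>2 = 2(c\<^sup>2 + s\<^sup>2)\<^sup>2\<close>.\<close>

definition Q8_proj :: "quat \<Rightarrow> complex" where
  "Q8_proj = (\<lambda>(u, v). 1 - u ^ 4 - v ^ 4 - 10 * u ^ 2 * v ^ 2 + 4 * \<i> * u * v * (u * cnj u - v * cnj v))"

lemma i_powers: "\<i> ^ 4 = (1::complex)" "\<i> ^ 2 = (-1::complex)"
  by (simp_all add: power4_eq_xxxx)

lemma Q8_proj_qmul: "g \<in> Q8 \<Longrightarrow> Q8_proj (qmul g y) = Q8_proj y"
  by (cases y, erule Q8_cases; hypsubst; simp add: Q8_proj_def qmul_def power_mult_distrib i_powers algebra_simps)

lemma Q8_proj_right_arc: "Q8_proj (cis t, 0) = 1 - cis (4 * t)"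
  by (simp add: Q8_proj_def Complex.DeMoivre)

lemma Q8_proj_left_arc: "Q8_proj (of_real (cos t), of_real (sin t)) = -1 + cis (4 * t)"
proof -
  define c where "c = complex_of_real (cos t)"
  define s where "s = complex_of_real (sin t)"
  have 1: "c ^ 2 + s ^ 2 = 1"
    unfolding c_def s_def by (metis of_real_1 of_real_add of_real_power sin_cos_squared_add2)
  have "cis t = c + \<i> * s" by (simp add: c_def s_def complex_eq_iff)
  then have "cis (4 * t) = (c + \<i> * s) ^ 4" using Complex.DeMoivre[of t 4] by simp
  also have "\<dots> = c ^ 4 + s ^ 4 - 6 * c^2 * s^2 + 4 * \<i> * (c^3 * s - c * s^3)"
    by (simp add: power4_eq_xxxx power2_eq_square power3_eq_cube algebra_simps)
  also have "\<dots> = 2 * (c ^ 2 + s ^ 2) ^ 2 - c ^ 4 - s ^ 4 - 10 * c^2 * s^2 + 4 * \<i> * c * s * (c * c - s * s)"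
    by (simp add: power4_eq_xxxx power2_eq_square power3_eq_cube algebra_simps)
  finally have "cis (4 * t) = 2 - c ^ 4 - s ^ 4 - 10 * c^2 * s^2 + 4 * \<i> * c * s * (c * c - s * s)"
    by (simp add: 1)
  then show ?thesis by (simp add: Q8_proj_def c_def s_def)
qed

lemma Q8_coverE:
  assumes "y \<in> Q8_cover"
  obtains g t where "g \<in> Q8" "y = qmul g (cis t, 0)"
  | g t where "g \<in> Q8" "y = qmul g (of_real (cos t), of_real (sin t))"
  using assms by (auto simp: Q8_cover_def)

lemma arc_in_Q8_cover: "g \<in> Q8 \<Longrightarrow> qmul g (cis t, 0) \<in> Q8_cover"
  "g \<in> Q8 \<Longrightarrow> qmul g (of_real (cos t), of_real (sin t)) \<in> Q8_cover"
  unfolding Q8_cover_def by blast+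

lemma Q8_in_cover: "g \<in> Q8 \<Longrightarrow> g \<in> Q8_cover"
  using arc_in_Q8_cover(1)[of g 0] by simp

lemma qmul_Q8_cover: "g \<in> Q8 \<Longrightarrow> y \<in> Q8_cover \<Longrightarrow> qmul g y \<in> Q8_cover"
  by (erule Q8_coverE) (auto simp: qmul_Q8 arc_in_Q8_cover simp flip: qmul_assoc)

lemma fourth_root_cases:
  assumes "(z::complex) ^ 4 = 1"
  shows "z = 1 \<or> z = -1 \<or> z = \<i> \<or> z = -\<i>"
proof -
  have "(z - 1) * (z + 1) * (z - \<i>) * (z + \<i>) = 0"
    using assms by (simp add: power4_eq_xxxx algebra_simps)
  then show ?thesis by (auto simp: eq_neg_iff_add_eq_0)
qed

lemma cis_fourth_root:
  assumes "cis (4 * t) = 1"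
  shows "(cis t, 0) \<in> Q8" "(complex_of_real (cos t), complex_of_real (sin t)) \<in> Q8"
proof -
  have "cis t ^ 4 = 1" using assms by (simp add: Complex.DeMoivre)
  then have *: "cis t = 1 \<or> cis t = -1 \<or> cis t = \<i> \<or> cis t = -\<i>" by (rule fourth_root_cases)
  then show "(cis t, 0) \<in> Q8" by (auto simp: Q8_eq)
  show "(complex_of_real (cos t), complex_of_real (sin t)) \<in> Q8"
    using * by (auto simp: Q8_eq complex_eq_iff)
qed

lemma Q8_orbit_trans:
  assumes "g \<in> Q8" "h \<in> Q8" "k \<in> Q8" "qmul k a = b"
  shows "\<exists>q\<in>Q8. qmul q (qmul g a) = qmul h b"
proof
  show "qmul h (qmul k (qconj g)) \<in> Q8" using assms by (simp add: qmul_Q8 qconj_Q8)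
  have "qmul (qmul h (qmul k (qconj g))) (qmul g a) = qmul h (qmul k (qmul (qmul (qconj g) g) a))"
    by (simp add: qmul_assoc)
  then show "qmul (qmul h (qmul k (qconj g))) (qmul g a) = qmul h b"
    using assms by (simp add: qmul_qconj_Q8)
qed

lemma cis_add_eq_2:
  assumes "cis a + cis b = 2"
  shows "cis a = 1" "cis b = 1"
proof -
  have c: "cos a + cos b = 2" using assms by (simp add: complex_eq_iff)
  then have ab: "cos a = 1" "cos b = 1" using cos_le_one[of a] cos_le_one[of b] by linarith+
  then have "sin a = 0" "sin b = 0" using sin_cos_squared_add[of a] sin_cos_squared_add[of b] by auto
  then show "cis a = 1" "cis b = 1" using ab by (auto simp: complex_eq_iff)
qed

text \<open>The two circles meet in the wedge point only, so arcs of different kinds can have points in the same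
fibre only at vertices, and the vertices are the elements of the group.\<close>

lemma Q8_mixed_fibre:
  assumes "1 - cis (4 * t) = -1 + cis (4 * s)"
  shows "\<exists>k\<in>Q8. qmul k (cis t, 0) = (complex_of_real (cos s), complex_of_real (sin s))"
    "\<exists>k\<in>Q8. qmul k (complex_of_real (cos s), complex_of_real (sin s)) = (cis t, 0)"
proof -
  have "cis (4 * t) + cis (4 * s) = 2" using assms by (simp add: algebra_simps)
  note * = cis_add_eq_2[OF this]
  have q: "(cis t, 0) \<in> Q8" "(complex_of_real (cos s), complex_of_real (sin s)) \<in> Q8"
    using cis_fourth_root(1)[OF *(1)] cis_fourth_root(2)[OF *(2)] by auto
  show "\<exists>k\<in>Q8. qmul k (cis t, 0) = (complex_of_real (cos s), complex_of_real (sin s))"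
    using Q8_orbit_trans[of "(cis t, 0)" "(complex_of_real (cos s), complex_of_real (sin s))" "(1,0)" "(1,0)"] q
    by (simp add: Q8_eq)
  show "\<exists>k\<in>Q8. qmul k (complex_of_real (cos s), complex_of_real (sin s)) = (cis t, 0)"
    using Q8_orbit_trans[of "(complex_of_real (cos s), complex_of_real (sin s))" "(cis t, 0)" "(1,0)" "(1,0)"] q
    by (simp add: Q8_eq)
qed

text \<open>Two points of arcs of the same kind in one fibre differ, after moving both arcs to the neutral element,
by a fourth root of unity in \<open>\<complex>\<close> or in the copy of \<open>\<complex>\<close> generated by \<open>j\<close>.\<close>

lemma Q8_transitive_fibre:
  assumes "y \<in> Q8_cover" "y' \<in> Q8_cover" "Q8_proj y = Q8_proj y'"
  shows "\<exists>q\<in>Q8. qmul q y = y'"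
  using assms(1)
proof (cases rule: Q8_coverE)
  case (1 g t)
  show ?thesis using assms(2)
  proof (cases rule: Q8_coverE)
    case (1 h s)
    have "cis (4 * t) = cis (4 * s)"
      using assms(3) \<open>g \<in> Q8\<close> \<open>y = qmul g (cis t, 0)\<close> 1 by (simp add: Q8_proj_qmul Q8_proj_right_arc)
    then have "cis (4 * (s - t)) = 1" by (simp add: right_diff_distrib flip: cis_divide)
    moreover have "qmul (cis (s - t), 0) (cis t, 0) = (cis s, 0)" by (simp add: qmul_def cis_mult)
    ultimately show ?thesis
      using Q8_orbit_trans[OF \<open>g \<in> Q8\<close> \<open>h \<in> Q8\<close> cis_fourth_root(1)] \<open>y = qmul g (cis t, 0)\<close> 1 by metis
  next
    case (2 h s)
    then show ?thesis
      using assms(3) \<open>g \<in> Q8\<close> \<open>y = qmul g (cis t, 0)\<close> Q8_mixed_fibre(1)[of t s] Q8_orbit_trans[OF \<open>g \<in> Q8\<close> \<open>h \<in> Q8\<close>]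
      by (auto simp: Q8_proj_qmul Q8_proj_right_arc Q8_proj_left_arc)
  qed
next
  case (2 g t)
  show ?thesis using assms(2)
  proof (cases rule: Q8_coverE)
    case (1 h s)
    then have "1 - cis (4 * s) = -1 + cis (4 * t)"
      using assms(3) \<open>g \<in> Q8\<close> 2(2) by (simp add: Q8_proj_qmul Q8_proj_right_arc Q8_proj_left_arc)
    then show ?thesis
      using Q8_mixed_fibre(2)[of s t] Q8_orbit_trans[OF \<open>g \<in> Q8\<close> \<open>h \<in> Q8\<close>] 1(2) 2(2) by metis
  next
    case (2 h s)
    have "cis (4 * t) = cis (4 * s)"
      using assms(3) \<open>g \<in> Q8\<close> \<open>y = qmul g (complex_of_real (cos t), complex_of_real (sin t))\<close> 2
      by (simp add: Q8_proj_qmul Q8_proj_left_arc)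
    then have "cis (4 * (s - t)) = 1" by (simp add: right_diff_distrib flip: cis_divide)
    moreover have "qmul (of_real (cos (s - t)), of_real (sin (s - t))) (of_real (cos t), of_real (sin t)) =
        (of_real (cos s), of_real (sin s))"
      using cos_add[of "s - t" t] sin_add[of "s - t" t]
      by (simp add: qmul_def flip: of_real_mult of_real_diff of_real_add)
    ultimately show ?thesis
      using Q8_orbit_trans[OF \<open>g \<in> Q8\<close> \<open>h \<in> Q8\<close> cis_fourth_root(2)] 2
        \<open>y = qmul g (complex_of_real (cos t), complex_of_real (sin t))\<close> by metis
  qed
qed

lemma unit_Q8_cover: "y \<in> Q8_cover \<Longrightarrow> qmul y (qconj y) = (1, 0)"
proof -
  have 1: "cis t * cis (- t) = 1" for t by (simp add: cis_mult)
  have 2: "complex_of_real (cos t) * complex_of_real (cos t) + complex_of_real (sin t) * complex_of_real (sin t) = 1" for t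
    by (metis of_real_1 of_real_add of_real_mult sin_cos_squared_add3)
  show "y \<in> Q8_cover \<Longrightarrow> qmul y (qconj y) = (1, 0)"
    by (erule Q8_coverE; erule Q8_cases; simp add: qmul_def qconj_def cis_cnj 1 2 algebra_simps)
qed

text \<open>All points of the cover are unit quaternions and can be cancelled.\<close>

lemma qmul_free: "y \<in> Q8_cover \<Longrightarrow> qmul q y = y \<Longrightarrow> q = (1, 0)"
  using unit_Q8_cover[of y] qmul_assoc[of q y "qconj y"] by simp

lemma Q8_proj_in: "y \<in> Q8_cover \<Longrightarrow> Q8_proj y \<in> figure_eight"
  by (erule Q8_coverE) (auto simp: Q8_proj_qmul Q8_proj_right_arc Q8_proj_left_arc right_circle_in
    left_circle_in[simplified])

text \<open>The map \<open>f\<close> lifts the cross to the two arcs through the neutral element, with a quarter of the angle.\<close>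

lemma local_section_Q8:
  assumes "x \<in> figure_eight"
  shows "\<exists>T s. x \<in> T \<and> openin (top_of_set figure_eight) T \<and>
        continuous_on T s \<and> s ` T \<subseteq> Q8_cover \<and> (\<forall>z\<in>T. Q8_proj (s z) = z)"
proof -
  obtain T L where T: "x \<in> T" "openin (top_of_set figure_eight) T" and L: "continuous_on T L"
    "L ` T \<subseteq> axes" "\<forall>z\<in>T. axes_map (L z) = z"
    using axes_map_local_section[OF assms] by metis
  define f where "f = (\<lambda>q. (of_real (cos (snd q / 4)) * cis (fst q / 4), complex_of_real (sin (snd q / 4))))"
  have one: "(1, 0) \<in> Q8" by (simp add: Q8_eq)
  have f: "f q \<in> Q8_cover" "Q8_proj (f q) = axes_map q" if "q \<in> axes" for q
    using that arc_in_Q8_cover[OF one] Q8_proj_right_arc[of "fst q / 4"] Q8_proj_left_arc[of "snd q / 4"]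
    by (auto simp: axes_def f_def axes_map_def)
  have "continuous_on T (\<lambda>z. f (L z))"
    unfolding f_def by (intro continuous_intros L) simp_all
  moreover have "L z \<in> axes" if "z \<in> T" for z using L(2) that by blast
  ultimately show ?thesis using T L(3) f
    by (intro exI[of _ T] exI[of _ "\<lambda>z. f (L z)"]) (simp add: image_subset_iff)
qed

lemma path_connected_Q8_cover: "path_connected Q8_cover"
proof -
  have A: "path_component Q8_cover (qmul g (cis t, 0)) (qmul g (cis s, 0))" if "g \<in> Q8" for g s t
  proof -
    have "path_connected ((\<lambda>t. qmul g (cis t, 0)) ` UNIV)"
      by (intro path_connected_continuous_image continuous_on_qmul continuous_intros) (rule path_connected_UNIV)
    then show ?thesis using arc_in_Q8_cover(1)[OF that]
      by (intro path_component_of_subset[OF _ path_connected_component[THEN iffD1, rule_format]]) auto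
  qed
  have B: "path_component Q8_cover (qmul g (of_real (cos t), of_real (sin t))) (qmul g (of_real (cos s), of_real (sin s)))" if "g \<in> Q8" for g s t
  proof -
    have "path_connected ((\<lambda>t. qmul g (of_real (cos t), of_real (sin t))) ` UNIV)"
      by (intro path_connected_continuous_image continuous_on_qmul continuous_intros) (rule path_connected_UNIV)
    then show ?thesis using arc_in_Q8_cover(2)[OF that]
      by (intro path_component_of_subset[OF _ path_connected_component[THEN iffD1, rule_format]]) auto
  qed
  have stepA: "path_component Q8_cover g (qmul g (\<i>, 0))" if "g \<in> Q8" for g
    using A[OF that, of 0 "pi/2"] by (simp add: cis_pi_half)
  have stepB: "path_component Q8_cover g (qmul g (0, 1))" if "g \<in> Q8" for g
    using B[OF that, of 0 "pi/2"] by simp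
  have i: "path_component Q8_cover (1, 0) (\<i>, 0)" using stepA[of "(1,0)"] by (simp add: Q8_eq)
  moreover have "path_component Q8_cover (\<i>, 0) (-1, 0)" using stepA[of "(\<i>,0)"] by (simp add: Q8_eq qmul_def)
  ultimately have m: "path_component Q8_cover (1, 0) (-1, 0)" by (rule path_component_trans)
  moreover have "path_component Q8_cover (-1, 0) (-\<i>, 0)" using stepA[of "(-1,0)"] by (simp add: Q8_eq qmul_def)
  ultimately have mi: "path_component Q8_cover (1, 0) (-\<i>, 0)" by (rule path_component_trans)
  have j: "path_component Q8_cover (1, 0) (0, 1)" using stepB[of "(1,0)"] by (simp add: Q8_eq)
  have "path_component Q8_cover (-1, 0) (0, -1)" using stepB[of "(-1,0)"] by (simp add: Q8_eq qmul_def)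
  with m have mj: "path_component Q8_cover (1, 0) (0, -1)" by (rule path_component_trans)
  have "path_component Q8_cover (\<i>, 0) (0, -\<i>)" using stepB[of "(\<i>,0)"] by (simp add: Q8_eq qmul_def)
  with i have k: "path_component Q8_cover (1, 0) (0, -\<i>)" by (rule path_component_trans)
  have "path_component Q8_cover (-\<i>, 0) (0, \<i>)" using stepB[of "(-\<i>,0)"] by (simp add: Q8_eq qmul_def)
  with mi have mk: "path_component Q8_cover (1, 0) (0, \<i>)" by (rule path_component_trans)
  have vert: "path_component Q8_cover (1, 0) g" if "g \<in> Q8" for g
    using that i m mi j mj k mk Q8_in_cover[OF that]
    by (cases rule: Q8_cases) (simp_all add: path_component_refl)
  have all: "path_component Q8_cover (1, 0) y" if "y \<in> Q8_cover" for y
    using that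
  proof (cases rule: Q8_coverE)
    case (1 g t)
    then show ?thesis using path_component_trans[OF vert A[of g 0 t, simplified]] by simp
  next
    case (2 g t)
    then show ?thesis using path_component_trans[OF vert B[of g 0 t, simplified]] by simp
  qed
  show ?thesis unfolding path_connected_component
    using all path_component_trans path_component_sym by metis
qed

lemma Q8_action: "free_group_action Q8_group Q8_cover Q8_proj (\<lambda>g. qmul (Q8_dec g))"
proof -
  interpret group Q8_group by (rule group_Q8)
  show ?thesis
  proof
    show "g = \<one>\<^bsub>Q8_group\<^esub>" if "g \<in> carrier Q8_group" "y \<in> Q8_cover" "qmul (Q8_dec g) y = y" for g y
      using qmul_free[OF that(2,3)] that(1) Q8_one by (subst Q8_dec_eq_iff[symmetric]) auto
    show "\<exists>g\<in>carrier Q8_group. qmul (Q8_dec g) y = y'"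
      if "y \<in> Q8_cover" "y' \<in> Q8_cover" "Q8_proj y = Q8_proj y'" for y y'
      using Q8_transitive_fibre[OF that] Q8_dec_surj by metis
  qed (auto simp: qmul_Q8_cover Q8_dec_in Q8_proj_qmul Q8_one Q8_mult qmul_assoc intro!: continuous_on_qmul)
qed

interpretation Q8: galois_covering Q8_group Q8_cover Q8_proj "\<lambda>g. qmul (Q8_dec g)" figure_eight 0 "(1, 0)"
proof -
  interpret free_group_action Q8_group Q8_cover Q8_proj "\<lambda>g. qmul (Q8_dec g)"
    by (rule Q8_action)
  have "continuous_on Q8_cover Q8_proj"
    unfolding Q8_proj_def case_prod_unfold by (intro continuous_intros)
  then have "covering_space Q8_cover Q8_proj figure_eight"
    by (rule covering_space_quotient[rotated]) (use Q8_proj_in local_section_Q8 in \<open>auto simp: Q8_group_def\<close>)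
  then show "galois_covering Q8_group Q8_cover Q8_proj (\<lambda>g. qmul (Q8_dec g)) figure_eight 0 (1, 0)"
    by unfold_locales (auto simp: path_connected_Q8_cover Q8_proj_def Q8_in_cover Q8_eq)
qed

section \<open>Generators of the fundamental group of the figure eight\<close>

text \<open>A path from the wedge point to \<open>axes_map q\<close>. These paths connect every point to the base
point; a point has many of them, one for each preimage in the cross.\<close>

definition ray :: "real \<times> real \<Rightarrow> real \<Rightarrow> complex" where
  "ray q = axes_map \<circ> linepath 0 q"

definition right_loop :: "real \<Rightarrow> complex" where "right_loop = ray (2 * pi, 0)"
definition left_loop :: "real \<Rightarrow> complex" where "left_loop = ray (0, 2 * pi)"

lemma ray_apply: "ray (s, t) x = cis (x * t) - cis (x * s)"
  by (simp add: ray_def axes_map_def linepath_def)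

lemma linepath_in_axes: "q \<in> axes \<Longrightarrow> path_image (linepath 0 q) \<subseteq> axes"
  by (auto simp: path_image_def linepath_def axes_def)

lemma starlike_axes: "starlike axes"
  unfolding starlike_def
  by (intro bexI[of _ 0]) (use linepath_in_axes in \<open>auto simp: path_image_linepath axes_def zero_prod_def\<close>)

text \<open>The cross is starlike, so in it any two paths with the same ends are homotopic.\<close>

lemma homotopic_in_axes:
  assumes "path f" "path_image f \<subseteq> axes" "path g" "path_image g \<subseteq> axes"
    "pathstart f = pathstart g" "pathfinish f = pathfinish g"
  shows "homotopic_paths figure_eight (axes_map \<circ> f) (axes_map \<circ> g)"
proof -
  have "simply_connected axes" by (rule starlike_imp_simply_connected[OF starlike_axes])
  then have "homotopic_paths axes f g"
    using assms unfolding simply_connected_eq_homotopic_paths by simp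
  then show ?thesis
    by (rule homotopic_paths_continuous_image) (auto simp: continuous_on_axes_map axes_map_in)
qed

lemma ray_path:
  assumes "q \<in> axes"
  shows "path (ray q)" "path_image (ray q) \<subseteq> figure_eight" "pathstart (ray q) = 0"
    "pathfinish (ray q) = axes_map q"
proof -
  show "path (ray q)"
    unfolding ray_def by (intro path_continuous_image continuous_on_axes_map) simp
  show "path_image (ray q) \<subseteq> figure_eight"
    using linepath_in_axes[OF assms] axes_map_in by (auto simp: ray_def path_image_compose)
qed (simp_all add: ray_def pathstart_compose pathfinish_compose axes_map_def zero_prod_def)

lemma ray_join:
  assumes "q \<in> axes" "path f" "path_image f \<subseteq> axes" "pathstart f = q"
  shows "homotopic_paths figure_eight (ray q +++ (axes_map \<circ> f)) (ray (pathfinish f))"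
proof -
  have fin: "pathfinish f \<in> axes" using assms by auto
  have "homotopic_paths figure_eight (axes_map \<circ> (linepath 0 q +++ f)) (axes_map \<circ> linepath 0 (pathfinish f))"
    using assms linepath_in_axes[OF fin] linepath_in_axes[OF assms(1)]
    by (intro homotopic_in_axes) (auto simp: path_image_join)
  then show ?thesis by (simp add: ray_def path_compose_join)
qed

abbreviation (input) "pi1 \<equiv> fundamental_group figure_eight 0"

definition generated_classes :: "(real \<Rightarrow> complex) set set" where
  "generated_classes = generate pi1 {loop_class figure_eight right_loop, loop_class figure_eight left_loop}"

definition generated_loops :: "(real \<Rightarrow> complex) set" where
  "generated_loops = {w \<in> loops figure_eight 0. loop_class figure_eight w \<in> generated_classes}"

lemma zero_in_figure_eight: "0 \<in> figure_eight"
  by (simp add: figure_eight_def)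

interpretation pi1: group pi1 by (rule group_fundamental_group[OF zero_in_figure_eight])

lemma ray_loop: "q \<in> axes \<Longrightarrow> axes_map q = 0 \<Longrightarrow> ray q \<in> loops figure_eight 0"
  using ray_path by (simp add: loops_def)

lemma subgroup_generated_classes: "subgroup generated_classes pi1"
  unfolding generated_classes_def
  by (intro pi1.generate_is_subgroup)
     (auto simp: carrier_fundamental_group right_loop_def left_loop_def axes_def axes_map_def cis_2pi
       simp del: cis.simps intro!: imageI ray_loop)

lemma generated_loops_join: "v \<in> generated_loops \<Longrightarrow> w \<in> generated_loops \<Longrightarrow> v +++ w \<in> generated_loops"
  using subgroup.m_closed[OF subgroup_generated_classes] by (auto simp: generated_loops_def loops_join simp flip: mult_loop_class)

lemma inv_loop_class:
  fixes S :: "'a::real_normed_vector set"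
  assumes "w \<in> loops S x" "x \<in> S"
  shows "inv\<^bsub>fundamental_group S x\<^esub> (loop_class S w) = loop_class S (reversepath w)"
proof -
  interpret G: group "fundamental_group S x" by (rule group_fundamental_group[OF assms(2)])
  have c: "(\<lambda>_. x) = linepath x x" by (simp add: linepath_def fun_eq_iff flip: scaleR_left_distrib)
  have "loop_class S (reversepath w +++ w) = loop_class S (\<lambda>_. x)"
    using homotopic_paths_linv[of w S] assms
    by (intro loop_class_eqI[where x=x] loops_join loops_reversepath loops_const) (auto simp: loops_def c)
  then show ?thesis
    using assms by (intro G.inv_equality)
      (auto simp: mult_loop_class loops_reversepath one_fundamental_group carrier_fundamental_group)
qed

lemma generated_loops_reversepath: "w \<in> generated_loops \<Longrightarrow> reversepath w \<in> generated_loops"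
  using subgroup.m_inv_closed[OF subgroup_generated_classes, of "loop_class figure_eight w"]
    inv_loop_class[OF _ zero_in_figure_eight, of w]
  by (simp add: generated_loops_def loops_reversepath)

lemma generated_loops_homotopic:
  assumes "v \<in> generated_loops" "homotopic_paths figure_eight v w"
  shows "w \<in> generated_loops"
proof -
  have "w \<in> loops figure_eight 0"
    using assms(1) homotopic_paths_imp_path[OF assms(2)] homotopic_paths_imp_subset[OF assms(2)]
      homotopic_paths_imp_pathstart[OF assms(2)] homotopic_paths_imp_pathfinish[OF assms(2)]
    unfolding generated_loops_def loops_def by simp
  then show ?thesis using assms loop_class_eqI[of v figure_eight 0 w] by (simp add: generated_loops_def)
qed

lemma generated_loops_basic: "right_loop \<in> generated_loops" "left_loop \<in> generated_loops" "ray 0 \<in> generated_loops"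
proof -
  have "right_loop \<in> loops figure_eight 0" "left_loop \<in> loops figure_eight 0"
    by (auto simp: right_loop_def left_loop_def axes_def axes_map_def intro!: ray_loop)
  then show "right_loop \<in> generated_loops" "left_loop \<in> generated_loops"
    by (auto simp: generated_loops_def generated_classes_def intro: generate.incl)
  have "ray 0 = (\<lambda>_. 0)" by (simp add: ray_def fun_eq_iff axes_map_def zero_prod_def linepath_def)
  then show "ray 0 \<in> generated_loops"
    using subgroup.one_closed[OF subgroup_generated_classes] loops_const[OF zero_in_figure_eight]
    by (simp add: generated_loops_def one_fundamental_group)
qed

text \<open>Running along a line up to \<open>r\<close> is the same as winding \<open>n\<close> times around the circle and running on
from there, which by periodicity looks like running up to \<open>r - 2\<pi>n\<close>.\<close>

lemma ray_shift:
  assumes "e = (1, 0) \<or> e = (0::real, 1::real)"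
  shows "homotopic_paths figure_eight (ray (r *\<^sub>R e))
     (ray ((2 * pi * of_int n) *\<^sub>R e) +++ ray ((r - 2 * pi * of_int n) *\<^sub>R e))"
proof -
  define q where "q = (2 * pi * of_int n) *\<^sub>R e"
  define f where "f = linepath q (r *\<^sub>R e)"
  have ax: "a *\<^sub>R e \<in> axes" for a using assms by (auto simp: axes_def)
  have "path_image f \<subseteq> axes"
    using assms by (auto simp: f_def q_def path_image_def linepath_def axes_def)
  moreover have "axes_map \<circ> f = ray ((r - 2 * pi * of_int n) *\<^sub>R e)"
  proof
    fix x
    have "cis ((1 - x) * (2 * pi * real_of_int n) + x * r) = cis (x * (r - 2 * pi * of_int n)) * cis (2 * pi * of_int n)"
      by (simp add: cis_mult algebra_simps)
    also have "cis (2 * pi * of_int n) = 1" by (simp add: cis_multiple_2pi)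
    finally show "(axes_map \<circ> f) x = ray ((r - 2 * pi * of_int n) *\<^sub>R e) x"
      using assms by (auto simp: f_def q_def linepath_def axes_map_def ray_apply)
  qed
  ultimately have "homotopic_paths figure_eight (ray q +++ ray ((r - 2 * pi * of_int n) *\<^sub>R e)) (ray (r *\<^sub>R e))"
    using ray_join[of q f] ax by (simp add: q_def f_def)
  then show ?thesis unfolding q_def by (rule homotopic_paths_sym)
qed

lemma axes_map_period: 
  assumes "e = (1, 0) \<or> e = (0::real, 1::real)" "axes_map (r *\<^sub>R e) = axes_map (s *\<^sub>R e)"
  obtains n where "r = s + 2 * pi * of_int n"
proof -
  have "cis r = cis s" using assms by (auto simp: axes_map_def)
  then have "cis (r - s) = 1" by (simp flip: cis_divide)
  then have "cos (r - s) = 1" by (simp add: complex_eq_iff)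
  then obtain n where "r - s = of_int n * 2 * pi" using cos_one_2pi_int by blast
  then show ?thesis using that[of n] by (simp add: algebra_simps)
qed

lemma ray_multiple_in_generated_loops:
  assumes "e = (1, 0) \<or> e = (0::real, 1::real)"
  shows "ray ((2 * pi * of_int n) *\<^sub>R e) \<in> generated_loops"
proof -
  define R where "R n = ray ((2 * pi * of_int n) *\<^sub>R e)" for n
  have R1: "R 1 \<in> generated_loops" using assms generated_loops_basic by (auto simp: R_def right_loop_def left_loop_def)
  have step: "homotopic_paths figure_eight (R m) (R k +++ R (m - k))" for m k
    using ray_shift[OF assms, of "2 * pi * of_int m" k] by (simp add: R_def algebra_simps)
  have lp: "R m \<in> loops figure_eight 0" for m
    unfolding R_def using assms by (intro ray_loop) (auto simp: axes_def axes_map_def cis_multiple_2pi)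
  have nonneg: "R (int m) \<in> generated_loops" for m
  proof (induction m)
    case 0
    show ?case using generated_loops_basic(3) by (simp add: R_def)
  next
    case (Suc m)
    have "homotopic_paths figure_eight (R 1 +++ R (int m)) (R (int (Suc m)))"
      using step[of "int (Suc m)" 1] homotopic_paths_sym by simp
    then show ?case using generated_loops_homotopic generated_loops_join R1 Suc by blast
  qed
  have neg: "R (- m) \<in> generated_loops" if "R m \<in> generated_loops" for m
  proof -
    let ?c = "\<lambda>k. loop_class figure_eight (R k)"
    have car: "?c k \<in> carrier pi1" for k using lp by (simp add: carrier_fundamental_group)
    have "R 0 = (\<lambda>_. 0)" by (auto simp: R_def ray_def fun_eq_iff axes_map_def zero_prod_def linepath_def)
    then have "\<one>\<^bsub>pi1\<^esub> = ?c 0" by (simp add: one_fundamental_group)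
    also have "\<dots> = loop_class figure_eight (R (- m) +++ R m)"
      using step[of 0 "- m"] loop_class_eqI[OF lp loops_join[OF lp lp]] by simp
    also have "\<dots> = ?c (- m) \<otimes>\<^bsub>pi1\<^esub> ?c m"
      using mult_loop_class[OF lp lp] by simp
    finally have "inv\<^bsub>pi1\<^esub> ?c m = ?c (- m)"
      using pi1.inv_equality[of "?c (- m)" "?c m"] car by simp
    moreover have "inv\<^bsub>pi1\<^esub> ?c m \<in> generated_classes"
      using that subgroup.m_inv_closed[OF subgroup_generated_classes] by (simp add: generated_loops_def)
    ultimately show ?thesis using lp by (simp add: generated_loops_def)
  qed
  have "R n \<in> generated_loops"
  proof (cases "0 \<le> n")
    case True
    then show ?thesis using nonneg[of "nat n"] by simp
  next
    case False
    then show ?thesis using neg[OF nonneg[of "nat (- n)"]] by simp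
  qed
  then show ?thesis by (simp add: R_def)
qed

lemma axes_cases:
  assumes "q \<in> axes"
  obtains r e where "q = r *\<^sub>R e" "e = (1, 0) \<or> e = (0::real, 1::real)"
proof (cases "fst q = 0")
  case True
  then have "q = snd q *\<^sub>R (0, 1)" by (simp add: prod_eq_iff)
  then show ?thesis by (rule that) simp
next
  case False
  then have "q = fst q *\<^sub>R (1, 0)" using assms by (auto simp: prod_eq_iff axes_def)
  then show ?thesis by (rule that) simp
qed

text \<open>Two preimages of a point other than the wedge point lie on the same line and differ by full turns. For the wedge point
both rays are themselves loops that wind around one of the circles some number of times.\<close>

lemma ray_change:
  assumes "q \<in> axes" "q' \<in> axes" "axes_map q = axes_map q'"
  obtains w where "w \<in> generated_loops" "homotopic_paths figure_eight (ray q) (w +++ ray q')"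
proof -
  obtain r e where q: "q = r *\<^sub>R e" and e: "e = (1, 0) \<or> e = (0, 1)" using axes_cases[OF assms(1)] .
  obtain r' e' where q': "q' = r' *\<^sub>R e'" and e': "e' = (1, 0) \<or> e' = (0, 1)" using axes_cases[OF assms(2)] .
  show ?thesis
  proof (cases "e = e'")
    case True
    then obtain n where "r = r' + 2 * pi * of_int n" using axes_map_period[OF e] assms(3) q q' by metis
    then show ?thesis
      using that[OF ray_multiple_in_generated_loops[OF e]] ray_shift[OF e, of r n] q q' True by simp
  next
    case False
    have "cos r + cos r' = 2"
      using e e' q q' False assms(3) by (auto simp: axes_map_def complex_eq_iff)
    then have "cos r = 1" using cos_le_one[of r] cos_le_one[of r'] by linarith
    then have "Re (axes_map q) = 0" using e q by (auto simp: axes_map_def)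
    then have z: "axes_map q = 0" "axes_map q' = 0"
      using figure_eight_cases(3)[OF axes_map_in[OF assms(1)]] assms(3) by auto
    have "\<exists>n. r = 2 * pi * of_int n" "\<exists>n. r' = 2 * pi * of_int n"
      using axes_map_period[OF e, of r 0] axes_map_period[OF e', of r' 0] z q q'
      by (auto simp: axes_map_def zero_prod_def)
    then have g: "ray q \<in> generated_loops" "ray q' \<in> generated_loops"
      using ray_multiple_in_generated_loops[OF e] ray_multiple_in_generated_loops[OF e'] q q' by auto
    then have l: "ray q \<in> loops figure_eight 0" "ray q' \<in> loops figure_eight 0" by (auto simp: generated_loops_def)
    have "loop_class figure_eight ((ray q +++ reversepath (ray q')) +++ ray q') =
        loop_class figure_eight (ray q) \<otimes>\<^bsub>pi1\<^esub> inv\<^bsub>pi1\<^esub> loop_class figure_eight (ray q')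
          \<otimes>\<^bsub>pi1\<^esub> loop_class figure_eight (ray q')"
      using l by (simp add: mult_loop_class loops_join loops_reversepath inv_loop_class zero_in_figure_eight)
    also have "\<dots> = loop_class figure_eight (ray q)"
    proof -
      have "loop_class figure_eight (ray q) \<in> carrier pi1" "loop_class figure_eight (ray q') \<in> carrier pi1"
        using l by (auto simp: carrier_fundamental_group)
      then show ?thesis by (simp add: pi1.m_assoc)
    qed
    finally have "homotopic_paths figure_eight (ray q) ((ray q +++ reversepath (ray q')) +++ ray q')"
      using l loop_class_eq_iff[of "ray q" figure_eight 0 "(ray q +++ reversepath (ray q')) +++ ray q'"]
      by (simp add: loops_join loops_reversepath)
    then show ?thesis
      by (rule that[OF generated_loops_join[OF g(1) generated_loops_reversepath[OF g(2)]]])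
  qed
qed

text \<open>Cut a loop \<open>g\<close> into pieces over which \<open>axes_map\<close> has a section; \<open>Bolzano\<close> does the subdivision. The
invariant \<open>P a b\<close> says that a ray to \<open>g a\<close> followed by the piece of \<open>g\<close> from \<open>a\<close> to \<open>b\<close> is, up to
a loop generated by the two standard ones, a ray to \<open>g b\<close>. On a short piece the given ray is first exchanged
for the one chosen by the section; then everything happens in the contractible cross.\<close>

theorem fundamental_group_figure_eight_generated:
  "carrier pi1 = generate pi1 {loop_class figure_eight right_loop, loop_class figure_eight left_loop}"
proof
  have "loop_class figure_eight g \<in> generated_classes" if g: "g \<in> loops figure_eight 0" for g
  proof -
    have pg: "path g" "path_image g \<subseteq> figure_eight" "g 0 = 0" "g 1 = 0"
      using g by (auto simp: loops_def pathstart_def pathfinish_def)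
    have gin: "g t \<in> figure_eight" if "0 \<le> t" "t \<le> 1" for t
      using pg that by (auto simp: path_image_def)
    define P where "P a b \<longleftrightarrow> (0 \<le> a \<longrightarrow> a \<le> b \<longrightarrow> b \<le> 1 \<longrightarrow>
      (\<forall>q\<in>axes. axes_map q = g a \<longrightarrow> (\<exists>w\<in>generated_loops. \<exists>q'\<in>axes. axes_map q' = g b \<and>
         homotopic_paths figure_eight (ray q +++ subpath a b g) (w +++ ray q'))))" for a b
    have sub: "path (subpath a b g)" "path_image (subpath a b g) \<subseteq> figure_eight"
      if "0 \<le> a" "a \<le> b" "b \<le> 1" for a b
      using that pg path_subpath[of g a b] path_image_subpath_subset[of a b g] by auto
    have "P 0 1"
    proof (rule Bolzano)
      fix a b c assume P: "P a b" "P b c" and le: "a \<le> b" "b \<le> c"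
      show "P a c"
        unfolding P_def
      proof (intro impI ballI)
        fix q assume ac: "0 \<le> a" "c \<le> 1" and q: "q \<in> axes" "axes_map q = g a"
        obtain w q' where w: "w \<in> generated_loops" "q' \<in> axes" "axes_map q' = g b"
          "homotopic_paths figure_eight (ray q +++ subpath a b g) (w +++ ray q')"
          using P(1)[unfolded P_def, rule_format, of q] q ac le by auto
        obtain w' q'' where w': "w' \<in> generated_loops" "q'' \<in> axes" "axes_map q'' = g c"
          "homotopic_paths figure_eight (ray q' +++ subpath b c g) (w' +++ ray q'')"
          using P(2)[unfolded P_def, rule_format, of q'] w ac le by auto
        have wl: "path w" "path_image w \<subseteq> figure_eight" "pathstart w = 0" "pathfinish w = 0"
          "path w'" "path_image w' \<subseteq> figure_eight" "pathstart w' = 0" "pathfinish w' = 0"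
          using w w' by (auto simp: generated_loops_def loops_def)
        note sub_ab = sub[of a b] and sub_bc = sub[of b c]
        have "homotopic_paths figure_eight (ray q +++ subpath a c g) (ray q +++ (subpath a b g +++ subpath b c g))"
          using ac le q ray_path[OF q(1)] pg
          by (intro homotopic_paths_join homotopic_paths_sym[OF homotopic_join_subpaths])
             (auto simp: )
        also have "homotopic_paths figure_eight \<dots> ((ray q +++ subpath a b g) +++ subpath b c g)"
          using ac le q ray_path[OF q(1)] sub_ab sub_bc by (intro homotopic_paths_assoc) auto
        also have "homotopic_paths figure_eight \<dots> ((w +++ ray q') +++ subpath b c g)"
          by (rule homotopic_paths_join[OF w(4)]) (use ac le q ray_path[OF q(1)] sub_ab sub_bc in auto)
        also have "homotopic_paths figure_eight \<dots> (w +++ (ray q' +++ subpath b c g))"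
          using ac le w wl sub_bc ray_path[OF w(2)]
          by (intro homotopic_paths_sym[OF homotopic_paths_assoc]) auto
        also have "homotopic_paths figure_eight \<dots> (w +++ (w' +++ ray q''))"
          by (rule homotopic_paths_join[OF _ w'(4)]) (use wl ray_path[OF w(2)] in auto)
        also have "homotopic_paths figure_eight \<dots> ((w +++ w') +++ ray q'')"
          using w' wl ray_path[OF w'(2)] by (intro homotopic_paths_assoc) auto
        finally show "\<exists>w\<in>generated_loops. \<exists>q'\<in>axes. axes_map q' = g c \<and>
           homotopic_paths figure_eight (ray q +++ subpath a c g) (w +++ ray q')"
          using w' generated_loops_join[OF w(1) w'(1)] by blast
      qed
    next
      fix x :: real assume x: "0 \<le> x" "x \<le> 1"
      obtain T L where T: "g x \<in> T" "openin (top_of_set figure_eight) T" and L: "continuous_on T L"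
        "L ` T \<subseteq> axes" "\<forall>z\<in>T. axes_map (L z) = z"
        using axes_map_local_section[OF gin[OF x]] by metis
      have "openin (top_of_set {0..1}) ({0..1} \<inter> g -` T)"
        using pg(1,2) T(2) unfolding path_def path_image_def
        by (intro continuous_openin_preimage[of _ g figure_eight]) auto
      then obtain d where d: "d > 0" "\<And>t. t \<in> {0..1} \<Longrightarrow> dist t x < d \<Longrightarrow> t \<in> {0..1} \<inter> g -` T"
        using x T(1) unfolding openin_euclidean_subtopology_iff by (metis IntI atLeastAtMost_iff vimageI)
      have "P a b" if ab: "a \<le> x" "x \<le> b" "b - a < d" for a b
        unfolding P_def
      proof (intro impI ballI)
        fix q assume ab': "0 \<le> a" "a \<le> b" "b \<le> 1" and q: "q \<in> axes" "axes_map q = g a"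
        define \<delta> where "\<delta> = subpath a b g"
        have inT: "\<delta> t \<in> T" if t: "t \<in> {0..1}" for t
        proof -
          define u where "u = (b - a) * t"
          have "(b - a) * t \<le> (b - a) * 1" using t ab' by (intro mult_left_mono) auto
          moreover have "0 \<le> (b - a) * t" using t ab' by simp
          ultimately have u: "0 \<le> u" "u \<le> b - a" by (simp_all add: u_def)
          then have "u + a \<in> {0..1}" using ab' by simp
          moreover have "dist (u + a) x < d" using u ab by (simp add: dist_real_def abs_less_iff)
          ultimately show ?thesis using d(2)[of "u + a"] by (simp add: \<delta>_def subpath_def u_def)
        qed
        have pd: "path \<delta>" "path_image \<delta> \<subseteq> figure_eight" "pathstart \<delta> = g a" "pathfinish \<delta> = g b"
          using sub ab' by (auto simp: \<delta>_def)
        define f where "f = L \<circ> \<delta>"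
        have pf: "path f"
          unfolding f_def by (intro path_continuous_image pd continuous_on_subset[OF L(1)]) (use inT in \<open>auto simp: path_image_def\<close>)
        have imf: "path_image f \<subseteq> axes"
          using L(2) inT by (auto simp: f_def path_image_def)
        have Lab: "axes_map (pathstart f) = g a" "axes_map (pathfinish f) = g b"
          using L(3) inT[of 0] inT[of 1] pd by (auto simp: f_def pathstart_def pathfinish_def)
        have ax: "pathstart f \<in> axes" "pathfinish f \<in> axes" using imf by auto
        obtain w where w: "w \<in> generated_loops" "homotopic_paths figure_eight (ray q) (w +++ ray (pathstart f))"
          using ray_change[OF q(1) ax(1)] q(2) Lab(1) by metis
        have wl: "path w" "path_image w \<subseteq> figure_eight" "pathstart w = 0" "pathfinish w = 0"
          using w by (auto simp: generated_loops_def loops_def)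
        have df: "homotopic_paths figure_eight \<delta> (axes_map \<circ> f)"
          using pd L(3) inT by (intro homotopic_paths_eq) (auto simp: f_def)
        have "homotopic_paths figure_eight (ray q +++ \<delta>) ((w +++ ray (pathstart f)) +++ (axes_map \<circ> f))"
          by (rule homotopic_paths_join[OF w(2) df]) (use ray_path[OF q(1)] q pd in auto)
        also have "homotopic_paths figure_eight \<dots> (w +++ (ray (pathstart f) +++ (axes_map \<circ> f)))"
          using wl homotopic_paths_imp_path[OF df] homotopic_paths_imp_subset[OF df] ray_path[OF ax(1)]
          by (intro homotopic_paths_sym[OF homotopic_paths_assoc]) (auto simp: pathstart_compose)
        also have "homotopic_paths figure_eight \<dots> (w +++ ray (pathfinish f))"
          by (rule homotopic_paths_join[OF _ ray_join[OF ax(1) pf imf refl]]) (use wl ray_path[OF ax(1)] in auto)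
        finally show "\<exists>w\<in>generated_loops. \<exists>q'\<in>axes. axes_map q' = g b \<and>
           homotopic_paths figure_eight (ray q +++ subpath a b g) (w +++ ray q')"
          using w(1) ax(2) Lab(2) unfolding \<delta>_def by blast
      qed
      then show "\<exists>d>0. \<forall>a b. a \<le> x \<and> x \<le> b \<and> b - a < d \<longrightarrow> P a b" using d(1) by blast
    qed simp
    note P01 = this
    have zero: "0 \<in> axes" "axes_map 0 = g 0" by (auto simp: axes_def axes_map_def zero_prod_def pg)
    then obtain w q where w: "w \<in> generated_loops" "q \<in> axes" "axes_map q = g 1"
       "homotopic_paths figure_eight (ray 0 +++ g) (w +++ ray q)"
      using P01[unfolded P_def, rule_format, of 0] by auto
    have "axes_map q = axes_map 0" using w pg by (simp add: axes_map_def zero_prod_def)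
    then obtain v where v: "v \<in> generated_loops" "homotopic_paths figure_eight (ray q) (v +++ ray 0)"
      using ray_change[OF w(2) zero(1)] by metis
    then have "ray q \<in> generated_loops"
      using generated_loops_homotopic[OF generated_loops_join[OF v(1) generated_loops_basic(3)]] homotopic_paths_sym by blast
    then have "ray 0 +++ g \<in> generated_loops"
      using generated_loops_homotopic[OF generated_loops_join[OF w(1)]] w(4) homotopic_paths_sym by blast
    moreover have "ray 0 = (\<lambda>_. 0)" by (simp add: ray_def fun_eq_iff axes_map_def zero_prod_def linepath_def)
    ultimately have "\<one>\<^bsub>pi1\<^esub> \<otimes>\<^bsub>pi1\<^esub> loop_class figure_eight g \<in> generated_classes"
      using g loops_const[OF zero_in_figure_eight] by (simp add: one_fundamental_group mult_loop_class generated_loops_def)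
    then show ?thesis using g by (simp add: carrier_fundamental_group)
  qed
  then show "carrier pi1 \<subseteq> generate pi1 {loop_class figure_eight right_loop, loop_class figure_eight left_loop}"
    by (auto simp: carrier_fundamental_group generated_classes_def)
  show "generate pi1 {loop_class figure_eight right_loop, loop_class figure_eight left_loop} \<subseteq> carrier pi1"
    using subgroup.subset[OF subgroup_generated_classes] by (simp add: generated_classes_def)
qed

section \<open>Parity homomorphisms of a free basis\<close>

text \<open>Homomorphisms to \<open>\<int>/2\<close>, which is represented by \<^typ>\<open>bool\<close> with exclusive disjunction as addition.\<close>

definition parity_hom :: "('a, 'm) monoid_scheme \<Rightarrow> ('a \<Rightarrow> bool) \<Rightarrow> bool" where
  "parity_hom G f \<longleftrightarrow> (\<forall>g\<in>carrier G. \<forall>h\<in>carrier G. f (g \<otimes>\<^bsub>G\<^esub> h) = (f g \<noteq> f h))"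

lemma (in group) parity_hom_vanishes_on_generate:
  assumes f: "parity_hom G f" and S: "S \<subseteq> carrier G" "\<And>s. s \<in> S \<Longrightarrow> \<not> f s"
    and g: "g \<in> generate G S"
  shows "\<not> f g"
proof -
  have mult: "f (g \<otimes> h) = (f g \<noteq> f h)" if "g \<in> carrier G" "h \<in> carrier G" for g h
    using f that by (auto simp: parity_hom_def)
  have one: "\<not> f \<one>" using mult[of \<one> \<one>] by simp
  show ?thesis
    using g
  proof (induction g rule: generate.induct)
    case (inv h)
    then have "f (inv h \<otimes> h) = (f (inv h) \<noteq> f h)" using S by (intro mult) auto
    moreover have "inv h \<otimes> h = \<one>" using inv S by (intro l_inv) auto
    ultimately show ?case using one inv S by simp
  next
    case (eng h1 h2)
    then show ?case using mult generate_in_carrier[OF S(1)] by simp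
  qed (use one S in auto)
qed

lemma word_value_simps [simp]:
  "word_value G [] = \<one>\<^bsub>G\<^esub>"
  "word_value G ((b, e) # w) = (if e then b else inv\<^bsub>G\<^esub> b) \<otimes>\<^bsub>G\<^esub> word_value G w"
  by (simp_all add: word_value_def)

definition word_inverse :: "('a \<times> bool) list \<Rightarrow> ('a \<times> bool) list" where
  "word_inverse w = rev (map (\<lambda>(b, e). (b, \<not> e)) w)"

abbreviation occurrences :: "'a \<Rightarrow> ('a \<times> bool) list \<Rightarrow> nat" where
  "occurrences x w \<equiv> length (filter (\<lambda>l. fst l = x) w)"

lemma occurrences_word_inverse: "occurrences x (word_inverse w) = occurrences x w"
  by (induction w) (auto simp: word_inverse_def)

lemma letters_word_inverse: "fst ` set (word_inverse w) = fst ` set w"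
  by (force simp: word_inverse_def image_iff)

context group begin

lemma word_value_closed: "fst ` set w \<subseteq> carrier G \<Longrightarrow> word_value G w \<in> carrier G"
  by (induction w) auto

lemma word_value_append:
  "fst ` set v \<subseteq> carrier G \<Longrightarrow> fst ` set w \<subseteq> carrier G \<Longrightarrow>
    word_value G (v @ w) = word_value G v \<otimes> word_value G w"
  by (induction v) (auto simp: word_value_closed m_assoc)

lemma word_value_word_inverse:
  "fst ` set w \<subseteq> carrier G \<Longrightarrow> word_value G (word_inverse w) = inv (word_value G w)"
proof (induction w)
  case (Cons l w)
  obtain b e where l: "l = (b, e)" by force
  have "word_inverse (l # w) = word_inverse w @ [(b, \<not> e)]" by (simp add: word_inverse_def l)
  then show ?case
    using Cons l by (auto simp: word_value_append letters_word_inverse word_value_closed inv_mult_group)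
qed (simp add: word_inverse_def)

lemma generate_word:
  assumes "B \<subseteq> carrier G" "g \<in> generate G B"
  shows "\<exists>w. fst ` set w \<subseteq> B \<and> word_value G w = g"
  using assms(2)
proof (induction g rule: generate.induct)
  case one
  show ?case by (rule exI[of _ "[]"]) simp
next
  case (incl h)
  then show ?case using assms(1) by (intro exI[of _ "[(h, True)]"]) auto
next
  case (inv h)
  then show ?case using assms(1) by (intro exI[of _ "[(h, False)]"]) auto
next
  case (eng g h)
  then obtain v w where vw: "fst ` set v \<subseteq> B" "word_value G v = g" "fst ` set w \<subseteq> B" "word_value G w = h"
    by blast
  then have "word_value G (v @ w) = g \<otimes> h"
    using assms(1) by (subst word_value_append) auto
  then show ?case using vw by (intro exI[of _ "v @ w"]) auto
qed

text \<open>A nonempty word with value \<open>1\<close> in a free basis is not reduced. Cancelling two adjacent inverse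
letters changes the number of occurrences of \<open>x\<close> by \<open>0\<close> or \<open>2\<close>.\<close>

lemma trivial_word_even:
  assumes B: "free_basis G B" and w: "fst ` set w \<subseteq> B" "word_value G w = \<one>"
  shows "even (occurrences x w)"
  using w
proof (induction "length w" arbitrary: w rule: less_induct)
  case less
  have BG: "B \<subseteq> carrier G" using B by (simp add: free_basis_def)
  show ?case
  proof (cases "w = []")
    case False
    then have "\<not> reduced_word w" using B less.prems by (auto simp: free_basis_def)
    then obtain i where i: "Suc i < length w" "fst (w ! i) = fst (w ! Suc i)" "snd (w ! i) \<noteq> snd (w ! Suc i)"
      by (auto simp: reduced_word_def)
    define u v b e where "u = take i w" and "v = drop (Suc (Suc i)) w" and "b = fst (w ! i)" and "e = snd (w ! i)"
    have "w = take i w @ w ! i # w ! Suc i # drop (Suc (Suc i)) w"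
      using i(1) by (metis Cons_nth_drop_Suc Suc_lessD append_take_drop_id)
    moreover have "w ! i = (b, e)" "w ! Suc i = (b, \<not> e)"
      using i(2,3) by (simp_all add: b_def e_def prod_eq_iff)
    ultimately have w_eq: "w = u @ (b, e) # (b, \<not> e) # v"
      by (simp add: u_def v_def)
    have sub: "fst ` set u \<subseteq> B" "fst ` set v \<subseteq> B" "b \<in> B" using less.prems(1) w_eq by auto
    then have car: "fst ` set u \<subseteq> carrier G" "fst ` set v \<subseteq> carrier G" "b \<in> carrier G" using BG by auto
    have "word_value G ((b, e) # (b, \<not> e) # v) = word_value G v"
      using car word_value_closed[OF car(2)] by (auto simp flip: m_assoc)
    then have "word_value G (u @ v) = \<one>"
      using less.prems(2) w_eq car word_value_append[OF car(1), of "(b, e) # (b, \<not> e) # v"]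
        word_value_append[OF car(1,2)] by simp
    then have "even (occurrences x (u @ v))"
      using sub by (intro less.hyps) (auto simp: w_eq)
    then show ?thesis by (auto simp: w_eq)
  qed simp
qed

text \<open>The homomorphism counts occurrences of \<open>x\<close> modulo 2 in any word with the given value; for two such
words \<open>v\<close> and \<open>w\<close> the word \<open>v w\<^sup>-\<^sup>1\<close> is trivial, so the counts agree.\<close>

lemma free_basis_parity_hom:
  assumes B: "free_basis G B" and x: "x \<in> B"
  obtains f where "parity_hom G f" "f x"
proof -
  have BG: "B \<subseteq> carrier G" "generate G B = carrier G" using B by (auto simp: free_basis_def)
  define f where "f g \<longleftrightarrow> (\<exists>w. fst ` set w \<subseteq> B \<and> word_value G w = g \<and> odd (occurrences x w))" for g
  have f_word: "f (word_value G w) = odd (occurrences x w)" if w: "fst ` set w \<subseteq> B" for w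
  proof -
    have "even (occurrences x v) = even (occurrences x w)"
      if v: "fst ` set v \<subseteq> B" "word_value G v = word_value G w" for v
    proof -
      have vw: "fst ` set v \<subseteq> carrier G" "fst ` set (word_inverse w) \<subseteq> carrier G" "fst ` set w \<subseteq> carrier G"
        using v w BG by (auto simp: letters_word_inverse)
      have "word_value G (v @ word_inverse w) = \<one>"
        using v(2) vw word_value_closed by (simp add: word_value_append word_value_word_inverse)
      then have "even (occurrences x (v @ word_inverse w))"
        using v w by (intro trivial_word_even[OF B]) (auto simp: letters_word_inverse image_Un)
      then show ?thesis using occurrences_word_inverse[of x w] by simp
    qed
    then show ?thesis unfolding f_def using w by blast
  qed
  have "parity_hom G f"
    unfolding parity_hom_def
  proof (intro ballI)
    fix g h assume "g \<in> carrier G" "h \<in> carrier G"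
    then obtain v w where vw: "fst ` set v \<subseteq> B" "word_value G v = g" "fst ` set w \<subseteq> B" "word_value G w = h"
      using generate_word[OF BG(1)] BG(2) by metis
    then have "word_value G (v @ w) = g \<otimes> h" using BG by (subst word_value_append) auto
    then show "f (g \<otimes> h) = (f g \<noteq> f h)"
      using f_word[of "v @ w"] f_word[of v] f_word[of w] vw by auto
  qed
  moreover have "f x" using f_word[of "[(x, True)]"] x BG by auto
  ultimately show ?thesis using that by blast
qed

end

section \<open>Quaternion values of primitive elements\<close>

abbreviation Q8_value :: "(real \<Rightarrow> complex) set \<Rightarrow> quat" where
  "Q8_value A \<equiv> Q8_dec (Q8.monodromy A)"

lemma monodromy_in: "A \<in> carrier pi1 \<Longrightarrow> Q8.monodromy A \<in> carrier Q8_group"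
  using Q8.monodromy_hom by (auto simp: hom_def)

lemma Q8_value_in: "A \<in> carrier pi1 \<Longrightarrow> Q8_value A \<in> Q8"
  using monodromy_in Q8_dec_in by blast

lemma Q8_value_mult: "A \<in> carrier pi1 \<Longrightarrow> B \<in> carrier pi1 \<Longrightarrow> Q8_value (A \<otimes>\<^bsub>pi1\<^esub> B) = qmul (Q8_value A) (Q8_value B)"
  using Q8.monodromy_hom by (simp add: hom_mult[of _ pi1 Q8_group] Q8_mult monodromy_in)

lemma basic_loops: "right_loop \<in> loops figure_eight 0" "left_loop \<in> loops figure_eight 0"
  using generated_loops_basic by (auto simp: generated_loops_def)

lemma Q8_value_eqI:
  assumes "g \<in> loops figure_eight 0" "is_lift Q8_cover Q8_proj (1, 0) g h" "pathfinish h \<in> Q8"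
  shows "Q8_value (loop_class figure_eight g) = pathfinish h"
  using Q8.monodromy_eq[OF assms(1,2) Q8_enc_in[OF assms(3)]] Q8_dec_enc[OF assms(3)] by simp

lemma Q8_value_right_loop: "Q8_value (loop_class figure_eight right_loop) = (\<i>, 0)"
proof -
  define h where "h t = (cis (t * pi / 2), 0::complex)" for t
  have "path h" unfolding path_def h_def by (intro continuous_intros) auto
  then have "is_lift Q8_cover Q8_proj (1, 0) right_loop h"
    using arc_in_Q8_cover(1)[of "(1, 0)"]
    by (auto simp: is_lift_def h_def path_image_def pathstart_def right_loop_def ray_apply Q8_eq
        Q8_proj_right_arc ac_simps)
  moreover have "pathfinish h = (\<i>, 0)" by (simp add: h_def pathfinish_def)
  ultimately show ?thesis using Q8_value_eqI[OF basic_loops(1)] by (simp add: Q8_eq)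
qed

lemma Q8_value_left_loop: "Q8_value (loop_class figure_eight left_loop) = (0, 1)"
proof -
  define h where "h t = (complex_of_real (cos (t * pi / 2)), complex_of_real (sin (t * pi / 2)))" for t
  have "path h" unfolding path_def h_def by (intro continuous_intros) auto
  moreover have "Q8_proj (h t) = left_loop t" for t
    unfolding h_def Q8_proj_left_arc by (simp add: left_loop_def ray_apply algebra_simps)
  moreover have "h t \<in> Q8_cover" for t
    using arc_in_Q8_cover(2)[of "(1, 0)" "t * pi / 2"] by (simp add: h_def Q8_eq)
  ultimately have "is_lift Q8_cover Q8_proj (1, 0) left_loop h"
    by (auto simp: is_lift_def path_image_def pathstart_def) (simp_all add: h_def)
  moreover have "pathfinish h = (0, 1)" by (simp add: h_def pathfinish_def)
  ultimately show ?thesis using Q8_value_eqI[OF basic_loops(2)] by (simp add: Q8_eq)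
qed

text \<open>The coordinates of the quotient of the quaternion group by its centre with respect to the basis
formed by \<open>i\<close> and \<open>j\<close>: the first is odd on \<open>\<plusminus>i\<close>, \<open>\<plusminus>k\<close>, the second on \<open>\<plusminus>j\<close>, \<open>\<plusminus>k\<close>.\<close>

definition i_parity :: "quat \<Rightarrow> bool" where "i_parity q \<longleftrightarrow> Re (fst q) = 0 \<and> Re (snd q) = 0"
definition j_parity :: "quat \<Rightarrow> bool" where "j_parity q \<longleftrightarrow> fst q = 0"

lemma Q8_parities:
  assumes "g \<in> Q8" "h \<in> Q8"
  shows "i_parity (qmul g h) = (i_parity g \<noteq> i_parity h)" "j_parity (qmul g h) = (j_parity g \<noteq> j_parity h)"
  by (rule Q8_cases[OF assms(1)]; rule Q8_cases[OF assms(2)]; simp add: qmul_def i_parity_def j_parity_def)+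

text \<open>The parity homomorphism \<open>f\<close> of a basis that contains \<open>A\<close> is determined by its values on the
two standard loops: it is the corresponding combination of \<open>i_parity\<close> and \<open>j_parity\<close>. On
an element with value \<open>1\<close> or \<open>-1\<close> this combination vanishes, but \<open>f\<close> does not vanish at \<open>A\<close>.\<close>

lemma primitive_value_noncentral:
  assumes "primitive_element pi1 A"
  shows "A \<in> carrier pi1" "Q8_value A \<notin> {(1, 0), (-1, 0)}"
proof -
  obtain B where B: "free_basis pi1 B" "A \<in> B" using assms by (auto simp: primitive_element_def)
  then show A: "A \<in> carrier pi1" by (auto simp: free_basis_def)
  obtain f where f: "parity_hom pi1 f" "f A" using pi1.free_basis_parity_hom[OF B] by blast
  let ?a = "loop_class figure_eight right_loop" and ?b = "loop_class figure_eight left_loop"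
  \<comment> \<open>The difference of \<open>f\<close> and the combination, to be shown to vanish.\<close>
  define D where "D g \<longleftrightarrow> (f g \<noteq> ((f ?a \<and> i_parity (Q8_value g)) \<noteq> (f ?b \<and> j_parity (Q8_value g))))" for g
  have "parity_hom pi1 D"
    using f(1) unfolding parity_hom_def D_def
    by (auto simp: Q8_value_mult Q8_parities Q8_value_in)
  moreover have "\<not> D ?a" "\<not> D ?b"
    by (simp_all add: D_def Q8_value_right_loop Q8_value_left_loop i_parity_def j_parity_def)
  moreover have "{?a, ?b} \<subseteq> carrier pi1" using basic_loops by (auto simp: carrier_fundamental_group)
  ultimately have "\<not> D A"
    using pi1.parity_hom_vanishes_on_generate[of D "{?a, ?b}" A] A
      fundamental_group_figure_eight_generated by blast
  then show "Q8_value A \<notin> {(1, 0), (-1, 0)}"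
    using f(2) by (auto simp: D_def i_parity_def j_parity_def)
qed

lemma primitive_value_square:
  assumes "primitive_element pi1 A"
  shows "qmul (Q8_value A) (Q8_value A) = (-1, 0)"
  by (rule Q8_cases[OF Q8_value_in[OF primitive_value_noncentral(1)[OF assms]]])
    (use primitive_value_noncentral(2)[OF assms] in \<open>simp_all add: qmul_def\<close>)

section \<open>Complex homology\<close>

lemma keys_cscale: "Poly_Mapping.keys (cscale a c) \<subseteq> Poly_Mapping.keys c"
  by (auto simp: cscale_def in_keys_iff map.rep_eq when_def)

lemma lookup_cscale [simp]: "Poly_Mapping.lookup (cscale a c) f = a * Poly_Mapping.lookup c f"
  by (simp add: cscale_def map.rep_eq when_def)

text \<open>The linear extension of a function on singular simplices to chains.\<close>

definition chain_eval :: "(((nat \<Rightarrow> real) \<Rightarrow> 'a) \<Rightarrow> complex) \<Rightarrow> 'a cchain \<Rightarrow> complex" where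
  "chain_eval L c = (\<Sum>f\<in>Poly_Mapping.keys c. Poly_Mapping.lookup c f * L f)"

lemma chain_eval_superset:
  assumes "finite A" "Poly_Mapping.keys c \<subseteq> A"
  shows "chain_eval L c = (\<Sum>f\<in>A. Poly_Mapping.lookup c f * L f)"
  unfolding chain_eval_def using assms
  by (intro sum.mono_neutral_left) (auto simp: in_keys_iff)

lemma chain_eval_add: "chain_eval L (c + d) = chain_eval L c + chain_eval L d"
proof -
  let ?A = "Poly_Mapping.keys c \<union> Poly_Mapping.keys d"
  have "chain_eval L (c + d) = (\<Sum>f\<in>?A. Poly_Mapping.lookup (c + d) f * L f)"
    using Poly_Mapping.keys_add[of c d] by (intro chain_eval_superset) auto
  also have "\<dots> = (\<Sum>f\<in>?A. Poly_Mapping.lookup c f * L f) + (\<Sum>f\<in>?A. Poly_Mapping.lookup d f * L f)"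
    by (simp add: lookup_add algebra_simps sum.distrib)
  also have "\<dots> = chain_eval L c + chain_eval L d"
    by (simp add: chain_eval_superset[of ?A])
  finally show ?thesis .
qed

lemma chain_eval_zero [simp]: "chain_eval L 0 = 0"
  by (simp add: chain_eval_def)

lemma chain_eval_single [simp]: "chain_eval L (Poly_Mapping.single f a) = a * L f"
  by (cases "a = 0") (simp_all add: chain_eval_def)

lemma chain_eval_scale: "chain_eval L (cscale a c) = a * chain_eval L c"
proof -
  have "chain_eval L (cscale a c) = (\<Sum>f\<in>Poly_Mapping.keys c. Poly_Mapping.lookup (cscale a c) f * L f)"
    by (intro chain_eval_superset keys_cscale) simp
  then show ?thesis by (simp add: chain_eval_def sum_distrib_left mult.assoc)
qed

lemma chain_eval_sum: "finite A \<Longrightarrow> chain_eval L (\<Sum>x\<in>A. c x) = (\<Sum>x\<in>A. chain_eval L (c x))"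
  by (induction A rule: finite_induct) (simp_all add: chain_eval_add)

text \<open>Each coefficient of the boundary is a linear functional of the chain; linearity of the boundary
follows from that of \<open>chain_eval\<close>.\<close>

lemma lookup_cboundary:
  assumes "n \<noteq> 0"
  shows "Poly_Mapping.lookup (cboundary n c) g =
    chain_eval (\<lambda>f. \<Sum>k\<le>n. (-1) ^ k when singular_face n k f = g) c"
  using assms
  by (simp add: cboundary_def chain_eval_def lookup_sum lookup_single sum_distrib_left when_def if_distrib mult.commute cong: if_cong)

lemma cboundary_add: "cboundary n (c + d) = cboundary n c + cboundary n d"
  by (cases "n = 0") (simp add: cboundary_def, rule poly_mapping_eqI, simp add: lookup_add lookup_cboundary chain_eval_add)

lemma cboundary_scale: "cboundary n (cscale a c) = cscale a (cboundary n c)"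
  by (cases "n = 0") (rule poly_mapping_eqI, simp add: cboundary_def, rule poly_mapping_eqI, simp add: lookup_cboundary chain_eval_scale)

lemma cboundary_zero [simp]: "cboundary n 0 = 0"
  by (simp add: cboundary_def)

lemma cchains_add: "c \<in> cchains n T \<Longrightarrow> d \<in> cchains n T \<Longrightarrow> c + d \<in> cchains n T"
  using Poly_Mapping.keys_add[of c d] by (auto simp: cchains_def)

lemma cchains_scale: "c \<in> cchains n T \<Longrightarrow> cscale a c \<in> cchains n T"
  using keys_cscale[of a c] by (auto simp: cchains_def)

lemma cscale_zero [simp]: "cscale a 0 = 0" "cscale 0 c = 0"
  by (auto intro!: poly_mapping_eqI)

lemma cscale_add: "cscale a (c + d) = cscale a c + cscale a d"
  by (rule poly_mapping_eqI) (simp add: lookup_add algebra_simps)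

lemma cscale_neg_one: "cscale (-1) c = - c"
  by (rule poly_mapping_eqI) simp

lemma cboundaries_zero: "0 \<in> cboundaries n T"
  unfolding cboundaries_def by (rule image_eqI[of _ _ 0]) (simp_all add: cchains_def)

lemma cboundaries_add: "b \<in> cboundaries n T \<Longrightarrow> b' \<in> cboundaries n T \<Longrightarrow> b + b' \<in> cboundaries n T"
  unfolding cboundaries_def by (auto simp: cboundary_add[symmetric] intro!: imageI cchains_add)

lemma cboundaries_scale: "b \<in> cboundaries n T \<Longrightarrow> cscale a b \<in> cboundaries n T"
  unfolding cboundaries_def by (auto simp: cboundary_scale[symmetric] intro!: imageI cchains_scale)

lemma cboundaries_diff: "b \<in> cboundaries n T \<Longrightarrow> b' \<in> cboundaries n T \<Longrightarrow> b - b' \<in> cboundaries n T"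
  using cboundaries_add[of b n T "cscale (-1) b'"] cboundaries_scale[of b' n T "-1"] by (simp add: cscale_neg_one)

lemma hclass_add: "hadd (hclass n T z) (hclass n T w) = hclass n T (z + w)"
proof (intro equalityI subsetI)
  fix c assume "c \<in> hadd (hclass n T z) (hclass n T w)"
  then obtain b b' where "b \<in> cboundaries n T" "b' \<in> cboundaries n T" "c = (z + b) + (w + b')"
    by (auto simp: hadd_def hclass_def)
  then show "c \<in> hclass n T (z + w)"
    unfolding hclass_def using cboundaries_add[of b n T b'] by (auto simp: algebra_simps)
next
  fix c assume "c \<in> hclass n T (z + w)"
  then obtain b where b: "b \<in> cboundaries n T" "c = (z + b) + (w + 0)"
    by (auto simp: hclass_def algebra_simps)
  then show "c \<in> hadd (hclass n T z) (hclass n T w)"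
    unfolding hadd_def hclass_def using cboundaries_zero by blast
qed

lemma hclass_scale: "hscale n T a (hclass n T z) = hclass n T (cscale a z)"
proof (intro equalityI subsetI)
  fix c assume "c \<in> hscale n T a (hclass n T z)"
  then obtain b b' where b: "b \<in> cboundaries n T" "b' \<in> cboundaries n T" "c = cscale a (z + b) + b'"
    by (auto simp: hscale_def hclass_def)
  then have "c = cscale a z + (cscale a b + b')" by (simp add: cscale_add algebra_simps)
  then show "c \<in> hclass n T (cscale a z)"
    unfolding hclass_def using b cboundaries_add[OF cboundaries_scale] by blast
next
  fix c assume "c \<in> hclass n T (cscale a z)"
  then obtain b where b: "b \<in> cboundaries n T" "c = cscale a (z + 0) + b"
    by (auto simp: hclass_def)
  then show "c \<in> hscale n T a (hclass n T z)"
    unfolding hscale_def hclass_def using cboundaries_zero by blast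
qed

lemma hclass_eq_iff: "hclass n T z = hclass n T w \<longleftrightarrow> z - w \<in> cboundaries n T"
proof
  assume "hclass n T z = hclass n T w"
  moreover have "z \<in> hclass n T z" unfolding hclass_def using cboundaries_zero by force
  ultimately obtain b where "b \<in> cboundaries n T" "z = w + b" by (auto simp: hclass_def)
  then show "z - w \<in> cboundaries n T" by simp
next
  assume zw: "z - w \<in> cboundaries n T"
  have "z + b = w + ((z - w) + b)" "w + b = z + (b - (z - w))" for b by (simp_all add: algebra_simps)
  then show "hclass n T z = hclass n T w"
    unfolding hclass_def using cboundaries_add[OF zw] cboundaries_diff[OF _ zw] by blast
qed

lemma homology_subspace_hclass_image:
  assumes "M \<subseteq> ccycles n T" "0 \<in> M" "\<And>z w. z \<in> M \<Longrightarrow> w \<in> M \<Longrightarrow> z + w \<in> M"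
    "\<And>a z. z \<in> M \<Longrightarrow> cscale a z \<in> M"
  shows "homology_subspace n T (hclass n T ` M)"
  unfolding homology_subspace_def homology_C_def using assms
  by (auto simp: hclass_add hclass_scale)

lemma homology_subspace_C: "homology_subspace n T (homology_C n T)"
  unfolding homology_C_def
proof (rule homology_subspace_hclass_image)
  show "0 \<in> ccycles n T" by (simp add: ccycles_def cchains_def)
  show "z + w \<in> ccycles n T" if "z \<in> ccycles n T" "w \<in> ccycles n T" for z w
    using that by (simp add: ccycles_def cchains_add cboundary_add)
  show "cscale a z \<in> ccycles n T" if "z \<in> ccycles n T" for a z
    using that by (simp add: ccycles_def cchains_scale cboundary_scale)
qed simp

text \<open>A linear functional on chains that kills boundaries is a functional on homology. If it kills \<open>S\<close>, the
classes on which it vanishes form a subspace containing \<open>S\<close>, and a cycle with nonzero value shows that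
this subspace is proper.\<close>

lemma homology_span_proper:
  assumes S: "S \<subseteq> homology_C n T"
    and vanish: "\<And>b. b \<in> cboundaries n T \<Longrightarrow> chain_eval L b = 0"
      "\<And>z. z \<in> ccycles n T \<Longrightarrow> hclass n T z \<in> S \<Longrightarrow> chain_eval L z = 0"
    and w: "w \<in> ccycles n T" "chain_eval L w \<noteq> 0"
  shows "homology_span n T S \<subset> homology_C n T"
proof
  show "homology_span n T S \<subseteq> homology_C n T"
    unfolding homology_span_def using S homology_subspace_C by blast
  define M where "M = {z \<in> ccycles n T. chain_eval L z = 0}"
  have "homology_subspace n T (hclass n T ` M)"
  proof (rule homology_subspace_hclass_image)
    show "0 \<in> M" by (simp add: M_def ccycles_def cchains_def)
    show "z + w \<in> M" if "z \<in> M" "w \<in> M" for z w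
      using that by (simp add: M_def ccycles_def cchains_add cboundary_add chain_eval_add)
    show "cscale a z \<in> M" if "z \<in> M" for a z
      using that by (simp add: M_def ccycles_def cchains_scale cboundary_scale chain_eval_scale)
  qed (auto simp: M_def)
  moreover have "S \<subseteq> hclass n T ` M"
    using S vanish(2) by (auto simp: M_def homology_C_def)
  ultimately have sub: "homology_span n T S \<subseteq> hclass n T ` M"
    unfolding homology_span_def by blast
  have "hclass n T w \<notin> hclass n T ` M"
  proof
    assume "hclass n T w \<in> hclass n T ` M"
    then obtain z where z: "z \<in> M" "hclass n T w = hclass n T z" by blast
    then have "w - z \<in> cboundaries n T" by (simp add: hclass_eq_iff)
    then have "chain_eval L (w - z) = 0" by (rule vanish(1))
    moreover have "chain_eval L w = chain_eval L (w - z) + chain_eval L z"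
      using chain_eval_add[of L "w - z" z] by simp
    ultimately show False using z w(2) by (simp add: M_def)
  qed
  then show "homology_span n T S \<noteq> homology_C n T"
    using sub w(1) by (auto simp: homology_C_def)
qed

lemma standard_simplex_1_apply: "x \<in> standard_simplex 1 \<Longrightarrow> 0 \<le> x 1 \<and> x 1 \<le> 1"
  by (auto simp: standard_simplex_def)

lemma singular_simplex_path:
  assumes "path h" "path_image h \<subseteq> Y"
  shows "singular_simplex 1 (top_of_set Y) (path_simplex h)"
proof -
  let ?S = "subtopology (powertop_real UNIV) (standard_simplex 1)"
  have "continuous_map ?S (top_of_set {0..1}) (\<lambda>x. x 1)"
    unfolding continuous_map_in_subtopology
    using standard_simplex_1_apply
    by (auto intro!: continuous_map_from_subtopology continuous_map_product_projection)
  moreover have "continuous_map (top_of_set {0..1}) (top_of_set Y) h"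
    using assms by (auto simp: path_def path_image_def continuous_map_in_subtopology)
  ultimately have "continuous_map ?S (top_of_set Y) (h \<circ> (\<lambda>x. x 1))"
    by (rule continuous_map_compose)
  then show ?thesis
    unfolding singular_simplex_def path_simplex_def
    by (auto intro: continuous_map_eq)
qed

lemma cboundary_path_simplex:
  "cboundary 1 (Poly_Mapping.single (path_simplex h) 1) =
    Poly_Mapping.single (\<lambda>x\<in>standard_simplex 0. pathfinish h) 1 -
    Poly_Mapping.single (\<lambda>x\<in>standard_simplex 0. pathstart h) 1"
proof -
  have face: "singular_face 1 k (path_simplex h) = (\<lambda>x\<in>standard_simplex 0. h (if k = 0 then 1 else 0))" if "k \<le> 1" for k
  proof -
    have "simplical_face k x \<in> standard_simplex 1" if "x \<in> standard_simplex 0" for x :: "nat \<Rightarrow> real"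
      using simplical_face_in_standard_simplex[of 1 k x] that \<open>k \<le> 1\<close> by simp
    moreover have "simplical_face k x 1 = (if k = 0 then 1 else 0::real)" if "x \<in> standard_simplex 0" for x
      using that \<open>k \<le> 1\<close> by (auto simp: simplical_face_def standard_simplex_0)
    ultimately show ?thesis by (auto simp: singular_face_def path_simplex_def restrict_def fun_eq_iff)
  qed
  have "cboundary 1 (Poly_Mapping.single (path_simplex h) 1) =
    Poly_Mapping.single (singular_face 1 0 (path_simplex h)) 1 + Poly_Mapping.single (singular_face 1 1 (path_simplex h)) (-1)"
    by (simp add: cboundary_def)
  then show ?thesis
    using face[of 0] face[of 1] by (simp add: pathstart_def pathfinish_def single_uminus)
qed

lemma path_chain:
  assumes "path h" "path_image h \<subseteq> Y"
  shows "Poly_Mapping.single (path_simplex h) 1 \<in> cchains 1 (top_of_set Y)"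
  using singular_simplex_path[OF assms] by (simp add: cchains_def)

lemma loop_cycle:
  assumes "path h" "path_image h \<subseteq> Y" "pathfinish h = pathstart h"
  shows "Poly_Mapping.single (path_simplex h) 1 \<in> ccycles 1 (top_of_set Y)"
  using path_chain[OF assms(1,2)] assms(3) by (simp add: ccycles_def cboundary_path_simplex del: One_nat_def)

section \<open>Change of argument as a cocycle\<close>

text \<open>After adding a constant the two logarithms are lifts, with a common value, of one map through the covering
\<open>exp\<close>.\<close>

lemma logarithms_differ_by_constant:
  fixes l :: "'a::real_normed_vector \<Rightarrow> complex"
  assumes "connected S" "continuous_on S l" "continuous_on S l'" "\<And>t. t \<in> S \<Longrightarrow> exp (l t) = exp (l' t)"
    and "a \<in> S" "b \<in> S"
  shows "l a - l b = l' a - l' b"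
proof -
  define c where "c = l b - l' b"
  have c: "exp c = 1" using assms(4)[OF assms(6)] by (simp add: c_def exp_diff)
  have "l a = l' a + c"
    by (rule covering_space_lift_unique[where ?g1.0=l and ?g2.0="\<lambda>t. l' t + c" and a=b and T=S
          and f="\<lambda>t. exp (l t)", OF covering_space_exp_punctured_plane])
      (use assms c in \<open>auto simp: c_def exp_add intro!: continuous_intros\<close>)
  then show ?thesis by (simp add: c_def)
qed

text \<open>The change of the argument along a path in the punctured plane.\<close>

definition arg_increment :: "(real \<Rightarrow> complex) \<Rightarrow> real" where
  "arg_increment g = (THE r. \<exists>l. continuous_on {0..1} l \<and> (\<forall>t\<in>{0..1}. exp (l t) = g t) \<and> r = Im (l 1 - l 0))"

lemma arg_increment_eq:
  assumes "continuous_on {0..1} l" "\<And>t. t \<in> {0..1} \<Longrightarrow> exp (l t) = g t"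
  shows "arg_increment g = Im (l 1 - l 0)"
  unfolding arg_increment_def
proof (rule the_equality)
  show "\<exists>l'. continuous_on {0..1} l' \<and> (\<forall>t\<in>{0..1}. exp (l' t) = g t) \<and> Im (l 1 - l 0) = Im (l' 1 - l' 0)"
    using assms by blast
  fix r assume "\<exists>l. continuous_on {0..1} l \<and> (\<forall>t\<in>{0..1}. exp (l t) = g t) \<and> r = Im (l 1 - l 0)"
  then obtain l' where l': "continuous_on {0..1} l'" "\<forall>t\<in>{0..1}. exp (l' t) = g t" "r = Im (l' 1 - l' 0)"
    by blast
  have "l' 1 - l' 0 = l 1 - l 0"
    by (rule logarithms_differ_by_constant[of "{0..1}"]) (use assms l' in auto)
  then show "r = Im (l 1 - l 0)" using l' by simp
qed

lemma arg_increment_cong: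
  assumes "\<And>t. t \<in> {0..1} \<Longrightarrow> g t = h t"
  shows "arg_increment g = arg_increment h"
  unfolding arg_increment_def using assms by (metis (no_types, lifting))

text \<open>The factor \<open>z\<close> turns the path into the plane slit along the negative real axis, where \<^const>\<open>Ln\<close> is continuous.\<close>

lemma arg_increment_slit:
  assumes "continuous_on {0..1} g" "\<And>t. t \<in> {0..1} \<Longrightarrow> z * g t \<notin> \<real>\<^sub>\<le>\<^sub>0" "z \<noteq> 0"
  shows "arg_increment g = Im (Ln (z * g 1)) - Im (Ln (z * g 0))"
proof -
  have "arg_increment g = Im ((Ln (z * g 1) - Ln z) - (Ln (z * g 0) - Ln z))"
  proof (rule arg_increment_eq)
    show "continuous_on {0..1} (\<lambda>t. Ln (z * g t) - Ln z)"
      using assms by (intro continuous_intros) auto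
    fix t :: real assume "t \<in> {0..1}"
    then have "z * g t \<noteq> 0" using assms(2)[of t] by auto
    then show "exp (Ln (z * g t) - Ln z) = g t" using assms(3) by (simp add: exp_diff)
  qed
  then show ?thesis by simp
qed

text \<open>Conjugation reverses the change of argument, so the two halves of the path cancel.\<close>

lemma arg_increment_conjugate_halves:
  assumes g: "continuous_on {0..1} g" "\<And>t. t \<in> {0..1} \<Longrightarrow> g t \<noteq> 0"
    and half: "\<And>t. t \<in> {0..1/2} \<Longrightarrow> g (t + 1/2) = cnj (g t)"
  shows "arg_increment g = 0"
proof -
  obtain l where l: "continuous_on {0..1} l" "\<And>t. t \<in> {0..1} \<Longrightarrow> g t = exp (l t)"
    using continuous_logarithm_on_contractible[OF g(1) convex_imp_contractible] g(2) by (metis convex_real_interval(5))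
  have "l (1/2 + 1/2) - l (0 + 1/2) = cnj (l (1/2)) - cnj (l 0)"
  proof (rule logarithms_differ_by_constant[where l="\<lambda>t. l (t + 1/2)" and l'="\<lambda>t. cnj (l t)" and S="{0..1/2::real}"])
    show "continuous_on {0..1/2} (\<lambda>t. l (t + 1/2))"
      by (rule continuous_on_compose2[OF l(1)]) (auto intro!: continuous_intros)
    show "continuous_on {0..1/2} (\<lambda>t. cnj (l t))"
      by (intro continuous_intros continuous_on_subset[OF l(1)]) auto
    fix t :: real assume t: "t \<in> {0..1/2}"
    then have "t + 1/2 \<in> {0..1}" "t \<in> {0..1}" by auto
    then show "exp (l (t + 1/2)) = exp (cnj (l t))"
      using half[OF t] l(2) by (simp add: exp_cnj)
  qed auto
  then have "Im (l 1 - l (1/2)) = Im (cnj (l (1/2) - l 0))" by simp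
  moreover have "arg_increment g = Im (l 1 - l 0)"
    using l by (intro arg_increment_eq) auto
  ultimately show ?thesis by simp
qed

text \<open>Affine coordinates on the standard simplices of dimension 1 and 2. Since the simplices live in a
function space that is not a normed space, paths and logarithms are considered in these coordinates.\<close>

definition edge_point :: "real \<Rightarrow> nat \<Rightarrow> real" where
  "edge_point t = (\<lambda>k. if k = 0 then 1 - t else if k = 1 then t else 0)"

definition triangle_point :: "real \<times> real \<Rightarrow> nat \<Rightarrow> real" where
  "triangle_point = (\<lambda>(s, t) k. if k = 0 then 1 - s - t else if k = 1 then s else if k = 2 then t else 0)"

definition arg_cochain :: "('a \<Rightarrow> complex) \<Rightarrow> ((nat \<Rightarrow> real) \<Rightarrow> 'a) \<Rightarrow> complex" where
  "arg_cochain F \<sigma> = of_real (arg_increment (\<lambda>t. F (\<sigma> (edge_point t))))"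

lemma edge_point_in: "t \<in> {0..1} \<Longrightarrow> edge_point t \<in> standard_simplex 1"
  by (auto simp: edge_point_def standard_simplex_def)

lemma arg_cochain_path: "arg_cochain F (path_simplex h) = of_real (arg_increment (F \<circ> h))"
  unfolding arg_cochain_def using edge_point_in
  by (intro arg_cong[where f=of_real] arg_increment_cong) (auto simp: path_simplex_def edge_point_def)

lemma simplical_face_edge_point:
  "simplical_face 0 (edge_point x) = triangle_point (1 - x, x)"
  "simplical_face 1 (edge_point x) = triangle_point (0, x)"
  "simplical_face 2 (edge_point x) = triangle_point (x, 0)"
  by (auto simp: simplical_face_def edge_point_def triangle_point_def fun_eq_iff)

text \<open>On the triangle, which is contractible, \<open>F \<circ> f\<close> has a single continuous logarithm; its
differences along the three edges cancel.\<close>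

lemma arg_cochain_face_sum:
  assumes f: "singular_simplex 2 (top_of_set Y) f" and F: "continuous_on Y F" "\<And>y. y \<in> Y \<Longrightarrow> F y \<noteq> 0"
  shows "arg_cochain F (singular_face 2 0 f) - arg_cochain F (singular_face 2 1 f) +
    arg_cochain F (singular_face 2 2 f) = 0"
proof -
  define T where "T = {q::real \<times> real. 0 \<le> fst q \<and> 0 \<le> snd q \<and> fst q + snd q \<le> 1}"
  have tri: "triangle_point q \<in> standard_simplex 2" if "q \<in> T" for q
  proof -
    have "{..2} = {0, 1, 2::nat}" by auto
    then show ?thesis
      using that by (auto simp: T_def triangle_point_def standard_simplex_def case_prod_unfold)
  qed
  have "continuous_map (top_of_set T) (powertop_real UNIV) triangle_point"
    unfolding continuous_map_componentwise_UNIV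
  proof
    fix k :: nat
    have "continuous_on T (\<lambda>q. triangle_point q k)"
      unfolding triangle_point_def case_prod_unfold by (cases "k = 0"; cases "k = 1"; cases "k = 2"; simp; intro continuous_intros)
    then show "continuous_map (top_of_set T) euclideanreal (\<lambda>q. triangle_point q k)" by simp
  qed
  then have "continuous_map (top_of_set T) (subtopology (powertop_real UNIV) (standard_simplex 2)) triangle_point"
    using tri by (auto simp: continuous_map_in_subtopology)
  then have "continuous_map (top_of_set T) (top_of_set Y) (f \<circ> triangle_point)"
    using f unfolding singular_simplex_def by (metis continuous_map_compose)
  then have ft: "continuous_on T (f \<circ> triangle_point)" "(f \<circ> triangle_point) ` T \<subseteq> Y"
    by (auto simp: continuous_map_in_subtopology image_subset_iff)
  have "continuous_on T (\<lambda>q. F ((f \<circ> triangle_point) q))"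
    using continuous_on_compose2[OF F(1) ft] .
  moreover have "convex T"
    unfolding T_def convex_def
  proof (intro ballI allI impI)
    fix x y :: "real \<times> real" and u v :: real
    assume *: "x \<in> {q. 0 \<le> fst q \<and> 0 \<le> snd q \<and> fst q + snd q \<le> 1}" "y \<in> {q. 0 \<le> fst q \<and> 0 \<le> snd q \<and> fst q + snd q \<le> 1}"
      "0 \<le> u" "0 \<le> v" "u + v = 1"
    have "u * (fst x + snd x) + v * (fst y + snd y) \<le> u * 1 + v * 1"
      using * by (intro add_mono mult_left_mono) auto
    then show "u *\<^sub>R x + v *\<^sub>R y \<in> {q. 0 \<le> fst q \<and> 0 \<le> snd q \<and> fst q + snd q \<le> 1}"
      using * by (auto simp: algebra_simps)
  qed
  then have "contractible T" by (rule convex_imp_contractible)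
  moreover have "F ((f \<circ> triangle_point) q) \<noteq> 0" if "q \<in> T" for q
    using F(2) ft(2) that by (simp add: image_subset_iff)
  ultimately obtain l where l: "continuous_on T l" "\<And>q. q \<in> T \<Longrightarrow> F (f (triangle_point q)) = exp (l q)"
    using continuous_logarithm_on_contractible[of T "\<lambda>q. F ((f \<circ> triangle_point) q)"] by (metis comp_apply)
  have face: "arg_cochain F (singular_face 2 k f) = of_real (Im (l (c 1) - l (c 0)))"
    if "\<And>x. simplical_face k (edge_point x) = triangle_point (c x)" "continuous_on {0..1} c" "c ` {0..1} \<subseteq> T" for k c
    unfolding arg_cochain_def
  proof (intro arg_cong[where f=of_real] arg_increment_eq)
    show "continuous_on {0..1} (\<lambda>t. l (c t))" by (rule continuous_on_compose2[OF l(1) that(2,3)])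
    fix t :: real assume t: "t \<in> {0..1}"
    then have "c t \<in> T" using that(3) by blast
    then show "exp (l (c t)) = F (singular_face 2 k f (edge_point t))"
      using that(1) edge_point_in[OF t] l(2)[of "c t"] by (simp add: singular_face_def)
  qed
  have "arg_cochain F (singular_face 2 0 f) = of_real (Im (l (0, 1) - l (1, 0)))"
    using face[of 0 "\<lambda>x. (1 - x, x)"] simplical_face_edge_point(1)
    by (force simp: T_def intro!: continuous_intros)
  moreover have "arg_cochain F (singular_face 2 1 f) = of_real (Im (l (0, 1) - l (0, 0)))"
    using face[of 1 "\<lambda>x. (0, x)"] simplical_face_edge_point(2)
    by (force simp: T_def intro!: continuous_intros)
  moreover have "arg_cochain F (singular_face 2 2 f) = of_real (Im (l (1, 0) - l (0, 0)))"
    using face[of 2 "\<lambda>x. (x, 0)"] simplical_face_edge_point(3)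
    by (force simp: T_def intro!: continuous_intros)
  ultimately show ?thesis by simp
qed

lemma arg_cochain_vanishes_on_boundaries:
  assumes F: "continuous_on Y F" "\<And>y. y \<in> Y \<Longrightarrow> F y \<noteq> 0" and b: "b \<in> cboundaries 1 (top_of_set Y)"
  shows "chain_eval (arg_cochain F) b = 0"
proof -
  obtain c where c: "b = cboundary 2 c" "c \<in> cchains 2 (top_of_set Y)"
    using b by (auto simp: cboundaries_def numeral_2_eq_2)
  have "chain_eval (arg_cochain F) b =
    (\<Sum>f\<in>Poly_Mapping.keys c. \<Sum>k\<le>2. (-1) ^ k * Poly_Mapping.lookup c f * arg_cochain F (singular_face 2 k f))"
    unfolding c(1) cboundary_def by (simp add: chain_eval_sum)
  also have "\<dots> = (\<Sum>f\<in>Poly_Mapping.keys c. Poly_Mapping.lookup c f *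
     (arg_cochain F (singular_face 2 0 f) - arg_cochain F (singular_face 2 1 f) + arg_cochain F (singular_face 2 2 f)))"
    by (intro sum.cong refl) (simp add: numeral_2_eq_2 algebra_simps)
  also have "\<dots> = 0"
    using c(2) arg_cochain_face_sum[OF _ F] by (intro sum.neutral) (simp add: cchains_def)
  finally show ?thesis .
qed

section \<open>A cycle that no primitive elevations span\<close>

text \<open>With real coordinates \<open>u = x\<^sub>1 + i x\<^sub>2\<close> and \<open>v = x\<^sub>3 + i x\<^sub>4\<close> the real part \<open>(x\<^sub>1 + x\<^sub>4)(x\<^sub>2 + x\<^sub>3)\<close> is even and
the imaginary part \<open>x\<^sub>1 + x\<^sub>4 + x\<^sub>3 - x\<^sub>2\<close> is odd. Each great circle of the cover lies in a coordinate plane, on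
which the real part is the product of the two coordinates \<open>c\<close> and \<open>s\<close> and the imaginary part is
\<open>\<plusminus>c \<plusminus> s\<close>; these do not vanish together. The signs are chosen such that the function turns once along the square below.\<close>

definition phase_fun :: "quat \<Rightarrow> complex" where
  "phase_fun = (\<lambda>(u, v). Complex ((Re u + Im v) * (Im u + Re v)) (Re u + Im v + Re v - Im u))"

lemma continuous_on_phase_fun: "continuous_on S phase_fun"
  unfolding phase_fun_def case_prod_unfold Complex_eq by (intro continuous_intros)

lemma phase_fun_minus: "phase_fun (qmul (-1, 0) y) = cnj (phase_fun y)"
  by (cases y) (simp add: phase_fun_def qmul_def complex_eq_iff algebra_simps)

lemma phase_fun_nonzero:
  assumes "y \<in> Q8_cover"
  shows "phase_fun y \<noteq> 0"
proof -
  have key: False if "cos t * sin t = 0" "cos t = sin t \<or> cos t = - sin t" for t :: real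
    using that sin_cos_squared_add[of t] by (auto simp: power2_eq_square)
  show ?thesis
  proof
    assume 0: "phase_fun y = 0"
    show False
      using assms
    proof (cases rule: Q8_coverE)
      case (1 g t)
      show False
        using 0 1(2) by (cases rule: Q8_cases[OF 1(1)])
          (auto simp: phase_fun_def qmul_def complex_eq_iff intro!: key[of t])
    next
      case (2 g t)
      show False
        using 0 2(2) by (cases rule: Q8_cases[OF 2(1)])
          (auto simp: phase_fun_def qmul_def complex_eq_iff intro!: key[of t])
    qed
  qed
qed

text \<open>The arcs from \<open>1\<close> to \<open>i\<close>, to \<open>k\<close>, to \<open>-j\<close> and back to \<open>1\<close>; in coordinates, \<open>k\<close> is the pair \<open>(0, -\<i>)\<close>.\<close>

definition square_arcs :: "(real \<Rightarrow> quat) list" where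
  "square_arcs = [\<lambda>t. qmul (1, 0) (cis (t * pi / 2), 0),
     \<lambda>t. qmul (\<i>, 0) (of_real (cos (t * pi / 2)), of_real (sin (t * pi / 2))),
     \<lambda>t. qmul (0, -\<i>) (cis (- (t * pi / 2)), 0),
     \<lambda>t. qmul (0, -1) (of_real (cos (t * pi / 2)), of_real (sin (t * pi / 2)))]"

definition square_cycle :: "quat cchain" where
  "square_cycle = (\<Sum>h\<leftarrow>square_arcs. Poly_Mapping.single (path_simplex h) 1)"

lemma square_arcs_path: "h \<in> set square_arcs \<Longrightarrow> path h \<and> path_image h \<subseteq> Q8_cover"
proof -
  have "continuous_on S (\<lambda>t. (cis (c * (t * pi / 2)), 0::complex))" for c :: real and S
    by (intro continuous_intros) simp_all
  from this[of _ 1] this[of _ "-1"]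
  have "continuous_on S (\<lambda>t. (cis (t * pi / 2), 0::complex))" "continuous_on S (\<lambda>t. (cis (- (t * pi / 2)), 0::complex))" for S
    by simp_all
  moreover have "continuous_on S (\<lambda>t. (complex_of_real (cos (t * pi / 2)), complex_of_real (sin (t * pi / 2))))" for S
    by (intro continuous_intros) simp_all
  ultimately show "h \<in> set square_arcs \<Longrightarrow> path h \<and> path_image h \<subseteq> Q8_cover"
    by (auto simp: square_arcs_def path_def path_image_def Q8_eq intro!: continuous_on_qmul arc_in_Q8_cover simp del: qmul_one)
qed

lemma cchains_sum_list: "(\<And>h. h \<in> set hs \<Longrightarrow> c h \<in> cchains n T) \<Longrightarrow> (\<Sum>h\<leftarrow>hs. c h) \<in> cchains n T"
  by (induction hs) (simp_all add: cchains_add, simp add: cchains_def)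

lemma square_cycle_cycle: "square_cycle \<in> ccycles 1 (top_of_set Q8_cover)"
proof -
  have "square_cycle \<in> cchains 1 (top_of_set Q8_cover)"
    using square_arcs_path unfolding square_cycle_def
    by (intro cchains_sum_list path_chain) auto
  moreover have "cboundary 1 square_cycle = 0"
    by (simp add: square_cycle_def square_arcs_def cboundary_add cboundary_path_simplex pathstart_def pathfinish_def
       qmul_def del: One_nat_def)
  ultimately show ?thesis by (simp add: ccycles_def)
qed

text \<open>On each arc \<open>phase_fun\<close> stays in a closed half plane bounded by a line through the origin: the right one on the
first arc, the lower one on the second and third, the left one on the last. So the change of argument can be read off
the end points, which are \<open>\<i>\<close>, \<open>-\<i>\<close>, \<open>-\<i>\<close>, \<open>-\<i>\<close>, \<open>\<i>\<close> in this order.\<close>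

lemma square_cycle_value: "chain_eval (arg_cochain phase_fun) square_cycle = of_real (- 2 * pi)"
proof -
  have cs: "0 \<le> cos (t * pi / 2)" "0 \<le> sin (t * pi / 2)" if "t \<in> {0..1}" for t :: real
  proof -
    have t: "0 \<le> t" "t \<le> 1" using that by auto
    have "0 \<le> t * pi / 2" "t * pi / 2 \<le> pi / 2" using t by (auto intro!: divide_right_mono mult_left_le_one_le)
    then show "0 \<le> cos (t * pi / 2)" "0 \<le> sin (t * pi / 2)"
      using cos_ge_zero[of "t * pi / 2"] sin_ge_zero[of "t * pi / 2"] pi_gt_zero by linarith+
  qed
  have cont: "continuous_on {0..1} (phase_fun \<circ> h)" if "h \<in> set square_arcs" for h
    using square_arcs_path[OF that] unfolding path_def
    by (intro continuous_on_compose continuous_on_phase_fun) simp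
  have nz: "phase_fun (h t) \<noteq> 0" if "h \<in> set square_arcs" "t \<in> {0..1}" for h t
    using square_arcs_path[OF that(1)] that(2) by (intro phase_fun_nonzero) (auto simp: path_image_def)
  have avoid: "z \<notin> \<real>\<^sub>\<le>\<^sub>0" if "0 \<le> Re z" "z \<noteq> 0" for z :: complex
    using that by (auto simp: complex_nonpos_Reals_iff complex_eq_iff)
  have inc: "arg_increment (phase_fun \<circ> h) = Im (Ln (z * phase_fun (h 1))) - Im (Ln (z * phase_fun (h 0)))"
    if "h \<in> set square_arcs" "z \<noteq> 0" "\<And>t. t \<in> {0..1} \<Longrightarrow> 0 \<le> Re (z * phase_fun (h t))" for h z
    using arg_increment_slit[OF cont[OF that(1)], of z] that nz avoid by auto
  have i1: "Complex 0 1 = \<i>" and i2: "Complex 0 (-1) = - \<i>" by (simp_all add: complex_eq_iff)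
  have "chain_eval (arg_cochain phase_fun) square_cycle = (\<Sum>h\<leftarrow>square_arcs. of_real (arg_increment (phase_fun \<circ> h)))"
    by (simp add: square_cycle_def square_arcs_def chain_eval_add arg_cochain_path)
  moreover have "arg_increment (phase_fun \<circ> (square_arcs ! 0)) = - pi"
    using cs by (subst inc[where z=1]) (auto simp: square_arcs_def phase_fun_def qmul_def i1 i2)
  moreover have "arg_increment (phase_fun \<circ> (square_arcs ! 1)) = 0"
    using cs by (subst inc[where z="\<i>"]) (auto simp: square_arcs_def phase_fun_def qmul_def)
  moreover have "arg_increment (phase_fun \<circ> (square_arcs ! 2)) = 0"
    using cs by (subst inc[where z="\<i>"]) (auto simp: square_arcs_def phase_fun_def qmul_def)
  moreover have "arg_increment (phase_fun \<circ> (square_arcs ! 3)) = - pi"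
    using cs by (subst inc[where z="-1"]) (auto simp: square_arcs_def phase_fun_def qmul_def i1 i2)
  ultimately show ?thesis by (simp add: square_arcs_def)
qed

section \<open>Irreducible representations\<close>

text \<open>The matrix of left multiplication by \<open>q\<close>, which is complex linear for the right action of
\<open>\<complex>\<close> on the quaternions.\<close>

definition Q8_matrix :: "quat \<Rightarrow> complex mat" where
  "Q8_matrix q = Matrix.mat 2 2 (\<lambda>(i, j).
     if i = 0 then (if j = 0 then fst q else - cnj (snd q)) else (if j = 0 then snd q else cnj (fst q)))"

definition Q8_rep :: "nat matrix_rep" where
  "Q8_rep = (2, \<lambda>g. Q8_matrix (Q8_dec g))"

definition col2 :: "quat \<Rightarrow> complex Matrix.vec" where
  "col2 y = Matrix.vec 2 (\<lambda>i. if i = 0 then fst y else snd y)"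

lemma sum_below_2: "(\<Sum>i\<in>{0..<2::nat}. f i) = f 0 + f 1"
  by (simp add: numeral_2_eq_2)

lemma Q8_matrix_carrier: "Q8_matrix q \<in> carrier_mat 2 2"
  by (simp add: Q8_matrix_def)

lemma Q8_matrix_mult_vec: "Q8_matrix q *\<^sub>v col2 y = col2 (qmul q y)"
  by (rule eq_vecI) (auto simp: Q8_matrix_def col2_def scalar_prod_def qmul_def sum_below_2 less_2_cases_iff)

lemma Q8_matrix_mult: "Q8_matrix (qmul p q) = Q8_matrix p * Q8_matrix q"
  by (rule eq_matI) (auto simp: Q8_matrix_def scalar_prod_def qmul_def sum_below_2 less_2_cases_iff)

lemma Q8_matrix_one: "Q8_matrix (1, 0) = 1\<^sub>m 2"
  by (rule eq_matI) (auto simp: Q8_matrix_def less_2_cases_iff)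

lemma col2_index [simp]: "vec_index (col2 y) 0 = fst y" "vec_index (col2 y) (Suc 0) = snd y" "dim_vec (col2 y) = 2"
  by (simp_all add: col2_def)

lemma col2_surj:
  assumes "v \<in> carrier_vec 2"
  obtains y where "v = col2 y"
proof
  show "v = col2 (vec_index v 0, vec_index v 1)"
    using assms by (intro eq_vecI) (auto simp: col2_def less_2_cases_iff)
qed

lemma col2_add: "col2 x + col2 y = col2 (x + y)"
  by (rule eq_vecI) (auto simp: col2_def less_2_cases_iff)

lemma col2_smult: "c \<cdot>\<^sub>v col2 y = col2 (c * fst y, c * snd y)"
  by (rule eq_vecI) (auto simp: col2_def less_2_cases_iff)

lemma col2_zero: "0\<^sub>v 2 = col2 (0, 0)"
  by (rule eq_vecI) (auto simp: col2_def less_2_cases_iff)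

lemma is_rep_Q8: "is_rep Q8_group Q8_rep"
  by (simp add: is_rep_def Q8_rep_def Q8_matrix_carrier Q8_one Q8_matrix_one Q8_mult Q8_matrix_mult)

text \<open>The element \<open>i\<close> acts with distinct eigenvalues on the two coordinate lines, so a nonzero invariant
subspace contains one of these lines, and \<open>j\<close> exchanges them.\<close>

lemma irreducible_Q8_rep: "Q8_rep \<in> irreducible_reps Q8_group"
proof -
  have "W = {0\<^sub>v 2} \<or> W = carrier_vec 2"
    if W: "vec_subspace 2 W" and inv: "\<forall>g\<in>carrier Q8_group. \<forall>w\<in>W. Q8_matrix (Q8_dec g) *\<^sub>v w \<in> W" for W
  proof (cases "W = {0\<^sub>v 2}")
    case False
    have inv': "col2 (qmul q y) \<in> W" if "q \<in> Q8" "col2 y \<in> W" for q y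
      using inv Q8_dec_surj[OF that(1)] that(2) Q8_matrix_mult_vec by metis
    have add: "col2 (x + y) \<in> W" if "col2 x \<in> W" "col2 y \<in> W" for x y
      using W that by (simp add: vec_subspace_def flip: col2_add)
    have smult: "col2 (c * fst y, c * snd y) \<in> W" if "col2 y \<in> W" for c y
      using W that by (simp add: vec_subspace_def flip: col2_smult)
    obtain w where "w \<in> W" "w \<noteq> 0\<^sub>v 2" using W False by (auto simp: vec_subspace_def)
    then obtain a b where ab: "col2 (a, b) \<in> W" "(a, b) \<noteq> (0, 0)"
      using W col2_surj col2_zero unfolding vec_subspace_def by (metis prod.collapse subset_iff)
    have Q: "(\<i>, 0) \<in> Q8" "(0, 1) \<in> Q8" by (simp_all add: Q8_eq)
    have swap: "col2 (- y, x) \<in> W" if "col2 (x, y) \<in> W" for x y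
      using inv'[OF Q(2) that] by (simp add: qmul_def)
    have diag: "col2 (x, 0) \<in> W" if "col2 (x, y) \<in> W" for x y
    proof -
      have "col2 (\<i> * x, - \<i> * y) \<in> W" using inv'[OF Q(1) that] by (simp add: qmul_def)
      from smult[OF this, of "- \<i>"] have "col2 (x, - y) \<in> W" by (simp add: algebra_simps)
      from add[OF that this] have "col2 (2 * x, 0) \<in> W" by simp
      from smult[OF this, of "1/2"] show ?thesis by simp
    qed
    obtain x where x: "x \<noteq> 0" "col2 (x, 0) \<in> W"
    proof (cases "a = 0")
      case True
      then show ?thesis using that[of "-b"] diag[OF swap[OF ab(1)]] ab(2) by simp
    next
      case False
      then show ?thesis using that diag[OF ab(1)] by blast
    qed
    have e1: "col2 (1, 0) \<in> W" using smult[OF x(2), of "1 / x"] x(1) by simp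
    have e2: "col2 (0, 1) \<in> W" using swap[OF e1] by simp
    have "col2 y \<in> W" for y
      using add[OF smult[OF e1, of "fst y"] smult[OF e2, of "snd y"]] by simp
    then have "carrier_vec 2 \<subseteq> W" using col2_surj by blast
    then show ?thesis using W by (auto simp: vec_subspace_def)
  qed simp
  then show ?thesis
    using is_rep_Q8 by (auto simp: irreducible_reps_def Q8_rep_def)
qed

lemma Q8_rep_no_fixed_vector:
  assumes "g \<in> carrier Q8_group" "qmul (Q8_dec g) (Q8_dec g) = (-1, 0)"
    "v \<in> carrier_vec 2" "snd Q8_rep g *\<^sub>v v = v"
  shows "v = 0\<^sub>v 2"
proof -
  obtain y where y: "v = col2 y" using col2_surj[OF assms(3)] .
  have "col2 (qmul (Q8_dec g) y) = col2 y"
    using assms(4) y by (simp add: Q8_rep_def Q8_matrix_mult_vec)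
  then have "col2 (qmul (Q8_dec g) (qmul (Q8_dec g) y)) = col2 y"
    by (metis Q8_matrix_mult_vec)
  then have "col2 (qmul (-1, 0) y) = col2 y" using assms(2) by (simp flip: qmul_assoc)
  then have eq: "col2 (- fst y, - snd y) = col2 y" by (simp add: qmul_def)
  have "- fst y = fst y" using arg_cong[OF eq, of "\<lambda>v. vec_index v 0"] by simp
  moreover have "- snd y = snd y" using arg_cong[OF eq, of "\<lambda>v. vec_index v 1"] by simp
  ultimately have "y = (0, 0)" by (simp add: prod_eq_iff neg_eq_iff_add_eq_0 flip: mult_2)
  then show ?thesis using y col2_zero by simp
qed

lemma fixed_vector_isomorphic:
  assumes iso: "rep_isomorphic G (n, \<rho>) (m, \<sigma>)" and rep: "is_rep G (n, \<rho>)" "is_rep G (m, \<sigma>)"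
    and g: "g \<in> carrier G" and v: "v \<in> carrier_vec n" "v \<noteq> 0\<^sub>v n" "\<rho> g *\<^sub>v v = v"
  obtains w where "w \<in> carrier_vec m" "w \<noteq> 0\<^sub>v m" "\<sigma> g *\<^sub>v w = w"
proof -
  obtain P Q where PQ: "P \<in> carrier_mat m n" "Q \<in> carrier_mat n m" "Q * P = 1\<^sub>m n" "P * \<rho> g = \<sigma> g * P"
    using iso g by (auto simp: rep_isomorphic_def)
  have car: "\<rho> g \<in> carrier_mat n n" "\<sigma> g \<in> carrier_mat m m" using rep g by (auto simp: is_rep_def)
  have "\<sigma> g *\<^sub>v (P *\<^sub>v v) = P *\<^sub>v v"
    using assoc_mult_mat_vec[OF car(2) PQ(1) v(1)] assoc_mult_mat_vec[OF PQ(1) car(1) v(1)] PQ(4) v(3) by simp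
  moreover have "P *\<^sub>v v \<noteq> 0\<^sub>v m"
  proof
    assume "P *\<^sub>v v = 0\<^sub>v m"
    moreover have "Q *\<^sub>v 0\<^sub>v m = 0\<^sub>v n" using PQ(2) by (intro eq_vecI) auto
    ultimately have "v = 0\<^sub>v n" using assoc_mult_mat_vec[OF PQ(2,1) v(1)] PQ(3) v(1) by simp
    then show False using v by simp
  qed
  ultimately show ?thesis using that[of "P *\<^sub>v v"] PQ(1) v by simp
qed

lemma rep_isomorphic_refl: "is_rep G V \<Longrightarrow> rep_isomorphic G V V"
  unfolding rep_isomorphic_def is_rep_def by (cases V) (auto intro!: bexI[of _ "1\<^sub>m _"])

text \<open>Having a nonzero vector fixed by \<open>\<phi>(\<gamma>)\<close> is invariant under isomorphism, so one
irreducible representation without such vectors keeps its whole class out of \<open>Irr_pr\<close>.\<close>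

lemma Irr_pr_proper:
  assumes V: "V \<in> irreducible_reps G" and F: "\<And>\<gamma>. primitive_element F \<gamma> \<Longrightarrow> \<phi> \<gamma> \<in> carrier G"
    and no_fixed: "\<And>\<gamma> v. primitive_element F \<gamma> \<Longrightarrow> v \<in> carrier_vec (fst V) \<Longrightarrow> snd V (\<phi> \<gamma>) *\<^sub>v v = v \<Longrightarrow> v = 0\<^sub>v (fst V)"
  shows "Irr_pr F \<phi> G \<subset> Irr G"
proof
  show "Irr_pr F \<phi> G \<subseteq> Irr G"
    by (auto simp: Irr_pr_def Irr_def quotient_def)
  have rep: "is_rep G W" if "W \<in> irreducible_reps G" for W using that by (auto simp: irreducible_reps_def)
  have V_in: "irrep_iso_rel G `` {V} \<in> Irr G" using V by (auto simp: Irr_def quotient_def)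
  have "irrep_iso_rel G `` {V} \<notin> Irr_pr F \<phi> G"
  proof
    assume "irrep_iso_rel G `` {V} \<in> Irr_pr F \<phi> G"
    then obtain n \<rho> \<gamma> v where W: "(n, \<rho>) \<in> irreducible_reps G" and \<gamma>: "primitive_element F \<gamma>"
      and v: "v \<in> carrier_vec n" "v \<noteq> 0\<^sub>v n" "\<rho> (\<phi> \<gamma>) *\<^sub>v v = v"
      and eq: "irrep_iso_rel G `` {V} = irrep_iso_rel G `` {(n, \<rho>)}"
      unfolding Irr_pr_def by (auto elim!: quotientE)
    have "V \<in> irrep_iso_rel G `` {V}"
      using V rep_isomorphic_refl[OF rep[OF V]] by (simp add: irrep_iso_rel_def)
    then have "rep_isomorphic G (n, \<rho>) V" unfolding eq by (simp add: irrep_iso_rel_def)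
    then have iso: "rep_isomorphic G (n, \<rho>) (fst V, snd V)" by simp
    have repV: "is_rep G (fst V, snd V)" using rep[OF V] by simp
    obtain w where "w \<in> carrier_vec (fst V)" "w \<noteq> 0\<^sub>v (fst V)" "snd V (\<phi> \<gamma>) *\<^sub>v w = w"
      using fixed_vector_isomorphic[OF iso rep[OF W] repV F[OF \<gamma>] v] by metis
    then show False using no_fixed[OF \<gamma>] by blast
  qed
  then show "Irr_pr F \<phi> G \<noteq> Irr G" using V_in by blast
qed

section \<open>Elevations of primitive loops\<close>

text \<open>Let \<open>q\<close> be the value of the primitive loop. The lift of \<open>g\<^sup>k\<close> passes through \<open>1, q, q\<^sup>2, \<dots>\<close>, and
\<open>q\<close> has order 4, so the preferred elevation makes four turns. Two of them are left multiplication by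
\<open>q\<^sup>2 = -1\<close>, which commutes with the deck transformations and so has the same effect on every elevation.\<close>

lemma primitive_elevation:
  assumes g: "g \<in> loops figure_eight 0" "primitive_element pi1 (loop_class figure_eight g)"
    and e: "e \<in> elevations Q8_cover Q8_proj (1, 0) g"
  shows "path e" "path_image e \<subseteq> Q8_cover" "pathfinish e = pathstart e"
    "\<And>t. t \<in> {0..1/2} \<Longrightarrow> e (t + 1/2) = qmul (-1, 0) (e t)"
proof -
  obtain \<tau> h where \<tau>: "\<tau> \<in> deck_transformations Q8_cover Q8_proj" and h: "preferred_elevation Q8_cover Q8_proj (1, 0) g h"
    and eh: "e = \<tau> \<circ> h"
    using e by (auto simp: elevations_def)
  obtain v where v: "v \<in> carrier Q8_group" "\<tau> = restrict (qmul (Q8_dec v)) Q8_cover"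
    using \<tau> unfolding Q8.deck_transformations_eq by blast
  obtain k where k: "1 \<le> k" "is_lift Q8_cover Q8_proj (1, 0) (loop_power g k) h" "pathfinish h = pathstart h"
    and minimal: "\<And>j h'. 1 \<le> j \<Longrightarrow> j < k \<Longrightarrow> is_lift Q8_cover Q8_proj (1, 0) (loop_power g j) h' \<Longrightarrow> pathfinish h' \<noteq> pathstart h'"
    using h by (auto simp: preferred_elevation_def)
  define q where "q = Q8_value (loop_class figure_eight g)"
  have qq: "qmul q q = (-1, 0)" using primitive_value_square[OF g(2)] by (simp add: q_def)
  have vertices: "h (real j / real k) = (qmul q ^^ j) (1, 0)" if "j \<le> k" for j
    using Q8.lift_power_vertices[OF g(1) k(2,1) that] by (simp add: q_def)
  have pow: "(qmul q ^^ 1) (1, 0) = q" "(qmul q ^^ 2) (1, 0) = qmul q q"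
    "(qmul q ^^ 3) (1, 0) = qmul q (qmul q q)" "(qmul q ^^ 4) (1, 0) = qmul q (qmul q (qmul q q))"
    by (simp_all add: numeral_eq_Suc)
  have "qmul q (qmul q (qmul q q)) = qmul (qmul q q) (qmul q q)" by (simp only: qmul_assoc)
  then have pow4: "(qmul q ^^ 4) (1, 0) = (1, 0)"
    unfolding pow(4) by (simp add: qq) (simp add: qmul_def)
  have "(qmul q ^^ (k mod 4)) (1, 0) = (1, 0)"
    using funpow_mod_eq[OF pow4, of k] vertices[of k] k by (simp add: is_lift_def pathfinish_def pathstart_def)
  moreover have "k mod 4 < 4" by simp
  then have "k mod 4 = 0 \<or> k mod 4 = 1 \<or> k mod 4 = 2 \<or> k mod 4 = 3" by linarith
  moreover have "q \<noteq> (1, 0)" "qmul q q \<noteq> (1, 0)" using qq by auto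
  moreover have "qmul q (qmul q q) \<noteq> (1, 0)"
  proof
    assume "qmul q (qmul q q) = (1, 0)"
    moreover have "q = qmul (qmul q (-1, 0)) (-1, 0)" by (simp add: qmul_def)
    ultimately have "q = (-1, 0)" unfolding qq by simp
    then show False using qq by (simp add: qmul_def)
  qed
  ultimately have "k mod 4 = 0" using pow(1-3) by metis
  then have k4: "4 \<le> k" using k(1) by presburger
  have "k = 4"
  proof (rule ccontr)
    assume "k \<noteq> 4"
    then have "4 < k" using k4 by simp
    moreover have "is_lift Q8_cover Q8_proj (1, 0) (loop_power g 4) (\<lambda>t. h (real 4 / real k * t))"
      using k4 by (intro Q8.is_lift_power_restrict[OF k(2)]) auto
    ultimately show False
      using minimal[of 4 "\<lambda>t. h (real 4 / real k * t)"] vertices[of 4] vertices[of 0] pow4 by (auto simp: pathfinish_def pathstart_def)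
  qed
  have shift: "h (s + 1/4) = qmul q (h s)" if "0 \<le> s" "s \<le> 3/4" for s
    using Q8.lift_power_shift[OF g(1) k(2,1), of s] that \<open>k = 4\<close> by (simp add: q_def)
  have half: "h (t + 1/2) = qmul (-1, 0) (h t)" if "t \<in> {0..1/2}" for t
  proof -
    have "h ((t + 1/4) + 1/4) = qmul q (h (t + 1/4))" using that by (intro shift) auto
    also have "\<dots> = qmul (qmul q q) (h t)" using that by (subst shift) (auto simp: qmul_assoc)
    finally show ?thesis by (simp add: qq add.commute)
  qed
  have hY: "h t \<in> Q8_cover" if "t \<in> {0..1}" for t
    using k(2) that by (auto simp: is_lift_def path_image_def)
  have e_eq: "e t = qmul (Q8_dec v) (h t)" if "t \<in> {0..1}" for t
    using hY[OF that] by (simp add: eh v)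
  have "path (qmul (Q8_dec v) \<circ> h)"
    using k(2) by (intro path_continuous_image continuous_on_qmul continuous_on_id) (auto simp: is_lift_def)
  then show "path e" by (rule path_eq) (use e_eq in auto)
  show "path_image e \<subseteq> Q8_cover"
  proof
    fix y assume "y \<in> path_image e"
    then obtain t where "t \<in> {0..1}" "y = e t" by (auto simp: path_image_def)
    then show "y \<in> Q8_cover" using e_eq[of t] hY[of t] qmul_Q8_cover[OF Q8_dec_in[OF v(1)]] by metis
  qed
  show "pathfinish e = pathstart e" using k(3) by (simp add: eh pathfinish_def pathstart_def)
  show "e (t + 1/2) = qmul (-1, 0) (e t)" if t: "t \<in> {0..1/2}" for t
  proof -
    have "e (t + 1/2) = qmul (Q8_dec v) (qmul (-1, 0) (h t))" using e_eq[of "t + 1/2"] half[OF t] t by simp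
    also have "\<dots> = qmul (-1, 0) (qmul (Q8_dec v) (h t))" by (simp add: qmul_def)
    finally show ?thesis using e_eq[of t] t by simp
  qed
qed

text \<open>Along an elevation \<open>e\<close> of a primitive loop, \<open>phase_fun\<close> takes conjugate values on the two halves because
\<open>e(t + 1/2) = -e(t)\<close>. So the change of its argument is a functional that separates the square cycle from all these
elevations.\<close>

lemma H1_prim_proper: "H1_prim figure_eight 0 Q8_cover Q8_proj (1, 0) \<subset> H1_C Q8_cover"
  unfolding H1_prim_def H1_C_def
proof (rule homology_span_proper)
  let ?S = "{loop_homology_class Q8_cover e |e g. g \<in> loops figure_eight 0 \<and>
      primitive_element pi1 (loop_class figure_eight g) \<and> e \<in> elevations Q8_cover Q8_proj (1, 0) g}"
  show "?S \<subseteq> homology_C 1 (top_of_set Q8_cover)"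
  proof
    fix A assume "A \<in> ?S"
    then obtain e g where g: "g \<in> loops figure_eight 0" "primitive_element pi1 (loop_class figure_eight g)"
      "e \<in> elevations Q8_cover Q8_proj (1, 0) g" and A: "A = loop_homology_class Q8_cover e"
      by blast
    show "A \<in> homology_C 1 (top_of_set Q8_cover)"
      unfolding A loop_homology_class_def homology_C_def
      by (intro imageI loop_cycle primitive_elevation(1-3)[OF g])
  qed
  show boundary: "chain_eval (arg_cochain phase_fun) b = 0" if "b \<in> cboundaries 1 (top_of_set Q8_cover)" for b
    using continuous_on_phase_fun phase_fun_nonzero that by (rule arg_cochain_vanishes_on_boundaries)
  show "chain_eval (arg_cochain phase_fun) z = 0" if z: "hclass 1 (top_of_set Q8_cover) z \<in> ?S" for z
  proof -
    obtain e g where g: "g \<in> loops figure_eight 0" "primitive_element pi1 (loop_class figure_eight g)"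
      "e \<in> elevations Q8_cover Q8_proj (1, 0) g" and z_eq: "hclass 1 (top_of_set Q8_cover) z = loop_homology_class Q8_cover e"
      using z by blast
    note e = primitive_elevation[OF g]
    have "arg_increment (phase_fun \<circ> e) = 0"
    proof (rule arg_increment_conjugate_halves)
      show "continuous_on {0..1} (phase_fun \<circ> e)"
        using e(1) unfolding path_def by (intro continuous_on_compose continuous_on_phase_fun)
      show "(phase_fun \<circ> e) t \<noteq> 0" if "t \<in> {0..1}" for t
        using e(2) that phase_fun_nonzero[of "e t"] by (auto simp: path_image_def image_subset_iff)
      show "(phase_fun \<circ> e) (t + 1/2) = cnj ((phase_fun \<circ> e) t)" if "t \<in> {0..1/2}" for t
        using e(4)[OF that] by (simp add: phase_fun_minus)
    qed
    then have "chain_eval (arg_cochain phase_fun) (Poly_Mapping.single (path_simplex e) 1) = 0"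
      by (simp add: arg_cochain_path)
    moreover have "chain_eval (arg_cochain phase_fun) (z - Poly_Mapping.single (path_simplex e) 1) = 0"
      using z_eq by (intro boundary) (simp add: loop_homology_class_def hclass_eq_iff)
    ultimately show ?thesis
      using chain_eval_add[of "arg_cochain phase_fun" "z - Poly_Mapping.single (path_simplex e) 1" "Poly_Mapping.single (path_simplex e) 1"]
      by simp
  qed
  show "square_cycle \<in> ccycles 1 (top_of_set Q8_cover)" by (rule square_cycle_cycle)
  show "chain_eval (arg_cochain phase_fun) square_cycle \<noteq> 0" by (simp add: square_cycle_value)
qed

lemma Irr_pr_Q8_proper: "Irr_pr pi1 Q8.monodromy Q8_group \<subset> Irr Q8_group"
proof (rule Irr_pr_proper[OF irreducible_Q8_rep])
  fix \<gamma> assume \<gamma>: "primitive_element pi1 \<gamma>"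
  then show in_G: "Q8.monodromy \<gamma> \<in> carrier Q8_group"
    using primitive_value_noncentral(1) monodromy_in by blast
  fix v assume "v \<in> carrier_vec (fst Q8_rep)" "snd Q8_rep (Q8.monodromy \<gamma>) *\<^sub>v v = v"
  then show "v = 0\<^sub>v (fst Q8_rep)"
    using Q8_rep_no_fixed_vector[OF in_G primitive_value_square[OF \<gamma>]] by (simp add: Q8_rep_def)
qed

theorem theorem1p7:
  shows "\<exists>(G :: nat monoid) (\<phi> :: (real \<Rightarrow> complex) set \<Rightarrow> nat)
           (Y :: (complex \<times> complex) set) (p :: complex \<times> complex \<Rightarrow> complex) (y0 :: complex \<times> complex).
           group G \<and> finite (carrier G) \<and> two_step_nilpotent G \<and>
           is_G_cover figure_eight 0 G \<phi> Y p y0 \<and>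
           Irr_pr (fundamental_group figure_eight 0) \<phi> G \<subset> Irr G \<and>
           H1_prim figure_eight 0 Y p y0 \<subset> H1_C Y"
proof (intro exI conjI)
  show "group Q8_group" by (rule group_Q8)
  show "finite (carrier Q8_group)" by (simp add: Q8_group_def)
  show "two_step_nilpotent Q8_group" by (rule two_step_nilpotent_Q8)
  show "is_G_cover figure_eight 0 Q8_group Q8.monodromy Q8_cover Q8_proj (1, 0)" by (rule Q8.is_G_cover)
  show "Irr_pr (fundamental_group figure_eight 0) Q8.monodromy Q8_group \<subset> Irr Q8_group"
    by (rule Irr_pr_Q8_proper)
  show "H1_prim figure_eight 0 Q8_cover Q8_proj (1, 0) \<subset> H1_C Q8_cover" by (rule H1_prim_proper)
qed

end
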